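(* Let $\alpha\ge0$, consider a very simple family of trees with degree generating function $\Phi$, and let $Y_n$ be the total cost of one-sided destruction of a random tree of size $n$ from this family with toll $t_n=n^\alpha$. Define $\sigma:=\tau\sqrt{\Phi''(\tau)/\Phi(\tau)}$ and $\alpha':=\alpha+\frac12$. Then for every integer $s\ge1$ the moments $\mu_n^{[s]}:=\mathbf E\,Y_n^s$ satisfy, as $n\to\infty$, $$\mu_n^{[s]}=\frac{s!\,\sigma^s}{2^{s/2}}\prod_{j=1}^s\frac{\Gamma(j\alpha')}{\Gamma(j\alpha'+\frac12)}\,n^{s\alpha'}+O\big(n^{s\alpha'-q}\big),$$ with $q:=\frac12-\epsilon$ if $\alpha\in\{0,1/2\}$, where $\epsilon>0$ is arbitrarily small, and $q:=\min\{\alpha,1/2\}$ otherwise. Thus $$\sigma^{-1}n^{-\alpha'}Y_n\to Y^{(\alpha)}\quad\text{in distribution},$$ where $Y^{(\alpha)}$ has the unique distribution with (for $s\ge1$) $s$th moment $$m_s=\frac{s!}{2^{s/2}}\prod_{j=1}^s\frac{\Gamma(j\alpha')}{\Gamma(j\alpha'+\frac12)}.$$ In particular, when $\alpha=0$ (i.e. $t_n\equiv1$), $\sigma^{-1}n^{-1/2}Y_n$ converges in distribution to a standard Rayleigh distributed random variable $Y^{(0)}$ with density $f(y)=ye^{-y^2/2}$, $y\ge0$. In this case the asymptotics of $\mu_n^{[s]}$ can be sharpened to $$\mu_n^{[s]}=\frac{s!\,\sigma^s\sqrt\pi}{2^{s/2}\,\Gamma(\frac{s+1}{2})}\,n^{s/2}\left[1+O\Big(\frac{\log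 n}{\sqrt n}\Big)\right].$$
   Context: Very simple families. A simply generated family is given by a degree generating function $\Phi(t)=\sum_{k\ge0}\phi_kt^k$ with $\phi_k\ge0$, $\phi_0=1$: each ordered rooted tree $T$ has weight $w(T)=\prod_{v\in T}\phi_{d(v)}$ ($d(v)$ = outdegree of $v$), $T_n$ is the total weight of the trees with $n$ nodes, and a random tree of size $n$ equals $T$ with probability $w(T)/T_n$. The generating function $T(z)=\sum_{n\ge1}T_nz^n$ satisfies $T(z)=z\Phi(T(z))$. Put $\alpha_i:=\phi_{i+1}/\phi_i$ for $i=0,1$. The family is very simple if $\alpha_0>0$ and $\Phi$ is one of the following; each type has associated constants $a_1,a_0$: (A) $\Phi(t)=e^{\alpha_0t}$, with $a_1=\alpha_0$, $a_0=0$; (B) $\Phi(t)=(1+\alpha_0t/d)^d$ with an integer $d\ge2$, with $a_1=\alpha_0\frac{d-1}{d}$, $a_0=\frac{\alpha_0}{d}$; (C) $\Phi(t)=[1-(2\alpha_1-\alpha_0)t]^{-\alpha_0/(2\alpha_1-\alpha_0)}$ with $2\alpha_1-\alpha_0>0$, with $a_1=2\alpha_1$, $a_0=-(2\alpha_1-\alpha_0)$. Let $\tau$ be the unique root of $t\Phi'(t)=\Phi(t)$ in $0<t<R$, where $R$ is the radius of convergence of $\Phi$. One-sided destruction. From a random tree of size $n\ge2$ of the family, a uniformly random edge is cut at cost $t_n$, separating the tree into two components; the component not containing the root is discarded and the process continues recursively on the component containing the root until the root is isolated. For very simple families, conditionally on its size the component containing the root is a random tree of the same family, and its size $K_n$ satisfies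 $$\Pr[K_n=k]=p_{n,k}=(a_1k+a_0)\frac{T_kT_{n-k}}{(n-1)T_n},\qquad 1\le k\le n-1.$$ The total cost $Y_n$ has the law determined by $Y_1=t_1$ and, for $n\ge2$, $Y_n\overset{d}{=}Y_{K_n}+t_n$, where $K_n$ is independent of $(Y_j)_{j\ge1}$. *)

theory Defs
  imports "HOL-Probability.Probability"
begin

section \<open>Ordered rooted trees and simply generated families\<close>

datatype ordered_tree = Tree_Node (children: "ordered_tree list")

primrec num_nodes :: "ordered_tree \<Rightarrow> nat" where
  "num_nodes (Tree_Node ts) = Suc (sum_list (map num_nodes ts))"

primrec tree_weight :: "real fps \<Rightarrow> ordered_tree \<Rightarrow> real" where
  "tree_weight \<Phi> (Tree_Node ts) = fps_nth \<Phi> (length ts) * prod_list (map (tree_weight \<Phi>) ts)"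

definition total_weight :: "real fps \<Rightarrow> nat \<Rightarrow> real" where
  "total_weight \<Phi> n = (\<Sum>T | num_nodes T = n. tree_weight \<Phi> T)"

text \<open>
  As \<^const>\<open>embed_pmf\<close> requires, the mass function is nonnegative and sums to 1 whenever
  the coefficients are nonnegative and \<^term>\<open>total_weight \<Phi> n > 0\<close>; a very simple
  family satisfies the latter for all \<^term>\<open>n \<ge> 1\<close>.  For other arguments the value is arbitrary.
\<close>
definition random_tree :: "real fps \<Rightarrow> nat \<Rightarrow> ordered_tree pmf" where
  "random_tree \<Phi> n =
     embed_pmf (\<lambda>T. if num_nodes T = n then tree_weight \<Phi> T / total_weight \<Phi> n else 0)"

definition simply_generated :: "real fps \<Rightarrow> bool" where
  "simply_generated \<Phi> \<longleftrightarrow> (\<forall>k. fps_nth \<Phi> k \<ge> 0) \<and> fps_nth \<Phi> 0 = 1"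

definition coeff_ratio :: "real fps \<Rightarrow> nat \<Rightarrow> real" where
  "coeff_ratio \<Phi> i = fps_nth \<Phi> (i + 1) / fps_nth \<Phi> i"

text \<open>
  In type C, the series \<^term>\<open>fps_binomial a\<close> is the expansion of \<open>(1 + t)\<close> to the real
  power \<open>a\<close>; substituting \<open>-(2\<alpha>\<^sub>1 - \<alpha>\<^sub>0)t\<close> for \<open>t\<close> gives the required binomial series.
\<close>
definition very_simple :: "real fps \<Rightarrow> bool" where
  "very_simple \<Phi> \<longleftrightarrow> simply_generated \<Phi> \<and>
     (let \<alpha>\<^sub>0 = coeff_ratio \<Phi> 0; \<alpha>\<^sub>1 = coeff_ratio \<Phi> 1 in
        \<alpha>\<^sub>0 > 0 \<and>
        (\<Phi> = fps_exp \<alpha>\<^sub>0 \<or>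
         (\<exists>d\<ge>2. \<Phi> = (1 + fps_const (\<alpha>\<^sub>0 / of_nat d) * fps_X) ^ d) \<or>
         (2 * \<alpha>\<^sub>1 - \<alpha>\<^sub>0 > 0 \<and>
          \<Phi> = fps_compose (fps_binomial (- \<alpha>\<^sub>0 / (2 * \<alpha>\<^sub>1 - \<alpha>\<^sub>0)))
                           (fps_const (- (2 * \<alpha>\<^sub>1 - \<alpha>\<^sub>0)) * fps_X))))"

definition char_root :: "real fps \<Rightarrow> real" where
  "char_root \<Phi> = (THE t. 0 < t \<and> ereal t < fps_conv_radius \<Phi> \<and>
     t * eval_fps (fps_deriv \<Phi>) t = eval_fps \<Phi> t)"

definition scaling_sigma :: "real fps \<Rightarrow> real" where
  "scaling_sigma \<Phi> = (let \<tau> = char_root \<Phi> in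
     \<tau> * sqrt (eval_fps (fps_deriv (fps_deriv \<Phi>)) \<tau> / eval_fps \<Phi> \<tau>))"

section \<open>One-sided destruction\<close>

text \<open>
  A node is addressed by the list of child indices on the path leading to it from the root,
  and an edge by the address of its endpoint farther from the root.
\<close>
fun is_node :: "nat list \<Rightarrow> ordered_tree \<Rightarrow> bool" where
  "is_node [] T = True"
| "is_node (i # p) T = (i < length (children T) \<and> is_node p (children T ! i))"

definition tree_edges :: "ordered_tree \<Rightarrow> nat list set" where
  "tree_edges T = {p. p \<noteq> [] \<and> is_node p T}"

text \<open>The component containing the root after the edge with the given address has been cut.\<close>
fun root_component :: "nat list \<Rightarrow> ordered_tree \<Rightarrow> ordered_tree" where
  "root_component [] T = T"
| "root_component [i] T = Tree_Node (take i (children T) @ drop (Suc i) (children T))"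
| "root_component (i # j # p) T =
     Tree_Node ((children T)[i := root_component (j # p) (children T ! i)])"

lemma num_nodes_children: "num_nodes T = Suc (sum_list (map num_nodes (children T)))"
  by (cases T) simp

lemma num_nodes_pos: "num_nodes T > 0"
  by (cases T) simp

lemma is_node_Cons_set:
  "{p. is_node p T} = insert [] (\<Union>i<length (children T). (#) i ` {p. is_node p (children T ! i)})"
proof (rule set_eqI)
  fix p show "p \<in> {p. is_node p T} \<longleftrightarrow>
    p \<in> insert [] (\<Union>i<length (children T). (#) i ` {p. is_node p (children T ! i)})"
    by (cases p) auto
qed

lemma finite_is_node: "finite {p. is_node p T}"
proof (induction T)
  case (Tree_Node ts)
  then show ?case
    by (subst is_node_Cons_set) (auto intro!: finite_imageI)
qed

lemma finite_tree_edges: "finite (tree_edges T)"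
  unfolding tree_edges_def by (rule finite_subset[OF _ finite_is_node[of T]]) auto

lemma tree_edges_nonempty:
  assumes "num_nodes T \<noteq> 1"
  shows "tree_edges T \<noteq> {}"
proof -
  from assms have "children T \<noteq> []" by (auto simp: num_nodes_children[of T])
  then have "[0] \<in> tree_edges T" by (simp add: tree_edges_def)
  then show ?thesis by blast
qed

lemma num_nodes_root_component:
  assumes "p \<noteq> []" "is_node p T"
  shows "num_nodes (root_component p T) < num_nodes T"
  using assms
proof (induction p T rule: root_component.induct)
  case (2 i T)
  let ?ts = "children T"
  have i: "i < length ?ts" using 2 by simp
  have "sum_list (map num_nodes ?ts) =
      sum_list (map num_nodes (take i ?ts @ ?ts ! i # drop (Suc i) ?ts))"
    using id_take_nth_drop[OF i] by simp
  then show ?case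
    using num_nodes_pos[of "?ts ! i"] by (simp add: num_nodes_children[of T])
next
  case (3 i j p T)
  let ?ts = "children T" and ?r = "root_component (j # p) (children T ! i)"
  have i: "i < length ?ts" using 3 by simp
  have less: "num_nodes ?r < num_nodes (?ts ! i)" using 3 by simp
  have "sum_list (map num_nodes ?ts) =
      sum_list (map num_nodes (take i ?ts @ ?ts ! i # drop (Suc i) ?ts))"
    using id_take_nth_drop[OF i] by simp
  moreover have "?ts[i := ?r] = take i ?ts @ ?r # drop (Suc i) ?ts"
    by (rule upd_conv_take_nth_drop[OF i])
  ultimately show ?case
    using less by (simp add: num_nodes_children[of T])
qed simp

text \<open>
  The law of the total cost of destroying a fixed tree with toll sequence \<open>t\<close>.  An isolated
  root incurs the cost \<open>t 1\<close>.
\<close>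
function destruction_cost :: "(nat \<Rightarrow> real) \<Rightarrow> ordered_tree \<Rightarrow> real pmf" where
  "destruction_cost t T =
     (if num_nodes T = 1 then return_pmf (t 1)
      else bind_pmf (pmf_of_set (tree_edges T))
             (\<lambda>e. map_pmf (\<lambda>y. y + t (num_nodes T)) (destruction_cost t (root_component e T))))"
  by pat_completeness auto
termination
proof (relation "Wellfounded.measure (\<lambda>(t, T). num_nodes T)")
  fix t :: "nat \<Rightarrow> real" and T e
  assume "num_nodes T \<noteq> 1" and "e \<in> set_pmf (pmf_of_set (tree_edges T))"
  then have "e \<in> tree_edges T"
    by (simp add: set_pmf_of_set tree_edges_nonempty finite_tree_edges)
  then show "((t, root_component e T), (t, T)) \<in> Wellfounded.measure (\<lambda>(t, T). num_nodes T)"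
    by (simp add: tree_edges_def num_nodes_root_component)
qed simp

declare destruction_cost.simps [simp del]

definition total_cost :: "real fps \<Rightarrow> (nat \<Rightarrow> real) \<Rightarrow> nat \<Rightarrow> real pmf" where
  "total_cost \<Phi> t n = bind_pmf (random_tree \<Phi> n) (destruction_cost t)"

definition power_cost :: "real fps \<Rightarrow> real \<Rightarrow> nat \<Rightarrow> real pmf" where
  "power_cost \<Phi> \<alpha> = total_cost \<Phi> (\<lambda>n. real n powr \<alpha>)"

definition cost_moment :: "real fps \<Rightarrow> real \<Rightarrow> nat \<Rightarrow> nat \<Rightarrow> real" where
  "cost_moment \<Phi> \<alpha> s n = measure_pmf.expectation (power_cost \<Phi> \<alpha> n) (\<lambda>y. y ^ s)"

section \<open>The limit law\<close>

definition limit_moment :: "real \<Rightarrow> nat \<Rightarrow> real" where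
  "limit_moment \<alpha> s = fact s / 2 powr (real s / 2) *
     (\<Prod>j=1..s. Gamma (real j * (\<alpha> + 1/2)) / Gamma (real j * (\<alpha> + 1/2) + 1/2))"

definition has_limit_moments :: "real \<Rightarrow> real measure \<Rightarrow> bool" where
  "has_limit_moments \<alpha> \<nu> \<longleftrightarrow> real_distribution \<nu> \<and>
     (\<forall>s\<ge>1. integrable \<nu> (\<lambda>y. y ^ s) \<and> (\<integral>y. y ^ s \<partial>\<nu>) = limit_moment \<alpha> s)"

definition rayleigh :: "real measure" where
  "rayleigh = density lborel (\<lambda>y. ennreal (if y \<ge> 0 then y * exp (- y\<^sup>2 / 2) else 0))"

end

theory Submission
  imports Defs "HOL-Real_Asymp.Real_Asymp"
begin

text \<open>
  The process is a Markov chain on sizes, and the theorem is about the additive functional \<open>Y\<^sub>n\<close> of this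
  chain with toll \<open>t\<^sub>n = n\<^sup>\<alpha>\<close>.

  All three types of very simple families satisfy \<open>(k + 1) \<phi>\<^sub>k\<^sub>+\<^sub>1 = (\<alpha>\<^sub>0 - a\<^sub>0 k) \<phi>\<^sub>k\<close>
  (\<open>very_simple_linear_ratio\<close>), equivalently \<open>(1 + a\<^sub>0 t) \<Phi>' = \<alpha>\<^sub>0 \<Phi>\<close>.  With \<open>a\<^sub>1 = \<alpha>\<^sub>0 - a\<^sub>0\<close>, this recurrence has
  three consequences.  The number of ways to graft a subtree onto a tree with \<open>k\<close> nodes, counted by
  weight, is proportional to \<open>a\<^sub>1 k + a\<^sub>0\<close>, which yields the splitting probabilities and the recursion
  \<open>E f(Y\<^sub>n) = (\<Sum>k. p\<^sub>n\<^sub>k E f(Y\<^sub>k + t\<^sub>n))\<close> (\<open>expectation_total_cost_rec\<close>).  Lagrange inversion gives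
  \<open>T\<^sub>n\<close> as an explicit product, and Stirling's formula then gives \<open>T\<^sub>n \<rho>\<^sup>n = C n\<^sup>-\<^sup>3\<^sup>/\<^sup>2 (1 + O(1/n))\<close>
  with a constant \<open>C\<close> and the radius of convergence \<open>\<rho>\<close> of the tree generating function
  (\<open>tilted_weight_asymptotics\<close>).  Finally \<open>\<tau> = 1 / a\<^sub>1\<close> and \<open>\<sigma>\<^sup>2 = a\<^sub>1 / \<alpha>\<^sub>0\<close>.

  For a sequence \<open>x\<close> let the defect be \<open>x\<^sub>n - (\<Sum>k. p\<^sub>n\<^sub>k x\<^sub>k)\<close>.  On powers it is
  \<open>\<kappa>\<^sub>\<gamma> n powr (\<gamma> - 1/2) + O(n powr (\<gamma> - 1))\<close> with \<open>\<kappa>\<^sub>\<gamma> = (\<surd>2 / \<sigma>) \<Gamma>(\<gamma> + 1/2) / \<Gamma>(\<gamma>)\<close>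
  (\<open>defect_powr_asymptotics\<close>).  It obeys a comparison principle: if the defect of \<open>x\<close> is dominated by
  that of \<open>y\<close>, then \<open>x\<close> is dominated by \<open>y\<close>.  The defect of the \<open>s\<close>-th moment of \<open>Y\<^sub>n\<close> is a combination of the
  moments of lower order, with leading term \<open>s t\<^sub>n \<mu>\<^sub>n\<^sup>[\<^sup>s\<^sup>-\<^sup>1\<^sup>]\<close>.  Induction on \<open>s\<close> therefore gives
  \<open>\<mu>\<^sub>n\<^sup>[\<^sup>s\<^sup>] = M\<^sub>s n powr (s \<alpha>') + error\<close> with \<open>M\<^sub>s = s M\<^sub>s\<^sub>-\<^sub>1 / \<kappa>\<close> for \<open>\<kappa>\<close> at \<open>\<gamma> = s \<alpha>'\<close>, which is the product of Gamma
  quotients in the theorem.  The relative error is \<open>O(n\<^sup>-\<^sup>1\<^sup>/\<^sup>2)\<close>, with an additional logarithm for \<open>\<alpha> = 0\<close>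
  (\<open>cost_moment_asymptotics\<close>).

  The limit moments divided by \<open>s!\<close> decay faster than any geometric sequence.  So they determine a
  law through its characteristic function, and tightness together with Helly's selection theorem gives
  existence and weak convergence (\<open>method_of_moments\<close>).  For \<open>\<alpha> = 0\<close> they are the Rayleigh moments.
\<close>

section \<open>Tree weights and Lagrange inversion\<close>

lemma length_le_forest_size: "length ts \<le> sum_list (map num_nodes ts)"
  using sum_list_mono[of ts "\<lambda>_. 1" num_nodes] num_nodes_pos
  by (simp add: sum_list_triv Suc_le_eq)

lemma finite_trees_le: "finite {T. num_nodes T \<le> n}"
proof (induction n)
  case 0
  have "{T. num_nodes T \<le> 0} = {}"
    using num_nodes_pos by (auto simp: not_le)
  then show ?case by (simp only: finite.emptyI)
next
  case (Suc n)
  have "{T. num_nodes T \<le> Suc n} \<subseteq> Tree_Node ` {ts. set ts \<subseteq> {T. num_nodes T \<le> n} \<and> length ts \<le> n}"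
  proof
    fix T assume "T \<in> {T. num_nodes T \<le> Suc n}"
    then obtain ts where T: "T = Tree_Node ts" and le: "sum_list (map num_nodes ts) \<le> n"
      by (cases T) auto
    have "num_nodes t \<le> n" if "t \<in> set ts" for t
      using member_le_sum_list[of "num_nodes t" "map num_nodes ts"] that le by auto
    then show "T \<in> Tree_Node ` {ts. set ts \<subseteq> {T. num_nodes T \<le> n} \<and> length ts \<le> n}"
      using T le length_le_forest_size[of ts] by auto
  qed
  then show ?case
    using finite_lists_length_le[OF Suc.IH] finite_subset by blast
qed

lemma finite_trees: "finite {T. num_nodes T = n}"
  by (rule finite_subset[OF _ finite_trees_le[of n]]) auto

definition forests :: "nat \<Rightarrow> nat \<Rightarrow> ordered_tree list set" where
  "forests k m = {ts. length ts = k \<and> sum_list (map num_nodes ts) = m}"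

lemma total_weight_0 [simp]: "total_weight \<Phi> 0 = 0"
proof -
  have "{T. num_nodes T = 0} = {}" using num_nodes_pos by (metis (mono_tags) Collect_empty_eq less_irrefl)
  then show ?thesis unfolding total_weight_def by (simp only: sum.empty)
qed

definition tree_gf :: "real fps \<Rightarrow> real fps" where
  "tree_gf \<Phi> = Abs_fps (total_weight \<Phi>)"

lemma tree_gf_nth: "fps_nth (tree_gf \<Phi>) n = total_weight \<Phi> n"
  by (simp add: tree_gf_def)

lemma forests_Suc:
  "forests (Suc k) m =
     (\<lambda>(T, ts). T # ts) ` (\<Union>i\<le>m. {T. num_nodes T = i} \<times> forests k (m - i))"
proof (intro set_eqI iffI)
  fix us assume "us \<in> forests (Suc k) m"
  then obtain T ts where "us = T # ts" "length ts = k" "num_nodes T + sum_list (map num_nodes ts) = m"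
    by (cases us) (auto simp: forests_def)
  then show "us \<in> (\<lambda>(T, ts). T # ts) ` (\<Union>i\<le>m. {T. num_nodes T = i} \<times> forests k (m - i))"
    by (intro image_eqI[of _ _ "(T, ts)"]) (auto simp: forests_def)
qed (auto simp: forests_def)

lemma finite_forests: "finite (forests k m)"
proof (induction k arbitrary: m)
  case 0
  have "forests 0 m \<subseteq> {[]}" by (auto simp: forests_def)
  then show ?case by (rule finite_subset) simp
next
  case (Suc k)
  then show ?case
    unfolding forests_Suc by (intro finite_imageI finite_UN_I finite_cartesian_product finite_trees) auto
qed

text \<open>Splitting off the first tree of a forest is the Cauchy product, so forests of \<open>k\<close> trees are
  counted by the \<open>k\<close>-th power of the tree generating function.\<close>
lemma sum_forest_weight:
  "(\<Sum>ts\<in>forests k m. prod_list (map (tree_weight \<Phi>) ts)) = fps_nth (tree_gf \<Phi> ^ k) m"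
proof (induction k arbitrary: m)
  case 0
  have "forests 0 m = (if m = 0 then {[]} else {})" by (auto simp: forests_def)
  then show ?case by simp
next
  case (Suc k)
  let ?w = "\<lambda>ts. prod_list (map (tree_weight \<Phi>) ts)"
  have "(\<Sum>ts\<in>forests (Suc k) m. ?w ts) =
      (\<Sum>(T, ts)\<in>(\<Union>i\<le>m. {T. num_nodes T = i} \<times> forests k (m - i)). tree_weight \<Phi> T * ?w ts)"
    unfolding forests_Suc by (subst sum.reindex) (auto simp: inj_on_def case_prod_beta)
  also have "\<dots> = (\<Sum>i\<le>m. \<Sum>(T, ts)\<in>{T. num_nodes T = i} \<times> forests k (m - i). tree_weight \<Phi> T * ?w ts)"
    by (subst sum.UNION_disjoint) (auto simp: finite_trees finite_forests)
  also have "\<dots> = (\<Sum>i\<le>m. total_weight \<Phi> i * fps_nth (tree_gf \<Phi> ^ k) (m - i))"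
    by (intro sum.cong refl) (simp add: sum.cartesian_product[symmetric] sum_product[symmetric] total_weight_def Suc.IH)
  also have "\<dots> = fps_nth (tree_gf \<Phi> ^ Suc k) m"
    by (simp add: fps_mult_nth tree_gf_nth atLeast0AtMost)
  finally show ?case .
qed

text \<open>Deleting the root of a tree leaves the forest of its children.  Coefficient by coefficient this
  is the functional equation \<open>T(z) = z \<Phi>(T(z))\<close>.\<close>
lemma total_weight_Suc:
  "total_weight \<Phi> (Suc m) = (\<Sum>k=0..m. fps_nth \<Phi> k * fps_nth (tree_gf \<Phi> ^ k) m)"
proof -
  have "{T. num_nodes T = Suc m} = Tree_Node ` (\<Union>k\<in>{0..m}. forests k m)"
  proof (intro set_eqI iffI)
    fix T assume "T \<in> {T. num_nodes T = Suc m}"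
    then obtain ts where "T = Tree_Node ts" "sum_list (map num_nodes ts) = m" by (cases T) auto
    then show "T \<in> Tree_Node ` (\<Union>k\<in>{0..m}. forests k m)"
      using length_le_forest_size[of ts] by (auto simp: forests_def)
  qed (auto simp: forests_def)
  then have "total_weight \<Phi> (Suc m) = (\<Sum>ts\<in>(\<Union>k\<in>{0..m}. forests k m). tree_weight \<Phi> (Tree_Node ts))"
    unfolding total_weight_def by (simp only:) (subst sum.reindex, auto simp: inj_on_def)
  also have "\<dots> = (\<Sum>k=0..m. \<Sum>ts\<in>forests k m. tree_weight \<Phi> (Tree_Node ts))"
    by (subst sum.UNION_disjoint) (auto simp: finite_forests, auto simp: forests_def)
  also have "\<dots> = (\<Sum>k=0..m. fps_nth \<Phi> k * fps_nth (tree_gf \<Phi> ^ k) m)"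
  proof (intro sum.cong refl)
    fix k
    have "(\<Sum>ts\<in>forests k m. tree_weight \<Phi> (Tree_Node ts))
        = (\<Sum>ts\<in>forests k m. fps_nth \<Phi> k * prod_list (map (tree_weight \<Phi>) ts))"
      by (intro sum.cong) (auto simp: forests_def)
    then show "(\<Sum>ts\<in>forests k m. tree_weight \<Phi> (Tree_Node ts)) = fps_nth \<Phi> k * fps_nth (tree_gf \<Phi> ^ k) m"
      by (simp add: sum_distrib_left[symmetric] sum_forest_weight)
  qed
  finally show ?thesis .
qed

lemma tree_gf_functional_equation: "tree_gf \<Phi> = fps_X * (\<Phi> oo tree_gf \<Phi>)"
proof (rule fps_ext)
  fix n show "fps_nth (tree_gf \<Phi>) n = fps_nth (fps_X * (\<Phi> oo tree_gf \<Phi>)) n"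
    by (cases n) (simp_all add: tree_gf_nth total_weight_Suc fps_compose_nth)
qed

lemma fps_deriv_power_Suc:
  "fps_deriv (F ^ Suc n) = of_nat (Suc n) * F ^ n * fps_deriv (F :: real fps)"
  by (subst fps_deriv_power') (simp add: mult_ac)

text \<open>Induction on \<open>m\<close> replaces the usual residue argument.  From \<open>T\<^sup>k = z\<^sup>k \<Phi>(T)\<^sup>k\<close> the coefficient is a
  sum of \<open>[t\<^sup>j] \<Phi>\<^sup>k\<close> times \<open>[z\<^sup>r] T\<^sup>j\<close> with \<open>r = m - k\<close>.  The induction hypothesis for \<open>r\<close> contributes a
  factor \<open>j\<close>, which turns the first coefficients into those of \<open>t (\<Phi>\<^sup>k)'\<close>; the sum becomes a coefficient
  of \<open>t (\<Phi>\<^sup>k)' \<Phi>\<^sup>r\<close>, and this series is \<open>k/m\<close> times \<open>t (\<Phi>\<^sup>m)'\<close>.\<close>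
theorem lagrange_inversion_power:
  fixes T \<Phi> :: "real fps"
  assumes T: "T = fps_X * (\<Phi> oo T)" and "m \<ge> 1"
  shows "real m * fps_nth (T ^ k) m = real k * (if k \<le> m then fps_nth (\<Phi> ^ m) (m - k) else 0)"
  using \<open>m \<ge> 1\<close>
proof (induction m arbitrary: k rule: less_induct)
  case (less m)
  have T0: "fps_nth T 0 = 0" by (subst T) simp
  have "T ^ k = fps_X ^ k * (\<Phi> oo T) ^ k"
    by (subst T) (simp add: power_mult_distrib)
  then have Tk: "T ^ k = fps_X ^ k * ((\<Phi> ^ k) oo T)"
    by (simp add: fps_compose_power[OF T0])
  consider "k = 0" | "k > m" | "k = m" "k \<ge> 1" | "1 \<le> k" "k < m" by linarith
  then show ?case
  proof cases
    case 4
    define r where "r = m - k"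
    have r: "1 \<le> r" "r < m" "m = k + r" using 4 by (auto simp: r_def)
    have "fps_nth (T ^ k) m = (\<Sum>j=0..r. fps_nth (\<Phi> ^ k) j * fps_nth (T ^ j) r)"
      unfolding Tk using r by (simp add: fps_X_power_mult_nth fps_compose_nth)
    then have "real r * fps_nth (T ^ k) m = (\<Sum>j=0..r. fps_nth (\<Phi> ^ k) j * (real r * fps_nth (T ^ j) r))"
      by (simp add: sum_distrib_left mult_ac)
    also have "\<dots> = (\<Sum>j=0..r. fps_nth (fps_X * fps_deriv (\<Phi> ^ k)) j * fps_nth (\<Phi> ^ r) (r - j))"
    proof (intro sum.cong refl)
      fix j assume "j \<in> {0..r}"
      then show "fps_nth (\<Phi> ^ k) j * (real r * fps_nth (T ^ j) r)
          = fps_nth (fps_X * fps_deriv (\<Phi> ^ k)) j * fps_nth (\<Phi> ^ r) (r - j)"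
        using less.IH[OF r(2,1), of j] by (cases j) auto
    qed
    also have "\<dots> = fps_nth (fps_X * fps_deriv (\<Phi> ^ k) * \<Phi> ^ r) r"
      by (simp add: fps_mult_nth)
    finally have *: "real r * fps_nth (T ^ k) m = fps_nth (fps_X * fps_deriv (\<Phi> ^ k) * \<Phi> ^ r) r" .
    have "of_nat m * (fps_X * fps_deriv (\<Phi> ^ k) * \<Phi> ^ r) = of_nat k * (fps_X * fps_deriv (\<Phi> ^ m))"
    proof -
      obtain k' where k': "k = Suc k'" using 4 by (cases k) auto
      have "k + r = Suc (k' + r)" using k' by simp
      then show ?thesis
        unfolding r(3) by (simp only: k' fps_deriv_power_Suc power_add) (simp add: algebra_simps)
    qed
    then have "real m * (real r * fps_nth (T ^ k) m) = real k * fps_nth (fps_X * fps_deriv (\<Phi> ^ m)) r"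
      unfolding * by (metis fps_mult_of_nat_nth(1))
    also have "fps_nth (fps_X * fps_deriv (\<Phi> ^ m)) r = real r * fps_nth (\<Phi> ^ m) r"
      using r(1) by (simp only: fps_X_mult_nth fps_deriv_nth) simp
    finally have "real r * (real m * fps_nth (T ^ k) m) = real r * (real k * fps_nth (\<Phi> ^ m) r)"
      by (simp only: mult_ac)
    then have "real m * fps_nth (T ^ k) m = real k * fps_nth (\<Phi> ^ m) r"
      using r(1) by simp
    then show ?thesis unfolding r_def using 4(2) by simp
  next
    case 3
    then show ?thesis using Tk by (simp add: fps_X_power_mult_nth)
  qed (simp_all add: Tk fps_X_power_mult_nth)
qed

text \<open>The three types of very simple families share a recurrence in which \<open>(k + 1) \<phi>\<^sub>k\<^sub>+\<^sub>1 / \<phi>\<^sub>k\<close> is affine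
  in \<open>k\<close>: type A has \<open>a\<^sub>0 = 0\<close>, type B has \<open>a\<^sub>0 = \<alpha>\<^sub>0 / d\<close> and type C has \<open>a\<^sub>0 = - (2 \<alpha>\<^sub>1 - \<alpha>\<^sub>0)\<close>.  Equivalently,
  \<open>(1 + a\<^sub>0 t) \<Phi>' = \<alpha>\<^sub>0 \<Phi>\<close>.\<close>
locale linear_ratio_family =
  fixes \<Phi> :: "real fps" and \<alpha>\<^sub>0 a\<^sub>0 :: real
  assumes phi_0: "fps_nth \<Phi> 0 = 1"
    and phi_nonneg: "fps_nth \<Phi> k \<ge> 0"
    and phi_Suc: "real (Suc k) * fps_nth \<Phi> (Suc k) = (\<alpha>\<^sub>0 - a\<^sub>0 * real k) * fps_nth \<Phi> k"
    and alpha_pos: "\<alpha>\<^sub>0 > 0"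
    and a0_less: "a\<^sub>0 < \<alpha>\<^sub>0"
begin

lemma fps_ode: "(1 + fps_const a\<^sub>0 * fps_X) * fps_deriv \<Phi> = fps_const \<alpha>\<^sub>0 * \<Phi>"
proof (rule fps_ext)
  fix n
  have "fps_nth ((1 + fps_const a\<^sub>0 * fps_X) * fps_deriv \<Phi>) n
      = real (Suc n) * fps_nth \<Phi> (Suc n) + a\<^sub>0 * real n * fps_nth \<Phi> n"
    by (cases n) (simp_all add: distrib_right mult.assoc)
  then show "fps_nth ((1 + fps_const a\<^sub>0 * fps_X) * fps_deriv \<Phi>) n = fps_nth (fps_const \<alpha>\<^sub>0 * \<Phi>) n"
    unfolding phi_Suc by (simp add: algebra_simps)
qed

text \<open>The power \<open>\<Phi>\<^sup>n\<close> solves the same differential equation with \<open>n \<alpha>\<^sub>0\<close> in place of \<open>\<alpha>\<^sub>0\<close>.\<close>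
lemma phi_power_nth:
  "fps_nth (\<Phi> ^ n) j = (\<Prod>i<j. real n * \<alpha>\<^sub>0 - a\<^sub>0 * real i) / fact j"
proof (induction j)
  case 0
  show ?case by (simp add: phi_0 fps_nth_power_0)
next
  case (Suc j)
  have "(1 + fps_const a\<^sub>0 * fps_X) * fps_deriv (\<Phi> ^ n) = fps_const (real n * \<alpha>\<^sub>0) * \<Phi> ^ n"
  proof (cases n)
    case (Suc k)
    have "(1 + fps_const a\<^sub>0 * fps_X) * fps_deriv (\<Phi> ^ n)
        = of_nat n * \<Phi> ^ k * ((1 + fps_const a\<^sub>0 * fps_X) * fps_deriv \<Phi>)"
      unfolding Suc fps_deriv_power_Suc by (simp add: algebra_simps)
    also have "\<dots> = fps_const (real n * \<alpha>\<^sub>0) * \<Phi> ^ n"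
      unfolding fps_ode Suc by (simp add: fps_of_nat[symmetric] algebra_simps flip: fps_const_mult)
    finally show ?thesis .
  qed simp
  from arg_cong[OF this, of "\<lambda>F. fps_nth F j"]
  have "real (Suc j) * fps_nth (\<Phi> ^ n) (Suc j) + a\<^sub>0 * real j * fps_nth (\<Phi> ^ n) j = real n * \<alpha>\<^sub>0 * fps_nth (\<Phi> ^ n) j"
    by (cases j) (simp_all add: distrib_right mult.assoc)
  then have "real (Suc j) * fps_nth (\<Phi> ^ n) (Suc j) = (real n * \<alpha>\<^sub>0 - a\<^sub>0 * real j) * fps_nth (\<Phi> ^ n) j"
    by (simp add: algebra_simps)
  then have "fps_nth (\<Phi> ^ n) (Suc j) = (real n * \<alpha>\<^sub>0 - a\<^sub>0 * real j) * fps_nth (\<Phi> ^ n) j / real (Suc j)"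
    by (subst eq_divide_eq) (simp only: mult.commute[of "fps_nth (\<Phi> ^ n) (Suc j)"] of_nat_eq_0_iff, simp)
  then show ?case unfolding Suc.IH by (simp add: mult_ac)
qed

theorem total_weight_eq:
  assumes "n \<ge> 1"
  shows "total_weight \<Phi> n = (\<Prod>i<n-1. real n * \<alpha>\<^sub>0 - a\<^sub>0 * real i) / fact n"
proof -
  have "real n * total_weight \<Phi> n = fps_nth (\<Phi> ^ n) (n - 1)"
    using lagrange_inversion_power[OF tree_gf_functional_equation[of \<Phi>] assms, of 1] assms
    by (simp add: tree_gf_nth)
  then show ?thesis
    using assms by (simp add: phi_power_nth fact_reduce[of n] field_simps)
qed

lemma total_weight_pos:
  assumes "n \<ge> 1"
  shows "total_weight \<Phi> n > 0"
  unfolding total_weight_eq[OF assms]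
proof (intro divide_pos_pos prod_pos ballI)
  fix i assume i: "i \<in> {..<n-1}"
  show "real n * \<alpha>\<^sub>0 - a\<^sub>0 * real i > 0"
  proof (cases "a\<^sub>0 \<le> 0")
    case True
    then have "a\<^sub>0 * real i \<le> 0" by (simp add: mult_nonpos_nonneg)
    moreover have "real n * \<alpha>\<^sub>0 > 0" using assms alpha_pos by simp
    ultimately show ?thesis by linarith
  next
    case False
    have "a\<^sub>0 * real i \<le> \<alpha>\<^sub>0 * real i" using a0_less by (intro mult_right_mono) auto
    also have "\<dots> < \<alpha>\<^sub>0 * real n" using i alpha_pos by (intro mult_strict_left_mono) auto
    finally show ?thesis by (simp add: mult.commute)
  qed
qed simp

end

section \<open>Cutting an edge and grafting the subtree back\<close>

text \<open>Inserts \<open>S\<close> into a tree so that the root of \<open>S\<close> receives the address \<open>p\<close>.  The last entry of \<open>p\<close>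
  names a gap among the children of a node; a node with \<open>d\<close> children has \<open>d + 1\<close> gaps, hence the
  non-strict bound in \<open>is_slot\<close> below.\<close>
fun graft :: "ordered_tree \<Rightarrow> nat list \<Rightarrow> ordered_tree \<Rightarrow> ordered_tree" where
  "graft S [] T = S"
| "graft S [i] T = Tree_Node (take i (children T) @ S # drop i (children T))"
| "graft S (i # j # p) T = Tree_Node ((children T)[i := graft S (j # p) (children T ! i)])"

fun is_slot :: "nat list \<Rightarrow> ordered_tree \<Rightarrow> bool" where
  "is_slot [] T = False"
| "is_slot [i] T = (i \<le> length (children T))"
| "is_slot (i # j # p) T = (i < length (children T) \<and> is_slot (j # p) (children T ! i))"

fun subtree_at :: "nat list \<Rightarrow> ordered_tree \<Rightarrow> ordered_tree" where
  "subtree_at [] T = T"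
| "subtree_at (i # p) T = subtree_at p (children T ! i)"

text \<open>Together with \<open>graft_then_cut\<close>, this makes \<open>(T, e)\<close> correspond bijectively to the triple of the root
  component, the discarded subtree and the slot from which it was cut.\<close>
lemma cut_then_graft:
  assumes "p \<noteq> []" "is_node p T"
  shows "is_slot p (root_component p T)"
    and "graft (subtree_at p T) p (root_component p T) = T"
    and "num_nodes (root_component p T) + num_nodes (subtree_at p T) = num_nodes T"
proof -
  have "is_slot p (root_component p T) \<and> graft (subtree_at p T) p (root_component p T) = T
    \<and> num_nodes (root_component p T) + num_nodes (subtree_at p T) = num_nodes T"
    using assms
  proof (induction p T rule: root_component.induct)
    case (2 i T)
    let ?ts = "children T"
    have i: "i < length ?ts" using 2 by simp
    have "sum_list (map num_nodes ?ts) =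
        sum_list (map num_nodes (take i ?ts @ ?ts ! i # drop (Suc i) ?ts))"
      using id_take_nth_drop[OF i] by simp
    then have "sum_list (map num_nodes ?ts) = sum_list (map num_nodes (take i ?ts)) +
        num_nodes (?ts ! i) + sum_list (map num_nodes (drop (Suc i) ?ts))" by simp
    moreover have "T = Tree_Node (take i ?ts @ ?ts ! i # drop (Suc i) ?ts)"
      using id_take_nth_drop[OF i] by simp
    ultimately show ?case
      using i by (simp add: num_nodes_children[of T] min_def)
  next
    case (3 i j p T)
    let ?ts = "children T" and ?r = "root_component (j # p) (children T ! i)"
    have i: "i < length ?ts" using 3 by simp
    have IH: "is_slot (j # p) ?r" "graft (subtree_at (j # p) (?ts ! i)) (j # p) ?r = ?ts ! i"
      "num_nodes ?r + num_nodes (subtree_at (j # p) (?ts ! i)) = num_nodes (?ts ! i)"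
      using 3 by auto
    have "sum_list (map num_nodes ?ts) =
        sum_list (map num_nodes (take i ?ts @ ?ts ! i # drop (Suc i) ?ts))"
      using id_take_nth_drop[OF i] by simp
    moreover have "?ts[i := ?r] = take i ?ts @ ?r # drop (Suc i) ?ts"
      by (rule upd_conv_take_nth_drop[OF i])
    then have "sum_list (map num_nodes (?ts[i := ?r])) =
       sum_list (map num_nodes (take i ?ts @ ?r # drop (Suc i) ?ts))" by simp
    moreover have "T = Tree_Node ?ts" by simp
    ultimately show ?case
      using i IH by (simp add: num_nodes_children[of T])
  qed simp
  then show "is_slot p (root_component p T)"
    and "graft (subtree_at p T) p (root_component p T) = T"
    and "num_nodes (root_component p T) + num_nodes (subtree_at p T) = num_nodes T"
    by auto
qed

lemma graft_then_cut:
  assumes "is_slot p T"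
  shows "p \<noteq> []" "is_node p (graft S p T)" "root_component p (graft S p T) = T"
    "subtree_at p (graft S p T) = S"
proof -
  have "p \<noteq> [] \<and> is_node p (graft S p T) \<and> root_component p (graft S p T) = T \<and> subtree_at p (graft S p T) = S"
    using assms
  proof (induction p T rule: is_slot.induct)
    case (2 i T)
    moreover have "T = Tree_Node (children T)" by simp
    ultimately show ?case by (simp add: min_def nth_append)
  next
    case (3 i j p T)
    moreover have "T = Tree_Node (children T)" by simp
    ultimately show ?case by simp
  qed simp
  then show "p \<noteq> []" "is_node p (graft S p T)" "root_component p (graft S p T) = T"
    "subtree_at p (graft S p T) = S"
    by auto
qed

definition slots :: "ordered_tree \<Rightarrow> nat list set" where
  "slots T = {p. is_slot p T}"

lemma slots_unfold:
  "slots T = (\<lambda>i. [i]) ` {..length (children T)} \<union> (\<Union>i<length (children T). (#) i ` slots (children T ! i))"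
proof (rule set_eqI)
  fix p
  show "p \<in> slots T \<longleftrightarrow> p \<in> (\<lambda>i. [i]) ` {..length (children T)} \<union> (\<Union>i<length (children T). (#) i ` slots (children T ! i))"
    by (cases "(p, T)" rule: is_slot.cases) (auto simp: slots_def)
qed

lemma finite_slots: "finite (slots T)"
proof (induction T)
  case (Tree_Node ts)
  then show ?case by (subst slots_unfold) (auto intro!: finite_imageI)
qed

lemma sum_slots:
  "(\<Sum>p\<in>slots T. f p) = (\<Sum>i\<le>length (children T). f [i]) +
     (\<Sum>i<length (children T). \<Sum>p\<in>slots (children T ! i). f (i # p))"
proof -
  have nil: "[] \<notin> slots S" for S by (simp add: slots_def)
  have "(\<Sum>p\<in>slots T. f p) = (\<Sum>p\<in>(\<lambda>i. [i]) ` {..length (children T)}. f p) +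
     (\<Sum>p\<in>(\<Union>i<length (children T). (#) i ` slots (children T ! i)). f p)"
    by (subst slots_unfold, rule sum.union_disjoint) (auto simp: finite_slots nil)
  also have "(\<Sum>p\<in>(\<lambda>i. [i]) ` {..length (children T)}. f p) = (\<Sum>i\<le>length (children T). f [i])"
    by (subst sum.reindex) (auto simp: inj_on_def)
  also have "(\<Sum>p\<in>(\<Union>i<length (children T). (#) i ` slots (children T ! i)). f p) =
      (\<Sum>i<length (children T). \<Sum>p\<in>(#) i ` slots (children T ! i). f p)"
    by (rule sum.UNION_disjoint) (auto simp: finite_slots)
  also have "\<dots> = (\<Sum>i<length (children T). \<Sum>p\<in>slots (children T ! i). f (i # p))"
    by (intro sum.cong[OF refl], subst sum.reindex) (auto simp: inj_on_def)
  finally show ?thesis .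
qed

lemma graft_Cons:
  "p \<noteq> [] \<Longrightarrow> graft S (i # p) T = Tree_Node ((children T)[i := graft S p (children T ! i)])"
  by (cases p) auto

lemma card_is_node: "card {p. is_node p T} = num_nodes T"
proof (induction T)
  case (Tree_Node ts)
  have "card (\<Union>i<length ts. (#) i ` {p. is_node p (ts ! i)}) = (\<Sum>i<length ts. card ((#) i ` {p. is_node p (ts ! i)}))"
    by (intro card_UN_disjoint) (auto intro!: finite_imageI finite_is_node)
  also have "\<dots> = (\<Sum>i<length ts. num_nodes (ts ! i))"
    using Tree_Node by (intro sum.cong refl) (subst card_image, auto)
  also have "\<dots> = sum_list (map num_nodes ts)"
    by (simp add: sum_list_sum_nth atLeast0LessThan)
  finally have *: "card (\<Union>i<length ts. (#) i ` {p. is_node p (ts ! i)}) = sum_list (map num_nodes ts)" .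
  have "finite (\<Union>i<length ts. (#) i ` {p. is_node p (ts ! i)})"
    by (auto intro!: finite_imageI finite_is_node)
  with * show ?case
    by (subst is_node_Cons_set) (subst card_insert_disjoint, auto)
qed

lemma card_tree_edges: "card (tree_edges T) = num_nodes T - 1"
proof -
  have "tree_edges T = {p. is_node p T} - {[]}" by (auto simp: tree_edges_def)
  then show ?thesis using card_is_node[of T] by (simp add: finite_is_node)
qed

context linear_ratio_family
begin

abbreviation a\<^sub>1 :: real where "a\<^sub>1 \<equiv> \<alpha>\<^sub>0 - a\<^sub>0"

text \<open>Grafting \<open>S\<close> at a node with \<open>d\<close> children replaces the factor \<open>\<phi>\<^sub>d\<close> by \<open>\<phi>\<^sub>d\<^sub>+\<^sub>1\<close>, and there are \<open>d + 1\<close> slots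
  at this node.  The recurrence for \<open>\<phi>\<close> turns their total contribution into \<open>(\<alpha>\<^sub>0 - a\<^sub>0 d) w(S) w(T)\<close>.
  Outdegrees add up to the number of nodes minus one, so the sum over all nodes depends on \<open>T\<close>
  through its size and weight only.  This is where very simple families are special.\<close>
lemma sum_graft_weights:
  "(\<Sum>p\<in>slots T. tree_weight \<Phi> (graft S p T))
     = (a\<^sub>1 * real (num_nodes T) + a\<^sub>0) * tree_weight \<Phi> S * tree_weight \<Phi> T"
proof (induction T)
  case (Tree_Node ts)
  let ?w = "tree_weight \<Phi>" and ?k = "length ts"
  let ?P = "prod_list (map ?w ts)"
  have "(\<Sum>i\<le>?k. ?w (graft S [i] (Tree_Node ts))) = (\<Sum>i\<le>?k. fps_nth \<Phi> (Suc ?k) * ?w S * ?P)"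
  proof (intro sum.cong refl)
    fix i assume "i \<in> {..?k}"
    have "prod_list (map ?w (take i ts)) * prod_list (map ?w (drop i ts)) = prod_list (map ?w (take i ts @ drop i ts))"
      by (simp only: map_append prod_list.append)
    also have "\<dots> = ?P" by (simp only: append_take_drop_id)
    finally have "prod_list (map ?w (drop i ts)) * prod_list (map ?w (take i ts)) = ?P" by (simp add: mult.commute)
    with \<open>i \<in> {..?k}\<close> show "?w (graft S [i] (Tree_Node ts)) = fps_nth \<Phi> (Suc ?k) * ?w S * ?P"
      by (simp add: min_def mult_ac)
  qed
  also have "\<dots> = (\<alpha>\<^sub>0 - a\<^sub>0 * real ?k) * ?w S * ?w (Tree_Node ts)"
    using phi_Suc[of ?k] by (simp add: mult_ac)
  finally have new_child: "(\<Sum>i\<le>?k. ?w (graft S [i] (Tree_Node ts))) = (\<alpha>\<^sub>0 - a\<^sub>0 * real ?k) * ?w S * ?w (Tree_Node ts)" .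
  have deeper: "(\<Sum>p\<in>slots (ts ! i). ?w (graft S (i # p) (Tree_Node ts)))
      = (a\<^sub>1 * real (num_nodes (ts ! i)) + a\<^sub>0) * ?w S * ?w (Tree_Node ts)" if i: "i < ?k" for i
  proof -
    define Q where "Q = fps_nth \<Phi> ?k * prod_list (map ?w (take i ts)) * prod_list (map ?w (drop (Suc i) ts))"
    have "?w (Tree_Node ts) = Q * ?w (ts ! i)"
      using arg_cong[OF id_take_nth_drop[OF i], of "\<lambda>xs. prod_list (map ?w xs)"]
      by (simp add: Q_def mult_ac)
    moreover have "?w (graft S (i # p) (Tree_Node ts)) = Q * ?w (graft S p (ts ! i))" if "p \<in> slots (ts ! i)" for p
    proof -
      have "p \<noteq> []" using that by (auto simp: slots_def)
      moreover have "Suc (?k - Suc 0) = ?k" using i by simp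
      ultimately show ?thesis
        using i by (simp add: graft_Cons upd_conv_take_nth_drop Q_def mult_ac)
    qed
    ultimately show ?thesis
      using Tree_Node[of "ts ! i"] i by (simp add: sum_distrib_left[symmetric] mult_ac)
  qed
  have "(\<Sum>p\<in>slots (Tree_Node ts). ?w (graft S p (Tree_Node ts))) =
     (\<alpha>\<^sub>0 - a\<^sub>0 * real ?k) * ?w S * ?w (Tree_Node ts) +
     (\<Sum>i<?k. (a\<^sub>1 * real (num_nodes (ts ! i)) + a\<^sub>0) * ?w S * ?w (Tree_Node ts))"
    using new_child deeper by (subst sum_slots) simp
  also have "\<dots> = (\<alpha>\<^sub>0 - a\<^sub>0 * real ?k + (\<Sum>i<?k. a\<^sub>1 * real (num_nodes (ts ! i)) + a\<^sub>0)) * ?w S * ?w (Tree_Node ts)"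
    by (simp only: distrib_right sum_distrib_right)
  also have "(\<Sum>i<?k. a\<^sub>1 * real (num_nodes (ts ! i)) + a\<^sub>0) = a\<^sub>1 * real (sum_list (map num_nodes ts)) + a\<^sub>0 * real ?k"
    by (simp add: sum.distrib sum_list_sum_nth atLeast0LessThan sum_distrib_left)
  finally show ?case by (simp add: algebra_simps)
qed

lemma sum_over_cuts:
  fixes F :: "ordered_tree \<Rightarrow> real"
  shows "(\<Sum>T | num_nodes T = n. \<Sum>e\<in>tree_edges T. tree_weight \<Phi> T * F (root_component e T)) =
    (\<Sum>k=1..<n. (a\<^sub>1 * real k + a\<^sub>0) * total_weight \<Phi> (n - k) * (\<Sum>T | num_nodes T = k. tree_weight \<Phi> T * F T))"
proof -
  let ?w = "tree_weight \<Phi>"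
  have "(\<Sum>T | num_nodes T = n. \<Sum>e\<in>tree_edges T. ?w T * F (root_component e T)) =
      (\<Sum>(T, e)\<in>Sigma {T. num_nodes T = n} tree_edges. ?w T * F (root_component e T))"
    by (rule sum.Sigma) (auto simp: finite_trees finite_tree_edges)
  also have "\<dots> = (\<Sum>((T, S), p)\<in>Sigma (Sigma {T. num_nodes T \<in> {1..<n}} (\<lambda>T. {S. num_nodes S = n - num_nodes T})) (\<lambda>(T, S). slots T).
      ?w (graft S p T) * F T)"
  proof (rule sum.reindex_bij_witness[where
      i = "\<lambda>((T, S), p). (graft S p T, p)" and
      j = "\<lambda>(T, p). ((root_component p T, subtree_at p T), p)"], goal_cases)
    case (1 a)
    then show ?case by (auto simp: tree_edges_def cut_then_graft)
  next
    case (2 a)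
    then obtain T p where a: "a = (T, p)" "num_nodes T = n" "p \<noteq> []" "is_node p T" by (auto simp: tree_edges_def)
    have "num_nodes (root_component p T) + num_nodes (subtree_at p T) = n"
      using cut_then_graft(3)[OF a(3,4)] a by simp
    then show ?case
      using num_nodes_root_component[OF a(3,4)] num_nodes_pos[of "root_component p T"] cut_then_graft(1)[OF a(3,4)] a(2)
      by (auto simp: a(1) slots_def)
  next
    case (3 b)
    then show ?case by (auto simp: slots_def graft_then_cut)
  next
    case (4 b)
    then obtain T S p where b: "b = ((T, S), p)" "num_nodes T < n" "num_nodes S = n - num_nodes T" "is_slot p T"
      by (auto simp: slots_def)
    have "num_nodes T + num_nodes S = num_nodes (graft S p T)"
      using cut_then_graft(3)[OF graft_then_cut(1)[OF b(4)] graft_then_cut(2)[OF b(4)], of S] graft_then_cut(3,4)[OF b(4), of S] by simp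
    then show ?case
      using b graft_then_cut[OF b(4)] by (auto simp: tree_edges_def)
  next
    case (5 a)
    then show ?case by (auto simp: tree_edges_def cut_then_graft)
  qed
  also have "\<dots> = (\<Sum>(T, S)\<in>Sigma {T. num_nodes T \<in> {1..<n}} (\<lambda>T. {S. num_nodes S = n - num_nodes T}). \<Sum>p\<in>slots T. ?w (graft S p T) * F T)"
    by (subst sum.Sigma[symmetric])
       (auto simp: finite_trees finite_slots case_prod_beta intro!: finite_SigmaI finite_subset[OF _ finite_trees_le[of n]])
  also have "\<dots> = (\<Sum>T | num_nodes T \<in> {1..<n}. \<Sum>S | num_nodes S = n - num_nodes T. \<Sum>p\<in>slots T. ?w (graft S p T) * F T)"
    by (subst sum.Sigma) (auto simp: finite_trees intro!: finite_subset[OF _ finite_trees_le[of n]])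
  also have "\<dots> = (\<Sum>T | num_nodes T \<in> {1..<n}. (a\<^sub>1 * real (num_nodes T) + a\<^sub>0) * total_weight \<Phi> (n - num_nodes T) * (?w T * F T))"
    by (simp add: sum_distrib_right[symmetric] sum_graft_weights total_weight_def sum_distrib_left[symmetric] mult_ac)
  also have "{T. num_nodes T \<in> {1..<n}} = (\<Union>k\<in>{1..<n}. {T. num_nodes T = k})" by auto
  also have "(\<Sum>T\<in>(\<Union>k\<in>{1..<n}. {T. num_nodes T = k}). (a\<^sub>1 * real (num_nodes T) + a\<^sub>0) * total_weight \<Phi> (n - num_nodes T) * (?w T * F T))
      = (\<Sum>k=1..<n. \<Sum>T | num_nodes T = k. (a\<^sub>1 * real (num_nodes T) + a\<^sub>0) * total_weight \<Phi> (n - num_nodes T) * (?w T * F T))"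
    by (rule sum.UNION_disjoint) (auto simp: finite_trees)
  also have "\<dots> = (\<Sum>k=1..<n. (a\<^sub>1 * real k + a\<^sub>0) * total_weight \<Phi> (n - k) * (\<Sum>T | num_nodes T = k. ?w T * F T))"
    by (simp add: sum_distrib_left)
  finally show ?thesis .
qed

definition split_prob :: "nat \<Rightarrow> nat \<Rightarrow> real" where
  "split_prob n k = (a\<^sub>1 * real k + a\<^sub>0) * total_weight \<Phi> k * total_weight \<Phi> (n - k) / ((real n - 1) * total_weight \<Phi> n)"

lemma tree_weight_nonneg: "tree_weight \<Phi> T \<ge> 0"
proof (induction T)
  case (Tree_Node ts)
  then have "prod_list (map (tree_weight \<Phi>) ts) \<ge> 0"
    by (intro prod_list_nonneg) auto
  then show ?case by (simp add: phi_nonneg)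
qed

lemma pmf_random_tree:
  assumes "n \<ge> 1"
  shows "pmf (random_tree \<Phi> n) T = (if num_nodes T = n then tree_weight \<Phi> T / total_weight \<Phi> n else 0)"
  unfolding random_tree_def
proof (rule pmf_embed_pmf)
  let ?f = "\<lambda>T. if num_nodes T = n then tree_weight \<Phi> T / total_weight \<Phi> n else 0"
  note pos = total_weight_pos[OF assms]
  show nonneg: "0 \<le> ?f T" for T
    using pos tree_weight_nonneg[of T] by simp
  have "(\<integral>\<^sup>+T. ennreal (?f T) \<partial>count_space UNIV) = (\<Sum>T | num_nodes T = n. ennreal (?f T))"
    by (intro nn_integral_count_space'[OF finite_trees]) auto
  also have "\<dots> = ennreal (\<Sum>T | num_nodes T = n. ?f T)"
    by (intro sum_ennreal nonneg)
  also have "(\<Sum>T | num_nodes T = n. ?f T) = 1"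
    using pos by (simp add: sum_divide_distrib[symmetric] total_weight_def[symmetric])
  finally show "(\<integral>\<^sup>+T. ennreal (?f T) \<partial>count_space UNIV) = 1" by simp
qed

lemma set_pmf_random_tree:
  assumes "n \<ge> 1"
  shows "set_pmf (random_tree \<Phi> n) \<subseteq> {T. num_nodes T = n}"
  using pmf_random_tree[OF assms] by (auto simp: set_pmf_eq split: if_splits)

end

lemma finite_destruction_cost: "finite (set_pmf (destruction_cost t T))"
proof (induction "num_nodes T" arbitrary: T rule: less_induct)
  case less
  show ?case
  proof (cases "num_nodes T = 1")
    case True
    then show ?thesis by (subst destruction_cost.simps) simp
  next
    case False
    have "finite (set_pmf (destruction_cost t (root_component e T)))" if "e \<in> tree_edges T" for e
      using that by (intro less) (auto simp: tree_edges_def num_nodes_root_component)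
    then show ?thesis
      using False by (subst destruction_cost.simps)
        (auto simp: set_pmf_of_set tree_edges_nonempty finite_tree_edges intro!: finite_UN_I)
  qed
qed

lemma expectation_destruction_cost:
  fixes f :: "real \<Rightarrow> real"
  assumes "num_nodes T \<noteq> 1"
  shows "measure_pmf.expectation (destruction_cost t T) f =
    (\<Sum>e\<in>tree_edges T. measure_pmf.expectation (destruction_cost t (root_component e T)) (\<lambda>y. f (y + t (num_nodes T))))
      / (real (num_nodes T) - 1)"
proof -
  have "measure_pmf.expectation (destruction_cost t T) f = measure_pmf.expectation
    (bind_pmf (pmf_of_set (tree_edges T))
             (\<lambda>e. map_pmf (\<lambda>y. y + t (num_nodes T)) (destruction_cost t (root_component e T)))) f"
    using assms by (subst destruction_cost.simps) simp
  also have "\<dots> = (\<Sum>e\<in>tree_edges T. measure_pmf.expectation (map_pmf (\<lambda>y. y + t (num_nodes T)) (destruction_cost t (root_component e T))) f /\<^sub>R real (card (tree_edges T)))"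
    using assms by (intro pmf_expectation_bind_pmf_of_set)
      (auto simp: tree_edges_nonempty finite_tree_edges finite_destruction_cost)
  also have "real (card (tree_edges T)) = real (num_nodes T) - 1"
    using num_nodes_pos[of T] by (simp add: card_tree_edges of_nat_diff)
  finally show ?thesis by (simp add: sum_distrib_left divide_inverse_commute)
qed

context linear_ratio_family
begin

lemma expectation_total_cost:
  fixes f :: "real \<Rightarrow> real"
  assumes "n \<ge> 1"
  shows "measure_pmf.expectation (total_cost \<Phi> t n) f =
    (\<Sum>T | num_nodes T = n. tree_weight \<Phi> T * measure_pmf.expectation (destruction_cost t T) f) / total_weight \<Phi> n"
  unfolding total_cost_def
  using set_pmf_random_tree[OF assms]
  by (subst pmf_expectation_bind[of "{T. num_nodes T = n}"])
     (simp_all add: finite_trees finite_destruction_cost pmf_random_tree[OF assms] sum_divide_distrib)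

text \<open>Conditionally on its size, the component containing the root is again a random tree of the family.
  In terms of expectations this is the identity \<open>sum_over_cuts\<close> divided by \<open>(n - 1) T\<^sub>n\<close>.\<close>
theorem expectation_total_cost_rec:
  fixes f :: "real \<Rightarrow> real"
  assumes "n \<ge> 2"
  shows "measure_pmf.expectation (total_cost \<Phi> t n) f =
    (\<Sum>k=1..<n. split_prob n k * measure_pmf.expectation (total_cost \<Phi> t k) (\<lambda>y. f (y + t n)))"
proof -
  let ?E = "\<lambda>T. measure_pmf.expectation (destruction_cost t T)"
  have n: "n \<ge> 1" using assms by simp
  have "(\<Sum>T | num_nodes T = n. tree_weight \<Phi> T * ?E T f) =
    (\<Sum>T | num_nodes T = n. \<Sum>e\<in>tree_edges T. tree_weight \<Phi> T * ?E (root_component e T) (\<lambda>y. f (y + t n))) / (real n - 1)"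
    using assms by (subst sum_divide_distrib, intro sum.cong refl, subst expectation_destruction_cost)
      (auto simp: sum_distrib_left)
  also have "\<dots> = (\<Sum>k=1..<n. (a\<^sub>1 * real k + a\<^sub>0) * total_weight \<Phi> (n - k) *
      (\<Sum>T | num_nodes T = k. tree_weight \<Phi> T * ?E T (\<lambda>y. f (y + t n)))) / (real n - 1)"
    by (subst sum_over_cuts) simp
  also have "\<dots> = (\<Sum>k=1..<n. (a\<^sub>1 * real k + a\<^sub>0) * total_weight \<Phi> (n - k) *
      (total_weight \<Phi> k * measure_pmf.expectation (total_cost \<Phi> t k) (\<lambda>y. f (y + t n)))) / (real n - 1)"
  proof (intro arg_cong2[of _ _ _ _ "(/)"] sum.cong refl arg_cong2[of _ _ _ _ "(*)"])
    fix k assume "k \<in> {1..<n}"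
    then have "k \<ge> 1" by simp
    from expectation_total_cost[OF this] total_weight_pos[OF this]
    show "(\<Sum>T | num_nodes T = k. tree_weight \<Phi> T * ?E T (\<lambda>y. f (y + t n))) =
      total_weight \<Phi> k * measure_pmf.expectation (total_cost \<Phi> t k) (\<lambda>y. f (y + t n))" by simp
  qed
  finally show ?thesis
    unfolding expectation_total_cost[OF n] split_prob_def
    by (simp add: sum_divide_distrib mult_ac)
qed

lemma expectation_total_cost_1:
  fixes f :: "real \<Rightarrow> real"
  shows "measure_pmf.expectation (total_cost \<Phi> t 1) f = f (t 1)"
proof -
  have "(\<Sum>T | num_nodes T = 1. tree_weight \<Phi> T * measure_pmf.expectation (destruction_cost t T) f) =
     (\<Sum>T | num_nodes T = 1. tree_weight \<Phi> T * f (t 1))"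
    by (intro sum.cong refl, subst destruction_cost.simps) auto
  also have "\<dots> = total_weight \<Phi> 1 * f (t 1)"
    by (simp add: total_weight_def sum_distrib_right)
  finally show ?thesis
    using total_weight_pos[of 1] by (subst expectation_total_cost) auto
qed

lemma split_prob_sum:
  assumes "n \<ge> 2" shows "(\<Sum>k=1..<n. split_prob n k) = 1"
  \<comment> \<open>The recursion for the constant function 1, with an arbitrary toll.\<close>
  using expectation_total_cost_rec[OF assms, of "\<lambda>_. 0" "\<lambda>_. 1"] by simp

lemma split_prob_nonneg:
  assumes "1 \<le> k" "k < n" shows "split_prob n k \<ge> 0"
proof -
  have "a\<^sub>1 * 1 \<le> a\<^sub>1 * real k" using a0_less assms by (intro mult_left_mono) auto
  then have "a\<^sub>1 * real k + a\<^sub>0 \<ge> 0" using alpha_pos by simp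
  then show ?thesis
    unfolding split_prob_def using assms total_weight_pos[of k] total_weight_pos[of "n - k"] total_weight_pos[of n]
    by (intro divide_nonneg_nonneg mult_nonneg_nonneg) (simp_all add: less_imp_le Suc_le_eq)
qed

end

section \<open>Stirling's formula and quotients of Gamma functions\<close>

definition stirling_remainder :: "real \<Rightarrow> real" where
  "stirling_remainder x = ln (Gamma x) - ((x - 1/2) * ln x - x)"

text \<open>By the functional equation of \<open>\<Gamma>\<close>, one unit shift changes the remainder by
  \<open>1 - (x + 1/2) ln (1 + 1/x) = O(1/x\<^sup>2)\<close>, and these increments are dominated by the telescoping sum of
  \<open>1/((x - 1) x)\<close>.\<close>
lemma stirling_remainder_telescope:
  "\<exists>K>0. \<exists>x0\<ge>2. \<forall>x\<ge>x0. \<forall>n. \<bar>stirling_remainder (x + real n) - stirling_remainder x\<bar> \<le> K / (x - 1)"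
proof -
  have "(\<lambda>x::real. 1 - (x + 1/2) * ln (1 + 1/x)) \<in> O(\<lambda>x. 1 / x^2)"
    by real_asymp
  then obtain K where K: "K > 0"
    and ev: "\<forall>\<^sub>F x in at_top. norm (1 - (x + 1/2) * ln (1 + 1/x)) \<le> K * norm (1 / (x::real)^2)"
    by (auto elim!: landau_o.bigE)
  then obtain x1 where x1: "\<And>x. x \<ge> x1 \<Longrightarrow> \<bar>1 - (x + 1/2) * ln (1 + 1/x)\<bar> \<le> K * (1 / (x::real)^2)"
    by (auto simp: eventually_at_top_linorder)
  define x0 where "x0 = max 2 x1"
  have step: "\<bar>stirling_remainder (x + 1) - stirling_remainder x\<bar> \<le> K / (x - 1) - K / x" if "x \<ge> x0" for x
  proof -
    have x: "x \<ge> 2" "x \<ge> x1" using that by (auto simp: x0_def)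
    have "x \<notin> \<int>\<^sub>\<le>\<^sub>0" using x by (auto elim!: nonpos_Ints_cases)
    then have "Gamma (x + 1) = x * Gamma x" by (rule Gamma_plus1)
    moreover have "Gamma x > 0" using x by simp
    ultimately have "ln (Gamma (x + 1)) = ln x + ln (Gamma x)"
      using x by (simp add: ln_mult_pos)
    moreover have l: "ln (1 + 1/x) = ln (x + 1) - ln x"
      using x ln_divide_pos[of "x + 1" x] by (simp add: add_divide_distrib)
    ultimately have "stirling_remainder (x + 1) - stirling_remainder x = 1 - (x + 1/2) * ln (1 + 1/x)"
      unfolding l by (simp add: stirling_remainder_def algebra_simps)
    then have "\<bar>stirling_remainder (x + 1) - stirling_remainder x\<bar> \<le> K * (1 / x^2)"
      using x1[OF x(2)] by simp
    also have "1 / x^2 \<le> 1 / ((x - 1) * x)"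
      using x by (intro divide_left_mono) (auto simp: power2_eq_square)
    also have "1 / ((x - 1) * x) = 1 / (x - 1) - 1 / x"
      using x by (simp add: field_simps)
    finally show ?thesis using K by (simp add: algebra_simps)
  qed
  have "\<bar>stirling_remainder (x + real n) - stirling_remainder x\<bar> \<le> K / (x - 1) - K / (x - 1 + real n)" if "x \<ge> x0" for x n
  proof (induction n)
    case (Suc n)
    have "\<bar>stirling_remainder (x + real n + 1) - stirling_remainder (x + real n)\<bar>
        \<le> K / (x + real n - 1) - K / (x + real n)"
      using that by (intro step) auto
    with Suc show ?case by (simp add: algebra_simps)
  qed auto
  then have "\<bar>stirling_remainder (x + real n) - stirling_remainder x\<bar> \<le> K / (x - 1)" if "x \<ge> x0" for x n
  proof (rule order.trans)
    have "K / (x - 1 + real n) \<ge> 0"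
      using that K by (intro divide_nonneg_nonneg) (auto simp: x0_def)
    then show "K / (x - 1) - K / (x - 1 + real n) \<le> K / (x - 1)" by simp
  qed (use that in auto)
  then show ?thesis
    using K by (intro exI[of _ K] exI[of _ x0] conjI allI impI) (auto simp: x0_def)
qed

text \<open>Euler's limit formula for \<open>\<Gamma>\<close> shows that the remainder has the same limit along every sequence
  \<open>x + n\<close> as along the integers.\<close>
lemma stirling_remainder_shift:
  assumes "x > 0"
  shows "(\<lambda>n. stirling_remainder (x + real (n + 1)) - stirling_remainder (real (n + 1))) \<longlonglongrightarrow> 0"
proof -
  have x: "x \<notin> \<int>\<^sub>\<le>\<^sub>0" using assms by (auto elim!: nonpos_Ints_cases)
  have G: "Gamma x > 0" using assms by simp
  have "(\<lambda>n. ln (Gamma_series x n)) \<longlonglongrightarrow> ln (Gamma x)"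
    using G by (intro tendsto_ln Gamma_series_LIMSEQ) auto
  moreover have "\<forall>\<^sub>F n in sequentially. ln (Gamma_series x n) =
      x * ln (real n) + ln (Gamma (real n + 1)) - ln (Gamma (x + real n + 1)) + ln (Gamma x)"
    using eventually_gt_at_top[of 0]
  proof eventually_elim
    case (elim n)
    have pos: "Gamma (x + real n + 1) > 0" "Gamma x > 0" using assms by (auto intro!: Gamma_real_pos)
    have "Gamma (real n + 1) = fact n" using Gamma_fact[of n, where 'a = real] by (simp add: add.commute)
    moreover have "pochhammer x (n+1) = Gamma (x + real n + 1) / Gamma x"
      using pochhammer_Gamma[OF x, of "n+1"] by (simp add: add_ac)
    ultimately have "Gamma_series x n = exp (x * ln (real n)) * Gamma (real n + 1) * Gamma x / Gamma (x + real n + 1)"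
      by (simp add: Gamma_series_def)
    moreover have "Gamma (real n + 1) > 0" using elim by (intro Gamma_real_pos) auto
    ultimately show ?case
      using pos by (simp add: ln_mult_pos ln_divide_pos)
  qed
  ultimately have "(\<lambda>n. x * ln (real n) + ln (Gamma (real n + 1)) - ln (Gamma (x + real n + 1)) + ln (Gamma x))
      \<longlonglongrightarrow> ln (Gamma x)"
    by (rule Lim_transform_eventually)
  then have "(\<lambda>n. ln (Gamma x) - (x * ln (real n) + ln (Gamma (real n + 1)) - ln (Gamma (x + real n + 1)) + ln (Gamma x)))
      \<longlonglongrightarrow> ln (Gamma x) - ln (Gamma x)"
    by (intro tendsto_intros)
  moreover have "(\<lambda>n. x * ln (real n) - (x + real n + 1/2) * ln (x + real n + 1) + (real n + 1/2) * ln (real n + 1) + x)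
      \<longlonglongrightarrow> 0"
    by real_asymp
  ultimately have "(\<lambda>n. ln (Gamma x) - (x * ln (real n) + ln (Gamma (real n + 1)) - ln (Gamma (x + real n + 1)) + ln (Gamma x))
     + (x * ln (real n) - (x + real n + 1/2) * ln (x + real n + 1) + (real n + 1/2) * ln (real n + 1) + x))
       \<longlonglongrightarrow> (ln (Gamma x) - ln (Gamma x)) + 0"
    by (rule tendsto_add)
  then show ?thesis
    by (simp add: stirling_remainder_def algebra_simps)
qed

lemma stirling_remainder_limit_exists:
  obtains c where "(\<lambda>x. stirling_remainder x - c) \<in> O(\<lambda>x. 1 / x)"
proof -
  obtain K x0 where x0: "x0 \<ge> 2" "K > 0" and
    "\<forall>x\<ge>x0. \<forall>n. \<bar>stirling_remainder (x + real n) - stirling_remainder x\<bar> \<le> K / (x - 1)"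
    using stirling_remainder_telescope by blast
  then have tele: "\<And>x n. x \<ge> x0 \<Longrightarrow> \<bar>stirling_remainder (x + real n) - stirling_remainder x\<bar> \<le> K / (x - 1)"
    by blast
  have "Cauchy (\<lambda>n. stirling_remainder (real n))"
  proof (rule CauchyI')
    fix e :: real assume e: "e > 0"
    have "(\<lambda>n. K / (real n - 1)) \<longlonglongrightarrow> 0" using x0(2) by real_asymp
    then have "\<forall>\<^sub>F n in sequentially. K / (real n - 1) < e"
      using e by (rule order_tendstoD)
    moreover have "\<forall>\<^sub>F n in sequentially. x0 \<le> real n"
      using filterlim_real_sequentially by (simp add: filterlim_at_top)
    ultimately have "\<forall>\<^sub>F n in sequentially. \<forall>m>n. \<bar>stirling_remainder (real m) - stirling_remainder (real n)\<bar> < e"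
    proof eventually_elim
      case (elim n)
      show ?case
      proof (intro allI impI)
        fix m assume "m > n"
        then obtain d where "m = n + d" using less_imp_add_positive by blast
        then show "\<bar>stirling_remainder (real m) - stirling_remainder (real n)\<bar> < e"
          using tele[of "real n" d] elim by simp
      qed
    qed
    then obtain M where "\<And>n m. n \<ge> M \<Longrightarrow> m > n \<Longrightarrow> \<bar>stirling_remainder (real m) - stirling_remainder (real n)\<bar> < e"
      by (auto simp: eventually_at_top_linorder)
    then show "\<exists>M. \<forall>m\<ge>M. \<forall>n>m. dist (stirling_remainder (real m)) (stirling_remainder (real n)) < e"
      by (intro exI[of _ M]) (auto simp: dist_real_def abs_minus_commute)
  qed
  then obtain c where c: "(\<lambda>n. stirling_remainder (real n)) \<longlonglongrightarrow> c"
    by (auto simp: Cauchy_convergent_iff convergent_def)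
  have lim: "\<bar>stirling_remainder x - c\<bar> \<le> K / (x - 1)" if x: "x \<ge> x0" for x
  proof -
    have "(\<lambda>n. stirling_remainder (real (n + 1))) \<longlonglongrightarrow> c"
      using LIMSEQ_ignore_initial_segment[OF c, of 1] .
    moreover have "(\<lambda>n. stirling_remainder (x + real (n + 1)) - stirling_remainder (real (n + 1))) \<longlonglongrightarrow> 0"
      using x x0 by (intro stirling_remainder_shift) auto
    ultimately have "(\<lambda>n. stirling_remainder (real (n+1)) + (stirling_remainder (x + real (n + 1)) - stirling_remainder (real (n + 1)))) \<longlonglongrightarrow> c + 0"
      by (rule tendsto_add)
    then have *: "(\<lambda>n. stirling_remainder (x + real (n + 1))) \<longlonglongrightarrow> c"
      by simp
    have "\<bar>stirling_remainder x - stirling_remainder (x + real (n + 1))\<bar> \<le> K / (x - 1)" for n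
      using tele[OF x, of "n+1"] by (simp add: abs_minus_commute)
    then show ?thesis
      by (intro tendsto_upperbound[OF tendsto_rabs[OF tendsto_diff[OF tendsto_const *]]]) auto
  qed
  have "(\<lambda>x. stirling_remainder x - c) \<in> O(\<lambda>x. 1 / (x - 1))"
  proof (rule bigoI)
    show "\<forall>\<^sub>F x in at_top. norm (stirling_remainder x - c) \<le> K * norm (1 / (x - 1))"
      using eventually_ge_at_top[of x0] by eventually_elim (use lim x0 in auto)
  qed
  also have "(\<lambda>x::real. 1 / (x - 1)) \<in> O(\<lambda>x. 1 / x)" by real_asymp
  finally show ?thesis by (rule that)
qed

lemma Gamma_legendre_duplication_real:
  assumes "x > (0::real)"
  shows "Gamma x * Gamma (x + 1/2) = exp ((1 - 2*x) * ln 2) * sqrt pi * Gamma (2*x)"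
proof -
  have nonpos: "complex_of_real x \<notin> \<int>\<^sub>\<le>\<^sub>0" "complex_of_real x + 1/2 \<notin> \<int>\<^sub>\<le>\<^sub>0"
    using assms by (auto elim!: nonpos_Ints_cases simp: complex_eq_iff)
  have *: "complex_of_real x + 1/2 = complex_of_real (x + 1/2)" "2 * complex_of_real x = complex_of_real (2 * x)"
    by simp_all
  from Gamma_legendre_duplication[OF nonpos]
  have "complex_of_real (Gamma x * Gamma (x + 1/2)) = complex_of_real (exp ((1 - 2*x) * ln 2) * sqrt pi * Gamma (2*x))"
    unfolding * Gamma_complex_of_real by (simp flip: exp_of_real)
  then show ?thesis
    unfolding of_real_eq_iff .
qed

text \<open>The duplication formula relates the remainders at \<open>x\<close>, \<open>x + 1/2\<close> and \<open>2 x\<close>; in the limit it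
  becomes an equation for the constant.\<close>
theorem stirling_ln_Gamma: "(\<lambda>x. stirling_remainder x - ln (2 * pi) / 2) \<in> O(\<lambda>x. 1 / x)"
proof -
  obtain c where c: "(\<lambda>x. stirling_remainder x - c) \<in> O(\<lambda>x. 1 / x)"
    by (rule stirling_remainder_limit_exists)
  have "(\<lambda>x::real. 1 / x) \<in> o(\<lambda>_. 1 :: real)" by real_asymp
  with c have "(\<lambda>x. stirling_remainder x - c) \<in> o(\<lambda>_. 1 :: real)"
    by (rule landau_o.big_small_trans)
  then have "((\<lambda>x. stirling_remainder x - c) \<longlongrightarrow> 0) at_top"
    by (drule_tac smalloD_tendsto) simp
  then have lim: "(stirling_remainder \<longlongrightarrow> c) at_top"
    using Lim_null by blast
  have "((\<lambda>x. stirling_remainder x + stirling_remainder (x + 1/2) - stirling_remainder (2 * x)) \<longlongrightarrow> c + c - c) at_top"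
    by (intro tendsto_intros lim filterlim_compose[OF lim]; real_asymp)
  moreover define h :: "real \<Rightarrow> real" where "h x = (1 - 2 * x) * ln 2 + ln pi / 2 - (x - 1/2) * ln x + x
      - x * ln (x + 1/2) + x + 1/2 + (2*x - 1/2) * (ln 2 + ln x) - 2 * x" for x
  have "\<forall>\<^sub>F x in at_top. stirling_remainder x + stirling_remainder (x + 1/2) - stirling_remainder (2 * x) = h x"
    using eventually_gt_at_top[of 0]
  proof eventually_elim
    case (elim x)
    have "Gamma x > 0" "Gamma (x + 1/2) > 0" "Gamma (2 * x) > 0" using elim by auto
    then have "ln (Gamma x) + ln (Gamma (x + 1/2)) = (1 - 2 * x) * ln 2 + ln pi / 2 + ln (Gamma (2 * x))"
      using arg_cong[OF Gamma_legendre_duplication_real[OF elim], of ln] by (simp add: ln_mult ln_sqrt)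
    then show ?case using elim by (simp add: h_def stirling_remainder_def ln_mult_pos algebra_simps)
  qed
  ultimately have "(h \<longlongrightarrow> c) at_top"
    by (simp add: Lim_transform_eventually)
  moreover have "(h \<longlongrightarrow> ln (2 * pi) / 2) at_top"
    unfolding h_def by (simp add: ln_mult_pos) real_asymp
  ultimately have "c = ln (2 * pi) / 2"
    using tendsto_unique[OF trivial_limit_at_top_linorder] by blast
  with c show ?thesis by simp
qed

lemma exp_minus_1_bigo:
  assumes "f \<in> O[F](g)" "(g \<longlongrightarrow> (0::real)) F"
  shows "(\<lambda>x. exp (f x) - 1 :: real) \<in> O[F](g)"
proof -
  have "(f \<longlongrightarrow> 0) F"
  proof -
    have "g \<in> o[F](\<lambda>_. 1)" using assms(2) by (intro smalloI_tendsto) auto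
    with assms(1) have "f \<in> o[F](\<lambda>_. 1)" by (rule landau_o.big_small_trans)
    then show ?thesis by (drule_tac smalloD_tendsto) simp
  qed
  have "\<forall>\<^sub>F x in F. \<bar>f x\<bar> < 1/2"
    using \<open>(f \<longlongrightarrow> 0) F\<close> by (intro order_tendstoD(2)[OF tendsto_rabs_zero]) auto
  then have "\<forall>\<^sub>F x in F. norm (exp (f x) - 1) \<le> 2 * norm (f x)"
  proof eventually_elim
    case (elim x)
    have "exp (f x) \<le> 1 + 2 * \<bar>f x\<bar>"
      using exp_bound_lemma[of "f x"] elim by simp
    moreover have "1 + f x \<le> exp (f x)" by (rule exp_ge_add_one_self)
    ultimately show ?case unfolding real_norm_def by arith
  qed
  then have "(\<lambda>x. exp (f x) - 1) \<in> O[F](f)" by (rule bigoI)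
  then show ?thesis using assms(1) landau_o.big_trans by blast
qed

lemma ln_one_plus_div_bigo:
  "(\<lambda>n. (real n + b) * ln (1 + a / real n) - a) \<in> O(\<lambda>n. 1 / real n)"
proof (cases "a = 0")
  case False
  then have "(\<lambda>n. ln (1 + a / real n) - a / real n) \<in> O(\<lambda>n. 1 / real n ^ 2)"
    by real_asymp
  then have "(\<lambda>n. (real n + b) * (ln (1 + a / real n) - a / real n)) \<in> O(\<lambda>n. real n * (1 / real n ^ 2))"
    by (rule landau_o.big.mult[rotated]) real_asymp
  also have "(\<lambda>n. real n * (1 / real n ^ 2)) \<in> O(\<lambda>n. 1 / real n)" by real_asymp
  finally have "(\<lambda>n. (real n + b) * (ln (1 + a / real n) - a / real n) + b * a * (1 / real n)) \<in> O(\<lambda>n. 1 / real n)"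
    by (rule sum_in_bigo) (intro landau_o.big.cmult_in_iff' landau_o.big.mult_in_1 bigoI[of _ "\<bar>b * a\<bar>"], simp add: abs_mult)
  moreover have "\<forall>\<^sub>F n in sequentially. (real n + b) * (ln (1 + a / real n) - a / real n) + b * a * (1 / real n)
      = (real n + b) * ln (1 + a / real n) - a"
    using eventually_gt_at_top[of 0] by eventually_elim (simp add: field_simps)
  ultimately show ?thesis by (subst (asm) landau_o.big.in_cong)
qed simp

text \<open>The relative error \<open>O(1/n)\<close> matters: an error \<open>O(n\<^sup>-\<^sup>1\<^sup>/\<^sup>2)\<close> would cost a logarithm in the estimates for
  the size process below.\<close>
lemma Gamma_ratio_asymptotics:
  "(\<lambda>n. Gamma (real n + a) / fact n / real n powr (a - 1) - 1) \<in> O(\<lambda>n. 1 / real n)"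
proof -
  define R where "R x = stirling_remainder x - ln (2 * pi) / 2" for x
  define f where "f n = R (real n + a) - R (real n + 1) +
      (((real n + (a - 1/2)) * ln (1 + a / real n) - a) - ((real n + 1/2) * ln (1 + 1 / real n) - 1))" for n
  have R: "(\<lambda>n. R (real n + b)) \<in> O(\<lambda>n. 1 / real n)" for b
  proof -
    have "(\<lambda>n. R (real n + b)) \<in> O(\<lambda>n. 1 / (real n + b))"
      unfolding R_def by (rule landau_o.big.compose[OF stirling_ln_Gamma]) real_asymp
    also have "(\<lambda>n. 1 / (real n + b)) \<in> O(\<lambda>n. 1 / real n)" by real_asymp
    finally show ?thesis .
  qed
  have "f \<in> O(\<lambda>n. 1 / real n)"
    unfolding f_def by (intro sum_in_bigo R ln_one_plus_div_bigo)
  then have "(\<lambda>n. exp (f n) - 1) \<in> O(\<lambda>n. 1 / real n)"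
    by (rule exp_minus_1_bigo) real_asymp
  moreover have "\<forall>\<^sub>F n in sequentially. exp (f n) - 1 = Gamma (real n + a) / fact n / real n powr (a - 1) - 1"
  proof -
    have "\<forall>\<^sub>F n in sequentially. real n > max 0 (- a)"
      using filterlim_real_sequentially by (simp only: filterlim_at_top_dense)
    then show ?thesis
    proof eventually_elim
      case (elim n)
      have pos: "Gamma (real n + a) > 0" "Gamma (real n + 1) > 0" "real n > 0" using elim by auto
      have l: "ln (1 + a / real n) = ln (real n + a) - ln (real n)" "ln (1 + 1 / real n) = ln (real n + 1) - ln (real n)"
        using elim ln_divide_pos[of "real n + a" "real n"] ln_divide_pos[of "real n + 1" "real n"]
        by (simp_all add: add_divide_distrib)
      have "f n = ln (Gamma (real n + a)) - ln (Gamma (real n + 1)) - (a - 1) * ln (real n)"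
        unfolding f_def l by (simp add: R_def stirling_remainder_def algebra_simps)
      also have "exp \<dots> = Gamma (real n + a) / Gamma (real n + 1) / real n powr (a - 1)"
        using pos by (simp add: exp_diff powr_def)
      also have "Gamma (real n + 1) = fact n"
        using Gamma_fact[of n, where 'a = real] by (simp add: add.commute)
      finally show ?case by simp
    qed
  qed
  ultimately show ?thesis
    by (subst (asm) landau_o.big.in_cong)
qed

section \<open>Asymptotics of the total weights\<close>

lemma stirling_scaled:
  assumes "b > 0"
  obtains r where "r \<in> O(\<lambda>n. 1 / real n)"
    "\<And>n. n \<ge> 1 \<Longrightarrow> ln (Gamma (b * real n)) = (b * real n - 1/2) * (ln b + ln (real n)) - b * real n + ln (2 * pi) / 2 + r n"
proof -
  define R where "R x = stirling_remainder x - ln (2 * pi) / 2" for x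
  have "(\<lambda>n. R (b * real n)) \<in> O(\<lambda>n. 1 / (b * real n))"
    unfolding R_def by (rule landau_o.big.compose[OF stirling_ln_Gamma]) (use assms in real_asymp)
  also have "(\<lambda>n. 1 / (b * real n)) \<in> O(\<lambda>n. 1 / real n)" using assms by real_asymp
  finally show ?thesis
    by (rule that) (use assms in \<open>simp add: R_def stirling_remainder_def ln_mult_pos\<close>)
qed

context linear_ratio_family
begin

text \<open>The exponential growth rate of the total weights, that is \<open>- ln \<rho>\<close> for the radius of convergence \<open>\<rho>\<close>
  of the tree generating function.  The cases arise because the product formula for \<open>T\<^sub>n\<close> is a power,
  a falling factorial or a rising factorial according to the sign of \<open>a\<^sub>0\<close>.\<close>
definition log_growth :: real where
  "log_growth = (if a\<^sub>0 = 0 then 1 + ln \<alpha>\<^sub>0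
     else if a\<^sub>0 > 0 then ln a\<^sub>0 + \<alpha>\<^sub>0 / a\<^sub>0 * ln (\<alpha>\<^sub>0 / a\<^sub>0) - (\<alpha>\<^sub>0 / a\<^sub>0 - 1) * ln (\<alpha>\<^sub>0 / a\<^sub>0 - 1)
     else ln (- a\<^sub>0) + (\<alpha>\<^sub>0 / (- a\<^sub>0) + 1) * ln (\<alpha>\<^sub>0 / (- a\<^sub>0) + 1) - \<alpha>\<^sub>0 / (- a\<^sub>0) * ln (\<alpha>\<^sub>0 / (- a\<^sub>0)))"

text \<open>The expression subtracted last is the logarithm of the constant \<open>C\<close> in \<open>T\<^sub>n \<rho>\<^sup>n \<sim> C n\<^sup>-\<^sup>3\<^sup>/\<^sup>2\<close>; in terms of \<open>\<alpha>\<^sub>0\<close> and \<open>a\<^sub>1\<close> it is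
  the same expression in all three cases.\<close>
definition log_weight_error :: "nat \<Rightarrow> real" where
  "log_weight_error n = ln (total_weight \<Phi> n) - real n * log_growth + 3/2 * ln (real n)
      - (ln \<alpha>\<^sub>0 - 3 * ln a\<^sub>1 - ln (2 * pi)) / 2"

text \<open>In this case \<open>T\<^sub>n = (\<alpha>\<^sub>0 n)\<^sup>n\<^sup>-\<^sup>1 / n!\<close>.\<close>
lemma ln_total_weight_zero:
  assumes a0: "a\<^sub>0 = 0"
  shows "log_weight_error \<in> O(\<lambda>n. 1 / real n)"
proof -
  obtain r where r: "r \<in> O(\<lambda>n. 1 / real n)" and
    G: "\<And>n. n \<ge> 1 \<Longrightarrow> ln (Gamma (1 * real n)) = (1 * real n - 1/2) * (ln 1 + ln (real n)) - 1 * real n + ln (2 * pi) / 2 + r n"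
    by (rule stirling_scaled[of 1]) auto
  have "(\<lambda>n. - r n) \<in> O(\<lambda>n. 1 / real n)" using r by simp
  moreover have "\<forall>\<^sub>F n in sequentially. - r n = log_weight_error n"
    using eventually_ge_at_top[of 1]
  proof eventually_elim
    case (elim n)
    have "fact n = real n * Gamma (real n)"
      using elim Gamma_fact[of "n - 1", where 'a = real] by (simp add: fact_reduce[of n] of_nat_diff)
    moreover have "Gamma (real n) > 0" using elim by simp
    ultimately have "ln (total_weight \<Phi> n) = real (n - 1) * (ln (real n) + ln \<alpha>\<^sub>0) - ln (real n) - ln (Gamma (real n))"
      using elim alpha_pos
      by (simp add: total_weight_eq a0 ln_divide_pos ln_mult_pos ln_realpow)
    moreover have "log_growth = 1 + ln \<alpha>\<^sub>0" "ln a\<^sub>1 = ln \<alpha>\<^sub>0" "real (n - 1) = real n - 1"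
      using elim unfolding log_growth_def by (simp_all add: a0 of_nat_diff)
    ultimately show ?case
      using G[OF elim] unfolding log_weight_error_def by (simp only:) (simp add: field_simps)
  qed
  ultimately show ?thesis by (subst (asm) landau_o.big.in_cong)
qed

text \<open>With \<open>\<alpha>\<^sub>0 = a\<^sub>0 D\<close> the product is \<open>a\<^sub>0\<close> to the power \<open>n - 1\<close> times \<open>\<Gamma>(D n + 1) / \<Gamma>((D - 1) n + 2)\<close>.\<close>
lemma ln_total_weight_pos:
  assumes a0: "a\<^sub>0 > 0"
  shows "log_weight_error \<in> O(\<lambda>n. 1 / real n)"
proof -
  define D where "D = \<alpha>\<^sub>0 / a\<^sub>0"
  define E where "E = D - 1"
  have D: "D > 1" "E > 0" "\<alpha>\<^sub>0 = D * a\<^sub>0" "a\<^sub>1 = E * a\<^sub>0" "E \<noteq> 0"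
    using a0 a0_less by (auto simp: D_def E_def field_simps)
  obtain r where r: "r \<in> O(\<lambda>n. 1 / real n)" and
    G: "\<And>n. n \<ge> 1 \<Longrightarrow> ln (Gamma (1 * real n)) = (1 * real n - 1/2) * (ln 1 + ln (real n)) - 1 * real n + ln (2 * pi) / 2 + r n"
    by (rule stirling_scaled[of 1]) auto
  obtain r1 where r1: "r1 \<in> O(\<lambda>n. 1 / real n)" and
    G1: "\<And>n. n \<ge> 1 \<Longrightarrow> ln (Gamma (D * real n)) = (D * real n - 1/2) * (ln D + ln (real n)) - D * real n + ln (2 * pi) / 2 + r1 n"
    by (rule stirling_scaled[of D]) (use D in auto)
  obtain r2 where r2: "r2 \<in> O(\<lambda>n. 1 / real n)" and
    G2: "\<And>n. n \<ge> 1 \<Longrightarrow> ln (Gamma (E * real n)) = (E * real n - 1/2) * (ln E + ln (real n)) - E * real n + ln (2 * pi) / 2 + r2 n"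
    by (rule stirling_scaled[of E]) (use D in auto)
  have "(\<lambda>n. ln E + ln (real n) - ln (E * real n + 1)) \<in> O(\<lambda>n. 1 / real n)"
    using D(2) by real_asymp
  then have "(\<lambda>n. ln E + ln (real n) - ln (E * real n + 1) + r1 n - r2 n - r n) \<in> O(\<lambda>n. 1 / real n)"
    by (rule sum_in_bigo(2)[OF sum_in_bigo(2)[OF sum_in_bigo(1)[OF _ r1] r2] r])
  moreover have "\<forall>\<^sub>F n in sequentially. ln E + ln (real n) - ln (E * real n + 1) + r1 n - r2 n - r n = log_weight_error n"
    using eventually_ge_at_top[of 1]
  proof eventually_elim
    case (elim n)
    define x where "x = E * real n"
    have x: "x > 0" using D elim by (simp add: x_def)
    have pos: "Gamma (real n) > 0" "Gamma (D * real n) > 0" "Gamma x > 0" using elim D x by auto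
    have f: "fact n = real n * Gamma (real n)"
      using elim Gamma_fact[of "n - 1", where 'a = real] by (simp add: fact_reduce[of n] of_nat_diff)
    have "(\<Prod>i<n-1. real n * \<alpha>\<^sub>0 - a\<^sub>0 * real i) = (\<Prod>i<n-1. a\<^sub>0 * (D * real n - real i))"
      by (intro prod.cong refl) (simp add: D(3) algebra_simps)
    also have "\<dots> = a\<^sub>0 ^ (n - 1) * (\<Prod>i<n-1. D * real n - real i)"
      by (simp add: prod.distrib)
    also have "(\<Prod>i<n-1. D * real n - real i) = pochhammer (x + 2) (n - 1)"
      unfolding pochhammer_prod atLeast0LessThan
    proof (rule prod.reindex_bij_witness[of _ "\<lambda>i. n - 2 - i" "\<lambda>i. n - 2 - i"])
      fix i assume "i \<in> {..<n-1}"
      then have "i \<le> n - 2" "n \<ge> 2" by auto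
      then show "x + 2 + real (n - 2 - i) = D * real n - real i"
        by (simp add: x_def E_def of_nat_diff algebra_simps)
    qed auto
    also have "\<dots> = Gamma (D * real n + 1) / Gamma (x + 2)"
    proof -
      have "x + 2 \<notin> \<int>\<^sub>\<le>\<^sub>0" using x by (auto elim!: nonpos_Ints_cases)
      moreover have "x + 2 + real (n - 1) = D * real n + 1"
        using elim by (simp add: x_def E_def of_nat_diff algebra_simps)
      ultimately show ?thesis by (metis pochhammer_Gamma)
    qed
    also have "Gamma (D * real n + 1) = D * real n * Gamma (D * real n)"
    proof (rule Gamma_plus1)
      have "D * real n > 0" using D elim by simp
      then show "D * real n \<notin> \<int>\<^sub>\<le>\<^sub>0" by (auto elim!: nonpos_Ints_cases)
    qed
    also have "Gamma (x + 2) = (x + 1) * (x * Gamma x)"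
    proof -
      have "x + 1 \<notin> \<int>\<^sub>\<le>\<^sub>0" "x \<notin> \<int>\<^sub>\<le>\<^sub>0" using x by (auto elim!: nonpos_Ints_cases)
      then show ?thesis using Gamma_plus1[of "x + 1"] Gamma_plus1[of x] by (simp add: add.assoc)
    qed
    finally have "total_weight \<Phi> n = a\<^sub>0 ^ (n - 1) * (D * real n * Gamma (D * real n) / ((x + 1) * (x * Gamma x))) / (real n * Gamma (real n))"
      using elim by (simp add: total_weight_eq f)
    then have "ln (total_weight \<Phi> n) = real (n - 1) * ln a\<^sub>0 + ln D + ln (real n) + ln (Gamma (D * real n)) - ln (x + 1) - ln x
        - ln (Gamma x) - ln (real n) - ln (Gamma (real n))"
      using pos x elim D a0 by (simp add: ln_divide_pos ln_mult_pos ln_realpow)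
    also have "ln x = ln E + ln (real n)" using D elim by (simp add: x_def ln_mult_pos)
    finally have "ln (total_weight \<Phi> n) = real (n - 1) * ln a\<^sub>0 + ln D + ln (real n) + ln (Gamma (D * real n)) - ln (x + 1) - (ln E + ln (real n))
        - ln (Gamma x) - ln (real n) - ln (Gamma (real n))" .
    moreover have "ln \<alpha>\<^sub>0 = ln D + ln a\<^sub>0" "ln a\<^sub>1 = ln E + ln a\<^sub>0"
      unfolding D(3) D(4)[unfolded D(3)] using D a0 by (simp_all add: ln_mult_pos)
    moreover have "log_growth = ln a\<^sub>0 + D * ln D - E * ln E"
      using a0 by (simp add: log_growth_def D_def E_def)
    moreover have "real (n - 1) = real n - 1" using elim by (simp add: of_nat_diff)
    ultimately show ?case
      unfolding log_weight_error_def using G[OF elim] G1[OF elim] G2[OF elim]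
      by (simp only: x_def E_def) (simp add: field_simps)
  qed
  ultimately show ?thesis by (subst (asm) landau_o.big.in_cong)
qed

text \<open>With \<open>c = - a\<^sub>0\<close> and \<open>\<alpha>\<^sub>0 = c E\<close> the product is \<open>c\<close> to the power \<open>n - 1\<close> times
  \<open>\<Gamma>((E + 1) n - 1) / \<Gamma>(E n)\<close>.\<close>
lemma ln_total_weight_neg:
  assumes a0: "a\<^sub>0 < 0"
  shows "log_weight_error \<in> O(\<lambda>n. 1 / real n)"
proof -
  define c where "c = - a\<^sub>0"
  define E where "E = \<alpha>\<^sub>0 / c"
  define B where "B = E + 1"
  have D: "c > 0" "E > 0" "B > 1" "\<alpha>\<^sub>0 = E * c" "a\<^sub>1 = B * c"
    using a0 alpha_pos by (auto simp: c_def E_def B_def field_simps)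
  obtain r where r: "r \<in> O(\<lambda>n. 1 / real n)" and
    G: "\<And>n. n \<ge> 1 \<Longrightarrow> ln (Gamma (1 * real n)) = (1 * real n - 1/2) * (ln 1 + ln (real n)) - 1 * real n + ln (2 * pi) / 2 + r n"
    by (rule stirling_scaled[of 1]) auto
  obtain r1 where r1: "r1 \<in> O(\<lambda>n. 1 / real n)" and
    G1: "\<And>n. n \<ge> 1 \<Longrightarrow> ln (Gamma (B * real n)) = (B * real n - 1/2) * (ln B + ln (real n)) - B * real n + ln (2 * pi) / 2 + r1 n"
    by (rule stirling_scaled[of B]) (use D in auto)
  obtain r2 where r2: "r2 \<in> O(\<lambda>n. 1 / real n)" and
    G2: "\<And>n. n \<ge> 1 \<Longrightarrow> ln (Gamma (E * real n)) = (E * real n - 1/2) * (ln E + ln (real n)) - E * real n + ln (2 * pi) / 2 + r2 n"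
    by (rule stirling_scaled[of E]) (use D in auto)
  have "(\<lambda>n. ln B + ln (real n) - ln (B * real n - 1)) \<in> O(\<lambda>n. 1 / real n)"
    using D(3) by real_asymp
  then have "(\<lambda>n. ln B + ln (real n) - ln (B * real n - 1) + r1 n - r2 n - r n) \<in> O(\<lambda>n. 1 / real n)"
    by (rule sum_in_bigo(2)[OF sum_in_bigo(2)[OF sum_in_bigo(1)[OF _ r1] r2] r])
  moreover have "\<forall>\<^sub>F n in sequentially. ln B + ln (real n) - ln (B * real n - 1) + r1 n - r2 n - r n = log_weight_error n"
    using eventually_ge_at_top[of 1]
  proof eventually_elim
    case (elim n)
    define x where "x = B * real n - 1"
    have "B * 1 \<le> B * real n" using D elim by (intro mult_left_mono) auto
    then have x: "x > 0" using D(3) unfolding x_def by linarith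
    have pos: "Gamma (real n) > 0" "Gamma (B * real n) > 0" "Gamma (E * real n) > 0" using elim D x by auto
    have f: "fact n = real n * Gamma (real n)"
      using elim Gamma_fact[of "n - 1", where 'a = real] by (simp add: fact_reduce[of n] of_nat_diff)
    have "(\<Prod>i<n-1. real n * \<alpha>\<^sub>0 - a\<^sub>0 * real i) = (\<Prod>i<n-1. c * (E * real n + real i))"
      by (intro prod.cong refl) (simp add: D(4) c_def algebra_simps)
    also have "\<dots> = c ^ (n - 1) * (\<Prod>i<n-1. E * real n + real i)"
      by (simp add: prod.distrib)
    also have "(\<Prod>i<n-1. E * real n + real i) = pochhammer (E * real n) (n - 1)"
      unfolding pochhammer_prod atLeast0LessThan by simp
    also have "\<dots> = Gamma x / Gamma (E * real n)"
    proof -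
      have "E * real n > 0" using D elim by simp
      then have "E * real n \<notin> \<int>\<^sub>\<le>\<^sub>0" by (auto elim!: nonpos_Ints_cases)
      moreover have "E * real n + real (n - 1) = x"
        using elim by (simp add: x_def B_def of_nat_diff algebra_simps)
      ultimately show ?thesis by (simp add: pochhammer_Gamma)
    qed
    also have "Gamma x = Gamma (B * real n) / x"
    proof -
      have "x \<notin> \<int>\<^sub>\<le>\<^sub>0" using x by (auto elim!: nonpos_Ints_cases)
      then show ?thesis using Gamma_plus1[of "x"] x by (simp add: x_def)
    qed
    finally have "total_weight \<Phi> n = c ^ (n - 1) * (Gamma (B * real n) / x / Gamma (E * real n)) / (real n * Gamma (real n))"
      using elim by (simp add: total_weight_eq f)
    then have "ln (total_weight \<Phi> n) = real (n - 1) * ln c + ln (Gamma (B * real n)) - ln x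
        - ln (Gamma (E * real n)) - ln (real n) - ln (Gamma (real n))"
      using pos x elim D a0 by (simp add: ln_divide_pos ln_mult_pos ln_realpow)
    moreover have "ln \<alpha>\<^sub>0 = ln E + ln c" "ln a\<^sub>1 = ln B + ln c"
      unfolding D(4) D(5)[unfolded D(4)] using D by (simp_all add: ln_mult_pos)
    moreover have "log_growth = ln c + B * ln B - E * ln E"
      using a0 by (simp add: log_growth_def c_def E_def B_def)
    moreover have "real (n - 1) = real n - 1" using elim by (simp add: of_nat_diff)
    ultimately show ?case
      unfolding log_weight_error_def using G[OF elim] G1[OF elim] G2[OF elim]
      by (simp only: x_def) (simp add: B_def field_simps)
  qed
  ultimately show ?thesis by (subst (asm) landau_o.big.in_cong)
qed

text \<open>Multiplying \<open>T\<^sub>n\<close> by \<open>\<rho>\<^sup>n\<close> leaves the splitting probabilities unchanged and removes the exponential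
  growth.\<close>
definition tilted_weight :: "nat \<Rightarrow> real" where
  "tilted_weight n = total_weight \<Phi> n * exp (- log_growth) ^ n"

definition weight_const :: real where
  "weight_const = sqrt (\<alpha>\<^sub>0 / (2 * pi * a\<^sub>1 ^ 3))"

lemma weight_const_pos: "weight_const > 0"
  using alpha_pos a0_less by (auto simp: weight_const_def intro!: divide_pos_pos mult_pos_pos zero_less_power)

theorem tilted_weight_asymptotics:
  "(\<lambda>n. tilted_weight n * real n powr (3/2) / weight_const - 1) \<in> O(\<lambda>n. 1 / real n)"
proof -
  have "log_weight_error \<in> O(\<lambda>n. 1 / real n)"
    using ln_total_weight_zero ln_total_weight_pos ln_total_weight_neg by (cases a\<^sub>0 "0::real" rule: linorder_cases) auto
  then have "(\<lambda>n. exp (log_weight_error n) - 1) \<in> O(\<lambda>n. 1 / real n)"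
    by (rule exp_minus_1_bigo) real_asymp
  moreover have "\<forall>\<^sub>F n in sequentially. exp (log_weight_error n) - 1 = tilted_weight n * real n powr (3/2) / weight_const - 1"
    using eventually_ge_at_top[of 1]
  proof eventually_elim
    case (elim n)
    have "ln weight_const = (ln \<alpha>\<^sub>0 - 3 * ln a\<^sub>1 - ln (2 * pi)) / 2"
      using alpha_pos a0_less
      by (simp add: weight_const_def ln_sqrt ln_divide_pos ln_mult_pos ln_realpow)
    then have "log_weight_error n = ln (total_weight \<Phi> n) + real n * (- log_growth) + 3/2 * ln (real n) - ln weight_const"
      by (simp add: log_weight_error_def)
    then have "exp (log_weight_error n) = total_weight \<Phi> n * exp (- log_growth) ^ n * real n powr (3/2) / weight_const"
      using total_weight_pos[OF elim] weight_const_pos elim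
      by (simp only: exp_diff exp_add exp_of_nat_mult exp_ln) (simp add: powr_def)
    then show ?case by (simp add: tilted_weight_def)
  qed
  ultimately show ?thesis by (subst (asm) landau_o.big.in_cong)
qed

lemma split_prob_tilted:
  assumes "1 \<le> k" "k < n"
  shows "split_prob n k = (a\<^sub>1 * real k + a\<^sub>0) * tilted_weight k * tilted_weight (n - k) / ((real n - 1) * tilted_weight n)"
proof -
  have "exp (- log_growth) ^ n = exp (- log_growth) ^ k * exp (- log_growth) ^ (n - k)"
    using assms by (simp flip: power_add)
  then show ?thesis by (simp add: split_prob_def tilted_weight_def)
qed

section \<open>The constants \<open>\<tau>\<close> and \<open>\<sigma>\<close>\<close>

text \<open>The quotients \<open>\<phi>\<^sub>k\<^sub>+\<^sub>1 / \<phi>\<^sub>k\<close> are eventually at most any number above \<open>q = max 0 (- a\<^sub>0)\<close>.  For \<open>a\<^sub>0 > 0\<close> this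
  holds since the coefficients are nonnegative, although \<open>\<bar>a\<^sub>0\<bar>\<close> itself need not be smaller than \<open>a\<^sub>1\<close>.
  As \<open>q < a\<^sub>1\<close>, the series converges beyond \<open>1 / a\<^sub>1\<close>.\<close>
lemma conv_radius_phi: "ereal (1 / a\<^sub>1) < fps_conv_radius \<Phi>"
proof -
  define q where "q = max 0 (- a\<^sub>0)"
  define q' where "q' = (q + a\<^sub>1) / 2"
  have q: "q \<ge> 0" "- a\<^sub>0 \<le> q" "q < q'" "q' < a\<^sub>1"
    using alpha_pos a0_less by (auto simp: q_def q'_def)
  have ratio: "fps_nth \<Phi> (Suc n) \<le> q' * fps_nth \<Phi> n" if n: "real n \<ge> \<alpha>\<^sub>0 / (q' - q)" for n
  proof -
    have "\<alpha>\<^sub>0 \<le> (q' - q) * real n" using n q by (simp add: field_simps)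
    moreover have "- a\<^sub>0 * real n \<le> q * real n" using q by (intro mult_right_mono) auto
    ultimately have "\<alpha>\<^sub>0 - a\<^sub>0 * real n \<le> q' * real (Suc n)"
      using q by (simp add: algebra_simps)
    then have "real (Suc n) * fps_nth \<Phi> (Suc n) \<le> q' * real (Suc n) * fps_nth \<Phi> n"
      unfolding phi_Suc using phi_nonneg by (rule mult_right_mono)
    then have "real (Suc n) * fps_nth \<Phi> (Suc n) \<le> real (Suc n) * (q' * fps_nth \<Phi> n)"
      by (simp only: mult_ac)
    then show ?thesis by (rule mult_left_le_imp_le) simp
  qed
  have "ereal (1 / q') \<le> conv_radius (fps_nth \<Phi>)"
  proof (rule conv_radius_geI_ex)
    fix r :: real assume r: "0 < r" "ereal r < ereal (1 / q')"
    have "summable (\<lambda>n. fps_nth \<Phi> n * r ^ n)"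
    proof (rule summable_ratio_test[where c = "r * q'" and N = "nat \<lceil>\<alpha>\<^sub>0 / (q' - q)\<rceil>"])
      show "r * q' < 1" using r q by (simp add: field_simps)
      fix n assume "nat \<lceil>\<alpha>\<^sub>0 / (q' - q)\<rceil> \<le> n"
      then have "real n \<ge> \<alpha>\<^sub>0 / (q' - q)" by linarith
      from mult_right_mono[OF ratio[OF this], of "r ^ Suc n"] r
      show "norm (fps_nth \<Phi> (Suc n) * r ^ Suc n) \<le> r * q' * norm (fps_nth \<Phi> n * r ^ n)"
        using phi_nonneg by (simp add: abs_mult mult_ac)
    qed
    then show "\<exists>z. norm z = r \<and> summable (\<lambda>n. fps_nth \<Phi> n * z ^ n)"
      using r by (intro exI[of _ r]) auto
  qed
  moreover have "1 / a\<^sub>1 < 1 / q'" using q by (intro divide_strict_left_mono) (auto intro: mult_pos_pos)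
  ultimately show ?thesis
    unfolding fps_conv_radius_def by (metis less_ereal.simps(1) order_less_le_trans)
qed

lemma eval_phi_pos:
  assumes "0 \<le> t" "ereal t < fps_conv_radius \<Phi>"
  shows "eval_fps \<Phi> t > 0"
proof -
  have "summable (\<lambda>n. fps_nth \<Phi> n * t ^ n)"
    using assms by (intro summable_fps) auto
  then have "(\<Sum>n<1. fps_nth \<Phi> n * t ^ n) \<le> (\<Sum>n. fps_nth \<Phi> n * t ^ n)"
    using phi_nonneg assms by (intro sum_le_suminf) auto
  then show ?thesis by (simp add: eval_fps_def phi_0)
qed

lemma eval_phi_ode:
  assumes "ereal (norm t) < fps_conv_radius \<Phi>"
  shows "(1 + a\<^sub>0 * t) * eval_fps (fps_deriv \<Phi>) t = \<alpha>\<^sub>0 * eval_fps \<Phi> t"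
    and "(1 + a\<^sub>0 * t) * eval_fps (fps_deriv (fps_deriv \<Phi>)) t = a\<^sub>1 * eval_fps (fps_deriv \<Phi>) t"
proof -
  have r1: "ereal (norm t) < fps_conv_radius (fps_deriv \<Phi>)"
    using assms fps_conv_radius_deriv[of \<Phi>] by (rule order_less_le_trans)
  have r2: "ereal (norm t) < fps_conv_radius (fps_deriv (fps_deriv \<Phi>))"
    using r1 fps_conv_radius_deriv[of "fps_deriv \<Phi>"] by (rule order_less_le_trans)
  have poly: "1 + fps_const a\<^sub>0 * fps_X = fps_of_poly [:1, a\<^sub>0:]"
    by (simp add: fps_of_poly_pCons)
  have r0: "ereal (norm t) < fps_conv_radius (1 + fps_const a\<^sub>0 * fps_X)"
    unfolding poly by simp
  have lin: "eval_fps (1 + fps_const a\<^sub>0 * fps_X) t = 1 + a\<^sub>0 * t"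
    unfolding poly by (simp add: mult.commute)
  show "(1 + a\<^sub>0 * t) * eval_fps (fps_deriv \<Phi>) t = \<alpha>\<^sub>0 * eval_fps \<Phi> t"
    using arg_cong[OF fps_ode, of "\<lambda>F. eval_fps F t"] assms r0 r1 lin
    by (simp add: eval_fps_mult)
  have "(1 + fps_const a\<^sub>0 * fps_X) * fps_deriv (fps_deriv \<Phi>) = fps_const a\<^sub>1 * fps_deriv \<Phi>"
    using arg_cong[OF fps_ode, of fps_deriv] by (simp add: algebra_simps flip: fps_const_sub)
  from arg_cong[OF this, of "\<lambda>F. eval_fps F t"]
  show "(1 + a\<^sub>0 * t) * eval_fps (fps_deriv (fps_deriv \<Phi>)) t = a\<^sub>1 * eval_fps (fps_deriv \<Phi>) t"
    using r0 r1 r2 lin by (simp add: eval_fps_mult)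
qed

text \<open>Given the differential equation, \<open>t \<Phi>' = \<Phi>\<close> is equivalent to \<open>1 + a\<^sub>0 t = \<alpha>\<^sub>0 t\<close>.\<close>
lemma char_root_eq: "char_root \<Phi> = 1 / a\<^sub>1"
  unfolding char_root_def
proof (rule the_equality)
  have a1: "a\<^sub>1 > 0" using a0_less by simp
  have "1 + a\<^sub>0 * (1 / a\<^sub>1) = \<alpha>\<^sub>0 * (1 / a\<^sub>1)" using a1 by (simp add: field_simps)
  then have "\<alpha>\<^sub>0 * (1 / a\<^sub>1 * eval_fps (fps_deriv \<Phi>) (1 / a\<^sub>1)) = \<alpha>\<^sub>0 * eval_fps \<Phi> (1 / a\<^sub>1)"
    using eval_phi_ode(1)[of "1 / a\<^sub>1"] conv_radius_phi a1 by simp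
  then have "1 / a\<^sub>1 * eval_fps (fps_deriv \<Phi>) (1 / a\<^sub>1) = eval_fps \<Phi> (1 / a\<^sub>1)"
    by (rule mult_left_cancel[THEN iffD1, rotated]) (use alpha_pos in simp)
  then show "0 < 1 / a\<^sub>1 \<and> ereal (1 / a\<^sub>1) < fps_conv_radius \<Phi> \<and>
      1 / a\<^sub>1 * eval_fps (fps_deriv \<Phi>) (1 / a\<^sub>1) = eval_fps \<Phi> (1 / a\<^sub>1)"
    using alpha_pos a1 conv_radius_phi by simp
next
  fix t assume t: "0 < t \<and> ereal t < fps_conv_radius \<Phi> \<and> t * eval_fps (fps_deriv \<Phi>) t = eval_fps \<Phi> t"
  then have pos: "eval_fps \<Phi> t > 0" by (intro eval_phi_pos) auto
  with t have "eval_fps (fps_deriv \<Phi>) t \<noteq> 0" by auto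
  moreover have "(1 + a\<^sub>0 * t) * eval_fps (fps_deriv \<Phi>) t = \<alpha>\<^sub>0 * (t * eval_fps (fps_deriv \<Phi>) t)"
    using eval_phi_ode(1)[of t] t by simp
  ultimately have "1 + a\<^sub>0 * t = \<alpha>\<^sub>0 * t" by simp
  then have "a\<^sub>1 * t = 1" by (simp add: algebra_simps)
  then show "t = 1 / a\<^sub>1" using a0_less by (simp add: field_simps)
qed

theorem scaling_sigma_eq: "scaling_sigma \<Phi> = sqrt (a\<^sub>1 / \<alpha>\<^sub>0)"
proof -
  define t where "t = 1 / a\<^sub>1"
  have a1: "a\<^sub>1 > 0" using a0_less by simp
  have lin: "1 + a\<^sub>0 * t = \<alpha>\<^sub>0 / a\<^sub>1" using a1 by (simp add: t_def field_simps)
  have t: "ereal (norm t) < fps_conv_radius \<Phi>" "0 \<le> t" using conv_radius_phi a1 by (auto simp: t_def)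
  have pos: "eval_fps \<Phi> t > 0" using t by (intro eval_phi_pos) auto
  have "eval_fps (fps_deriv \<Phi>) t = a\<^sub>1 * eval_fps \<Phi> t"
  proof -
    have "eval_fps (fps_deriv \<Phi>) t = a\<^sub>1 / \<alpha>\<^sub>0 * (\<alpha>\<^sub>0 / a\<^sub>1 * eval_fps (fps_deriv \<Phi>) t)"
      using alpha_pos a1 by simp
    also have "\<dots> = a\<^sub>1 * eval_fps \<Phi> t"
      unfolding eval_phi_ode(1)[OF t(1), unfolded lin] using alpha_pos by simp
    finally show ?thesis .
  qed
  moreover have "eval_fps (fps_deriv (fps_deriv \<Phi>)) t = a\<^sub>1 / \<alpha>\<^sub>0 * (a\<^sub>1 * eval_fps (fps_deriv \<Phi>) t)"
  proof -
    have "eval_fps (fps_deriv (fps_deriv \<Phi>)) t = a\<^sub>1 / \<alpha>\<^sub>0 * (\<alpha>\<^sub>0 / a\<^sub>1 * eval_fps (fps_deriv (fps_deriv \<Phi>)) t)"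
      using alpha_pos a1 by simp
    then show ?thesis
      unfolding eval_phi_ode(2)[OF t(1), unfolded lin] .
  qed
  ultimately have "eval_fps (fps_deriv (fps_deriv \<Phi>)) t / eval_fps \<Phi> t = a\<^sub>1 ^ 2 * (a\<^sub>1 / \<alpha>\<^sub>0)"
    using pos by (simp add: power2_eq_square mult_ac)
  then have "scaling_sigma \<Phi> = t * sqrt (a\<^sub>1 ^ 2 * (a\<^sub>1 / \<alpha>\<^sub>0))"
    unfolding scaling_sigma_def Let_def char_root_eq t_def[symmetric] by simp
  also have "\<dots> = sqrt (a\<^sub>1 / \<alpha>\<^sub>0)"
    unfolding real_sqrt_mult using a1 by (simp add: t_def)
  finally show ?thesis .
qed

end

section \<open>Convolutions with a three-halves tail\<close>

text \<open>The comparison argument for the size process runs over all sizes from \<open>1\<close> on, so asymptotic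
  bounds are needed in a form without a threshold.\<close>
lemma bigo_explicit_bound:
  fixes f g :: "nat \<Rightarrow> real"
  assumes "f \<in> O(g)" and pos: "\<And>n. n \<ge> 1 \<Longrightarrow> g n > 0"
  obtains K where "K > 0" "\<And>n. n \<ge> 1 \<Longrightarrow> \<bar>f n\<bar> \<le> K * g n"
proof -
  from assms(1) obtain c where c: "c > 0" "\<forall>\<^sub>F n in sequentially. norm (f n) \<le> c * norm (g n)"
    by (rule landau_o.bigE)
  then obtain N where N: "\<And>n. n \<ge> N \<Longrightarrow> \<bar>f n\<bar> \<le> c * \<bar>g n\<bar>"
    by (auto simp: eventually_at_top_linorder)
  define K where "K = c + (\<Sum>n\<in>{1..<N}. \<bar>f n\<bar> / g n)"
  have nonneg: "(\<Sum>n\<in>{1..<N}. \<bar>f n\<bar> / g n) \<ge> 0"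
    using pos by (intro sum_nonneg divide_nonneg_pos) auto
  have "\<bar>f n\<bar> \<le> K * g n" if n: "n \<ge> 1" for n
  proof (cases "n \<ge> N")
    case True
    then have "\<bar>f n\<bar> \<le> c * g n" using N[of n] pos[OF n] by simp
    also have "\<dots> \<le> K * g n" using nonneg pos[OF n] by (intro mult_right_mono) (auto simp: K_def)
    finally show ?thesis .
  next
    case False
    have "\<bar>f n\<bar> / g n \<le> (\<Sum>n\<in>{1..<N}. \<bar>f n\<bar> / g n)"
      using False n pos by (intro member_le_sum divide_nonneg_pos) auto
    also have "\<dots> \<le> K" using c by (simp add: K_def)
    finally show ?thesis using pos[OF n] by (simp add: field_simps)
  qed
  moreover have "K > 0" using c nonneg by (simp add: K_def)
  ultimately show ?thesis using that by blast
qed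

lemma bigoI_nat:
  fixes f g :: "nat \<Rightarrow> real"
  assumes "\<And>n. n \<ge> 1 \<Longrightarrow> \<bar>f n\<bar> \<le> K * g n" "\<And>n. n \<ge> 1 \<Longrightarrow> g n \<ge> 0"
  shows "f \<in> O(g)"
proof (rule bigoI)
  show "\<forall>\<^sub>F n in sequentially. norm (f n) \<le> K * norm (g n)"
    using eventually_ge_at_top[of 1] by eventually_elim (use assms in auto)
qed

lemma summable_inverse_three_halves: "summable (\<lambda>n. real n powr (-3/2))"
  using summable_real_powr_iff[of "-3/2"] by simp

lemma square_mult_le_sum_cubes:
  fixes a b :: real
  assumes "a \<ge> 0" "b \<ge> 0"
  shows "a ^ 2 * b \<le> a ^ 3 + b ^ 3"
proof (cases "a \<le> b")
  case True
  have "a ^ 2 * b \<le> b ^ 2 * b" using True assms by (intro mult_right_mono power_mono) auto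
  also have "\<dots> = b ^ 3" by (simp add: power3_eq_cube power2_eq_square)
  finally show ?thesis using zero_le_power[OF assms(1), of 3] by linarith
next
  case False
  have "a ^ 2 * b \<le> a ^ 2 * a" using False assms by (intro mult_left_mono) auto
  also have "\<dots> = a ^ 3" by (simp add: power3_eq_cube power2_eq_square)
  finally show ?thesis using zero_le_power[OF assms(2), of 3] by linarith
qed

lemma sum_powr_three_halves_bounded:
  obtains S where "S > 0" "\<And>n. (\<Sum>k=1..<n. real k powr (-3/2) + real (n - k) powr (-3/2)) \<le> S"
proof -
  define s where "s = (\<Sum>n. real n powr (-3/2))"
  have le: "(\<Sum>k=1..<n. real k powr (-3/2)) \<le> s" for n
    unfolding s_def by (intro sum_le_suminf summable_inverse_three_halves) auto
  have refl: "(\<Sum>k=1..<n. real (n - k) powr (-3/2)) = (\<Sum>k=1..<n. real k powr (-3/2))" for n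
    by (rule sum.reindex_bij_witness[of _ "\<lambda>k. n - k" "\<lambda>k. n - k"]) auto
  have "s \<ge> 0" using le[of 0] by simp
  moreover have "(\<Sum>k=1..<n. real k powr (-3/2) + real (n - k) powr (-3/2)) \<le> 2 * s + 1" for n
    unfolding sum.distrib refl using le[of n] by linarith
  ultimately show ?thesis
    by (intro that[of "2 * s + 1"]) auto
qed

text \<open>Put \<open>u = k\<^sup>-\<^sup>1\<^sup>/\<^sup>2\<close> and \<open>v = (n - k)\<^sup>-\<^sup>1\<^sup>/\<^sup>2\<close>.  Since \<open>\<surd>n \<le> 1/u + 1/v\<close>, multiplying the summand \<open>u v\<^sup>3\<close> by \<open>\<surd>n\<close>
  gives at most \<open>v\<^sup>3 + u v\<^sup>2 \<le> 2 (u\<^sup>3 + v\<^sup>3)\<close>, and the sums of the cubes converge.\<close>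
lemma convolution_half_three_halves:
  obtains K where "K > 0" "\<And>n. n \<ge> 1 \<Longrightarrow>
    (\<Sum>k=1..<n. real k powr (-1/2) * real (n - k) powr (-3/2)) \<le> K * real n powr (-1/2)"
proof -
  obtain S where S: "S > 0" "\<And>n. (\<Sum>k=1..<n. real k powr (-3/2) + real (n - k) powr (-3/2)) \<le> S"
    by (rule sum_powr_three_halves_bounded) blast
  have "(\<Sum>k=1..<n. real k powr (-1/2) * real (n - k) powr (-3/2)) \<le> 2 * S * real n powr (-1/2)" if n: "n \<ge> 1" for n
  proof -
    have "real n powr (1/2) * (real k powr (-1/2) * real (n - k) powr (-3/2))
        \<le> 2 * (real k powr (-3/2) + real (n - k) powr (-3/2))" if k: "k \<in> {1..<n}" for k
    proof -
      define u v where "u = real k powr (-1/2)" and "v = real (n - k) powr (-1/2)"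
      have uv: "u > 0" "v > 0" using k by (auto simp: u_def v_def)
      have cubes: "real k powr (-3/2) = u ^ 3" "real (n - k) powr (-3/2) = v ^ 3"
        using k by (simp_all add: u_def v_def powr_realpow[symmetric] powr_powr)
      have inv: "real k powr (1/2) * u = 1" "real (n - k) powr (1/2) * v = 1"
        using k by (simp_all add: u_def v_def powr_add[symmetric])
      have "real n powr (1/2) = sqrt (real k + real (n - k))"
        using k by (simp add: powr_half_sqrt of_nat_diff)
      also have "\<dots> \<le> sqrt (real k) + sqrt (real (n - k))"
        by (rule sqrt_add_le_add_sqrt) auto
      also have "\<dots> = real k powr (1/2) + real (n - k) powr (1/2)" by (simp add: powr_half_sqrt)
      finally have "real n powr (1/2) * (u * v ^ 3) \<le> (real k powr (1/2) + real (n - k) powr (1/2)) * (u * v ^ 3)"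
        using uv by (intro mult_right_mono) auto
      also have "\<dots> = (real k powr (1/2) * u) * v ^ 3 + (real (n - k) powr (1/2) * v) * (v ^ 2 * u)"
        by (simp add: power3_eq_cube power2_eq_square algebra_simps)
      also have "\<dots> = v ^ 3 + v ^ 2 * u" by (simp only: inv mult_1)
      also have "\<dots> \<le> v ^ 3 + (v ^ 3 + u ^ 3)" using square_mult_le_sum_cubes[of v u] uv by simp
      also have "\<dots> \<le> 2 * (u ^ 3 + v ^ 3)" using uv by simp
      finally show ?thesis unfolding cubes u_def[symmetric] .
    qed
    then have "real n powr (1/2) * (\<Sum>k=1..<n. real k powr (-1/2) * real (n - k) powr (-3/2))
       \<le> (\<Sum>k=1..<n. 2 * (real k powr (-3/2) + real (n - k) powr (-3/2)))"
      unfolding sum_distrib_left by (intro sum_mono) auto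
    also have "\<dots> \<le> 2 * S" unfolding sum_distrib_left[symmetric] using S(2)[of n] by linarith
    finally have "real n powr (-1/2) * (real n powr (1/2) * (\<Sum>k=1..<n. real k powr (-1/2) * real (n - k) powr (-3/2)))
        \<le> real n powr (-1/2) * (2 * S)" by (intro mult_left_mono) auto
    moreover have "real n powr (-1/2) * real n powr (1/2) = 1" using n by (simp add: powr_add[symmetric])
    ultimately show ?thesis by (simp only: mult.assoc[symmetric]) (simp add: mult_ac)
  qed
  then show ?thesis using S(1) that[of "2 * S"] by simp
qed

text \<open>One of \<open>k\<close> and \<open>n - k\<close> is at least \<open>n / 2\<close>; the other factor is summable.\<close>
lemma convolution_three_halves:
  obtains K where "K > 0" "\<And>n. n \<ge> 1 \<Longrightarrow>
    (\<Sum>k=1..<n. real k powr (-3/2) * real (n - k) powr (-3/2)) \<le> K * real n powr (-3/2)"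
proof -
  obtain S where S: "S > 0" "\<And>n. (\<Sum>k=1..<n. real k powr (-3/2) + real (n - k) powr (-3/2)) \<le> S"
    by (rule sum_powr_three_halves_bounded) blast
  have "(\<Sum>k=1..<n. real k powr (-3/2) * real (n - k) powr (-3/2)) \<le> (2 powr (3/2) * S) * real n powr (-3/2)" if n: "n \<ge> 1" for n
  proof -
    have "real k powr (-3/2) * real (n - k) powr (-3/2)
        \<le> 2 powr (3/2) * real n powr (-3/2) * (real k powr (-3/2) + real (n - k) powr (-3/2))" if k: "k \<in> {1..<n}" for k
    proof -
      have half: "real m powr (-3/2) \<le> 2 powr (3/2) * real n powr (-3/2)" if "2 * m \<ge> n" for m
      proof -
        have "real m powr (-3/2) \<le> (real n / 2) powr (-3/2)"
          using that n by (intro powr_mono2') auto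
        also have "\<dots> = 2 powr (3/2) * real n powr (-3/2)"
          by (simp add: powr_divide powr_minus_divide)
        finally show ?thesis .
      qed
      have "2 * k \<ge> n \<or> 2 * (n - k) \<ge> n" using k by auto
      then show ?thesis
      proof
        assume "2 * k \<ge> n"
        from mult_right_mono[OF half[OF this], of "real (n - k) powr (-3/2)"]
        show ?thesis by (simp add: algebra_simps add_increasing)
      next
        assume "2 * (n - k) \<ge> n"
        from mult_left_mono[OF half[OF this], of "real k powr (-3/2)"]
        show ?thesis by (simp add: algebra_simps add_increasing2)
      qed
    qed
    then have "(\<Sum>k=1..<n. real k powr (-3/2) * real (n - k) powr (-3/2)) \<le>
       (\<Sum>k=1..<n. 2 powr (3/2) * real n powr (-3/2) * (real k powr (-3/2) + real (n - k) powr (-3/2)))"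
      by (intro sum_mono) auto
    also have "\<dots> \<le> 2 powr (3/2) * real n powr (-3/2) * S"
      unfolding sum_distrib_left[symmetric] using S by (intro mult_left_mono) auto
    finally show ?thesis by (simp add: mult_ac)
  qed
  then show ?thesis using S(1) that[of "2 powr (3/2) * S"] by simp
qed

text \<open>For \<open>x = k / n \<le> 1\<close> and an integer \<open>N \<ge> g\<close>, Bernoulli's inequality gives
  \<open>1 - x powr g \<le> 1 - x\<^sup>N \<le> N (1 - x)\<close>.\<close>
lemma powr_diff_le:
  assumes "g > (0::real)" "1 \<le> k" "k \<le> n"
  shows "real n powr g - real k powr g \<le> real (nat \<lceil>g\<rceil>) * real n powr (g - 1) * real (n - k)"
    and "0 \<le> real n powr g - real k powr g"
proof -
  define N where "N = nat \<lceil>g\<rceil>"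
  define x where "x = real k / real n"
  have x: "0 < x" "x \<le> 1" using assms by (auto simp: x_def)
  have "1 + real N * (x - 1) \<le> (1 + (x - 1)) ^ N"
    using x by (intro Bernoulli_inequality) auto
  also have "\<dots> = x powr real N" using x by (simp add: powr_realpow)
  also have "\<dots> \<le> x powr g" using x by (intro powr_mono') (auto simp: N_def, linarith)
  finally have "1 - x powr g \<le> real N * (1 - x)"
    by (simp add: algebra_simps)
  then have "real n powr g * (1 - x powr g) \<le> real n powr g * (real N * (1 - x))"
    by (intro mult_left_mono) auto
  also have "real n powr g * (1 - x powr g) = real n powr g - real k powr g"
    using assms by (simp add: x_def powr_divide right_diff_distrib)
  also have "real n powr g * (real N * (1 - x)) = real N * (real n powr g * (1 - x))"
    by (simp only: mult_ac)
  also have "real n powr g * (1 - x) = real n powr (g - 1) * real (n - k)"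
    using assms by (simp add: x_def powr_diff field_simps of_nat_diff)
  finally show "real n powr g - real k powr g \<le> real (nat \<lceil>g\<rceil>) * real n powr (g - 1) * real (n - k)"
    unfolding N_def[symmetric] by (simp only: mult.assoc)
  show "0 \<le> real n powr g - real k powr g"
    using assms by (simp add: powr_mono2)
qed

text \<open>These are \<open>\<Gamma>(a)\<close> times the coefficients of \<open>(1 - z)\<close> to the power \<open>- a\<close>.  They agree with \<open>k powr (a - 1)\<close>
  up to a relative error \<open>O(1/k)\<close>, but unlike powers they have exact convolutions, by Vandermonde's
  identity.\<close>
definition gamma_quot :: "real \<Rightarrow> nat \<Rightarrow> real" where
  "gamma_quot a k = Gamma (real k + a) / fact k"

lemma gamma_quot_bound:
  obtains K where "K > 0" "\<And>k. k \<ge> 1 \<Longrightarrow> \<bar>gamma_quot a k - real k powr (a - 1)\<bar> \<le> K * real k powr (a - 2)"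
proof -
  have "(\<lambda>k. (gamma_quot a k / real k powr (a - 1) - 1) * real k powr (a - 1)) \<in> O(\<lambda>k. 1 / real k * real k powr (a - 1))"
    unfolding gamma_quot_def by (intro landau_o.big.mult Gamma_ratio_asymptotics) auto
  also have "(\<lambda>k. 1 / real k * real k powr (a - 1)) \<in> O(\<lambda>k. real k powr (a - 2))" by real_asymp
  finally obtain K where "K > 0" "\<And>k. k \<ge> 1 \<Longrightarrow>
      \<bar>(gamma_quot a k / real k powr (a - 1) - 1) * real k powr (a - 1)\<bar> \<le> K * real k powr (a - 2)"
    by (rule bigo_explicit_bound) auto
  moreover have "(gamma_quot a k / real k powr (a - 1) - 1) * real k powr (a - 1) = gamma_quot a k - real k powr (a - 1)"
    if "k \<ge> 1" for k using that by (simp add: left_diff_distrib)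
  ultimately show ?thesis using that[of K] by simp
qed

lemma gamma_quot_pochhammer:
  assumes "a \<notin> \<int>\<^sub>\<le>\<^sub>0"
  shows "gamma_quot a k = Gamma a * pochhammer a k / fact k"
  using pochhammer_Gamma[OF assms, of k] assms
  by (simp add: gamma_quot_def Gamma_eq_zero_iff add.commute)

lemma gamma_quot_convolution:
  assumes "a \<notin> \<int>\<^sub>\<le>\<^sub>0" "b \<notin> \<int>\<^sub>\<le>\<^sub>0"
  shows "(\<Sum>k\<le>n. gamma_quot a k * gamma_quot b (n - k)) = Gamma a * Gamma b * pochhammer (a + b) n / fact n"
proof -
  have "(\<Sum>k\<le>n. gamma_quot a k * gamma_quot b (n - k))
     = (\<Sum>k\<le>n. Gamma a * Gamma b / fact n * (real (n choose k) * pochhammer a k * pochhammer b (n - k)))"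
    by (intro sum.cong refl) (simp add: gamma_quot_pochhammer assms binomial_fact)
  also have "\<dots> = Gamma a * Gamma b / fact n * pochhammer (a + b) n"
    by (simp only: sum_distrib_left[symmetric] pochhammer_binomial_sum)
  finally show ?thesis by simp
qed

lemma minus_half_notin_nonpos_Ints: "(-1/2 :: real) \<notin> \<int>\<^sub>\<le>\<^sub>0"
proof
  assume "(-1/2 :: real) \<in> \<int>\<^sub>\<le>\<^sub>0"
  then obtain n :: int where "-1/2 = real_of_int n" by (auto elim!: nonpos_Ints_cases)
  then have "real_of_int (2 * n) = real_of_int (-1)" by simp
  then have "2 * n = -1" by (simp only: of_int_eq_iff)
  then show False by presburger
qed

lemma Gamma_minus_half: "Gamma (- (1/2) :: real) = - 2 * sqrt pi"
proof -
  have "Gamma (-1/2 + 1 :: real) = -1/2 * Gamma (-1/2)"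
    by (rule Gamma_plus1[OF minus_half_notin_nonpos_Ints])
  then show ?thesis by (simp add: Gamma_one_half_real)
qed

lemma four_term_triangle:
  fixes p q r s x y :: real
  assumes "x \<ge> 0" "y \<ge> 0"
  shows "\<bar>(p - q) * x - (r * y - s)\<bar> \<le> (\<bar>p\<bar> + \<bar>q\<bar>) * x + (\<bar>r\<bar> * y + \<bar>s\<bar>)"
proof -
  have "\<bar>(p - q) * x\<bar> \<le> (\<bar>p\<bar> + \<bar>q\<bar>) * x"
    using assms by (simp add: abs_mult mult_right_mono abs_triangle_ineq4)
  moreover have "\<bar>r * y\<bar> = \<bar>r\<bar> * y" using assms by (simp add: abs_mult)
  ultimately show ?thesis by linarith
qed

text \<open>The sum is a discrete form of the integral of
  \<open>x powr (-1/2) (1 - x) powr (-3/2) (1 - x powr g)\<close> over \<open>(0, 1)\<close>.  It is evaluated by replacing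
  \<open>A\<^sub>k n\<^sup>g\<close>, \<open>A\<^sub>k k\<^sup>g\<close> and \<open>B\<^sub>m\<close> by Gamma quotients with parameters \<open>1/2\<close>, \<open>g + 1/2\<close> and \<open>-1/2\<close>.  In the
  exact convolution of these the first contribution vanishes because the parameters add up to zero,
  and the second one is a multiple of the Gamma quotient with parameter \<open>g\<close>.  In the replacement error, an error in
  \<open>B\<close> is of order \<open>m powr (-5/2)\<close> and meets the difference \<open>n\<^sup>g - k\<^sup>g\<close>, which is at most a multiple of \<open>n\<^sup>g\<^sup>-\<^sup>1 m\<close>;
  an error in \<open>A\<close> is of order \<open>k powr (-3/2)\<close> and can be bounded without using this cancellation.\<close>
lemma difference_convolution_asymptotics:
  fixes A B :: "nat \<Rightarrow> real"
  assumes A: "\<And>k. k \<ge> 1 \<Longrightarrow> \<bar>A k - real k powr (-1/2)\<bar> \<le> KA * real k powr (-3/2)"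
    and B: "\<And>k. k \<ge> 1 \<Longrightarrow> \<bar>B k - real k powr (-3/2)\<bar> \<le> KB * real k powr (-5/2)"
    and g: "g > 0"
  shows "(\<lambda>n. (\<Sum>k=1..<n. A k * B (n - k) * (real n powr g - real k powr g))
            - 2 * sqrt pi * Gamma (g + 1/2) / Gamma g * real n powr (g - 1)) \<in> O(\<lambda>n. real n powr (g - 3/2))"
proof -
  let ?h = "-1/2 :: real" and ?a = "g + 1/2"
  define Y where "Y n k = gamma_quot (1/2) k * real n powr g - gamma_quot ?a k" for n k
  define c where "c = 2 * sqrt pi * Gamma ?a / Gamma g"
  have KA: "KA \<ge> 0" and KB: "KB \<ge> 0" using A[of 1] B[of 1] by auto
  obtain K1 where K1: "K1 > 0" "\<And>k. k \<ge> 1 \<Longrightarrow> \<bar>gamma_quot (1/2) k - real k powr ?h\<bar> \<le> K1 * real k powr (-3/2)"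
    by (rule gamma_quot_bound[of "1/2"]) auto
  obtain K2 where K2: "K2 > 0" "\<And>k. k \<ge> 1 \<Longrightarrow> \<bar>gamma_quot ?a k - real k powr (g - 1/2)\<bar> \<le> K2 * real k powr (g - 3/2)"
    by (rule gamma_quot_bound[of ?a]) auto
  obtain K3 where K3: "K3 > 0" "\<And>k. k \<ge> 1 \<Longrightarrow> \<bar>gamma_quot ?h k - real k powr (-3/2)\<bar> \<le> K3 * real k powr (-5/2)"
    by (rule gamma_quot_bound[of ?h]) auto
  obtain K4 where K4: "K4 > 0" "\<And>k. k \<ge> 1 \<Longrightarrow> \<bar>gamma_quot g k - real k powr (g - 1)\<bar> \<le> K4 * real k powr (g - 2)"
    by (rule gamma_quot_bound[of g]) auto
  obtain S1 where S1: "S1 > 0" "\<And>n. n \<ge> 1 \<Longrightarrow>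
    (\<Sum>k=1..<n. real k powr (-1/2) * real (n - k) powr (-3/2)) \<le> S1 * real n powr (-1/2)"
    by (rule convolution_half_three_halves) blast
  obtain S2 where S2: "S2 > 0" "\<And>n. n \<ge> 1 \<Longrightarrow>
    (\<Sum>k=1..<n. real k powr (-3/2) * real (n - k) powr (-3/2)) \<le> S2 * real n powr (-3/2)"
    by (rule convolution_three_halves) blast
  have pw: "real k powr (-3/2) * real k powr g = real k powr (g - 3/2)"
    "real k powr (-1/2) * real k powr g = real k powr (g - 1/2)"
    "real k powr (-5/2) * real k = real k powr (-3/2)"
    "real k powr (-5/2) \<le> real k powr (-3/2)"
    "real k powr (-3/2) \<le> real k powr (-1/2)"
    if "k \<ge> 1" for k
  proof -
    have "real k powr (-5/2) * real k powr 1 = real k powr (-3/2)"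
      unfolding powr_add[symmetric] by simp
    then show "real k powr (-5/2) * real k = real k powr (-3/2)" using that by simp
  qed (use that in \<open>simp_all add: powr_add[symmetric] powr_mono\<close>)
  have main: "(\<lambda>n. (\<Sum>k=1..<n. Y n k * gamma_quot ?h (n - k)) - c * real n powr (g - 1)) \<in> O(\<lambda>n. real n powr (g - 3/2))"
  proof -
    have nin: "1/2 \<notin> (\<int>\<^sub>\<le>\<^sub>0 :: real set)" "?a \<notin> \<int>\<^sub>\<le>\<^sub>0" "g \<notin> \<int>\<^sub>\<le>\<^sub>0"
      using g by (auto elim!: nonpos_Ints_cases)
    have Gg: "Gamma g > 0" using g by simp
    have eq: "(\<Sum>k=1..<n. Y n k * gamma_quot ?h (n - k)) = c * gamma_quot g n - Y n 0 * gamma_quot ?h n - Y n n * gamma_quot ?h 0"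
      if n: "n \<ge> 1" for n
    proof -
      have "(\<Sum>k\<le>n. Y n k * gamma_quot ?h (n - k)) = real n powr g * (\<Sum>k\<le>n. gamma_quot (1/2) k * gamma_quot ?h (n - k))
          - (\<Sum>k\<le>n. gamma_quot ?a k * gamma_quot ?h (n - k))"
        unfolding sum_distrib_left sum_subtractf[symmetric]
        by (intro sum.cong refl) (simp add: Y_def algebra_simps)
      also have "(\<Sum>k\<le>n. gamma_quot (1/2) k * gamma_quot ?h (n - k)) = 0"
        using n by (subst gamma_quot_convolution[OF nin(1) minus_half_notin_nonpos_Ints]) (simp add: pochhammer_0_left)
      also have "(\<Sum>k\<le>n. gamma_quot ?a k * gamma_quot ?h (n - k)) = Gamma ?a * Gamma ?h * pochhammer g n / fact n"
        by (subst gamma_quot_convolution[OF nin(2) minus_half_notin_nonpos_Ints]) simp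
      also have "\<dots> = - c * gamma_quot g n"
        using Gg by (simp add: Gamma_minus_half gamma_quot_pochhammer[OF nin(3)] c_def)
      finally have "(\<Sum>k\<le>n. Y n k * gamma_quot ?h (n - k)) = c * gamma_quot g n" by simp
      moreover have "{..n} = insert 0 (insert n {1..<n})" using n by auto
      ultimately show ?thesis using n by simp
    qed
    have "(\<lambda>n. c * (gamma_quot g n - real n powr (g - 1)) - Y n 0 * gamma_quot ?h n - Y n n * gamma_quot ?h 0) \<in> O(\<lambda>n. real n powr (g - 3/2))"
    proof (intro sum_in_bigo)
      have "(\<lambda>n. gamma_quot g n - real n powr (g - 1)) \<in> O(\<lambda>n. real n powr (g - 2))"
        using K4(2) by (rule bigoI_nat) auto
      also have "(\<lambda>n. real n powr (g - 2)) \<in> O(\<lambda>n. real n powr (g - 3/2))" by real_asymp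
      finally show "(\<lambda>n. c * (gamma_quot g n - real n powr (g - 1))) \<in> O(\<lambda>n. real n powr (g - 3/2))"
        by (cases "c = 0") simp_all
      have "(\<lambda>n. Y n n) \<in> O(\<lambda>n. real n powr (g - 3/2))"
      proof (rule bigoI_nat)
        fix n :: nat assume n: "n \<ge> 1"
        have "Y n n = (gamma_quot (1/2) n - real n powr ?h) * real n powr g - (gamma_quot ?a n - real n powr (g - 1/2))"
          using pw(2)[OF n] by (simp add: Y_def algebra_simps)
        also have "\<bar>\<dots>\<bar> \<le> \<bar>gamma_quot (1/2) n - real n powr ?h\<bar> * real n powr g + \<bar>gamma_quot ?a n - real n powr (g - 1/2)\<bar>"
          by (rule order.trans[OF abs_triangle_ineq4]) (simp add: abs_mult)
        also have "\<dots> \<le> K1 * real n powr (-3/2) * real n powr g + K2 * real n powr (g - 3/2)"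
          using K1(2)[OF n] K2(2)[OF n] by (intro add_mono mult_right_mono) auto
        also have "\<dots> = (K1 + K2) * real n powr (g - 3/2)"
          using pw(1)[OF n] by (simp add: algebra_simps)
        finally show "\<bar>Y n n\<bar> \<le> (K1 + K2) * real n powr (g - 3/2)" .
      qed auto
      then show "(\<lambda>n. Y n n * gamma_quot ?h 0) \<in> O(\<lambda>n. real n powr (g - 3/2))"
        by (cases "gamma_quot ?h 0 = 0") simp_all
      have "(\<lambda>n. gamma_quot ?h n) \<in> O(\<lambda>n. real n powr (-3/2))"
      proof (rule bigoI_nat)
        fix n :: nat assume n: "n \<ge> 1"
        have "\<bar>gamma_quot ?h n\<bar> \<le> \<bar>gamma_quot ?h n - real n powr (-3/2)\<bar> + real n powr (-3/2)"
          using powr_ge_zero[of "real n" "-3/2"] by linarith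
        also have "\<dots> \<le> K3 * real n powr (-3/2) + real n powr (-3/2)"
          using K3(2)[OF n] mult_left_mono[OF pw(4)[OF n], of K3] K3(1) by linarith
        finally show "\<bar>gamma_quot ?h n\<bar> \<le> (K3 + 1) * real n powr (-3/2)" by (simp add: algebra_simps)
      qed auto
      moreover have "(\<lambda>n. Y n 0) \<in> O(\<lambda>n. real n powr g)"
      proof (rule bigoI_nat)
        fix n :: nat assume n: "n \<ge> 1"
        have "\<bar>gamma_quot ?a 0\<bar> * 1 \<le> \<bar>gamma_quot ?a 0\<bar> * real n powr g"
          using n g by (intro mult_left_mono ge_one_powr_ge_zero) auto
        then show "\<bar>Y n 0\<bar> \<le> (\<bar>gamma_quot (1/2) 0\<bar> + \<bar>gamma_quot ?a 0\<bar>) * real n powr g"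
          unfolding Y_def distrib_right
          by (intro order.trans[OF abs_triangle_ineq4] add_mono) (auto simp: abs_mult)
      qed auto
      ultimately have "(\<lambda>n. Y n 0 * gamma_quot ?h n) \<in> O(\<lambda>n. real n powr g * real n powr (-3/2))"
        by (intro landau_o.big.mult)
      also have "(\<lambda>n. real n powr g * real n powr (-3/2)) = (\<lambda>n. real n powr (g - 3/2))"
        by (simp add: powr_add[symmetric])
      finally show "(\<lambda>n. Y n 0 * gamma_quot ?h n) \<in> O(\<lambda>n. real n powr (g - 3/2))" .
    qed
    moreover have "\<forall>\<^sub>F n in sequentially. c * (gamma_quot g n - real n powr (g - 1)) - Y n 0 * gamma_quot ?h n - Y n n * gamma_quot ?h 0
      = (\<Sum>k=1..<n. Y n k * gamma_quot ?h (n - k)) - c * real n powr (g - 1)"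
      using eventually_ge_at_top[of 1] by eventually_elim (simp only: eq, simp add: right_diff_distrib)
    ultimately show ?thesis by (subst (asm) landau_o.big.in_cong)
  qed
  define N where "N = real (nat \<lceil>g\<rceil>)"
  define L where "L = (1 + KA) * N * (KB + K3) * S1 + (KA + K1 + KA + K2) * (K3 + 1) * S2"
  let ?V = "\<lambda>n. \<Sum>k=1..<n. A k * B (n - k) * (real n powr g - real k powr g)"
  let ?W = "\<lambda>n. \<Sum>k=1..<n. Y n k * gamma_quot ?h (n - k)"
  have "(\<lambda>n. ?V n - ?W n) \<in> O(\<lambda>n. real n powr (g - 3/2))"
  proof (rule bigoI_nat)
    fix n :: nat assume n: "n \<ge> 1"
    have term_bound: "\<bar>A k * B (n - k) * (real n powr g - real k powr g) - Y n k * gamma_quot ?h (n - k)\<bar>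
        \<le> (1 + KA) * N * (KB + K3) * real n powr (g - 1) * (real k powr (-1/2) * real (n - k) powr (-3/2))
         + (KA + K1 + KA + K2) * (K3 + 1) * real n powr g * (real k powr (-3/2) * real (n - k) powr (-3/2))"
      if k: "k \<in> {1..<n}" for k
    proof -
      define m where "m = n - k"
      have km: "k \<ge> 1" "m \<ge> 1" "k \<le> n" using k by (auto simp: m_def)
      define X where "X = A k * (real n powr g - real k powr g)"
      have diff: "0 \<le> real n powr g - real k powr g" "real n powr g - real k powr g \<le> N * real n powr (g - 1) * real m"
        using powr_diff_le[OF g km(1,3)] by (auto simp: N_def m_def)
      have "\<bar>A k\<bar> \<le> real k powr (-1/2) + KA * real k powr (-3/2)" using A[OF km(1)] powr_ge_zero[of "real k" "-1/2"] by linarith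
      also have "\<dots> \<le> (1 + KA) * real k powr (-1/2)"
        using mult_left_mono[OF pw(5)[OF km(1)] KA] by (simp add: algebra_simps)
      finally have Ak: "\<bar>A k\<bar> \<le> (1 + KA) * real k powr (-1/2)" .
      have X: "\<bar>X\<bar> \<le> ((1 + KA) * real k powr (-1/2)) * (N * real n powr (g - 1) * real m)"
        unfolding X_def abs_mult using Ak diff KA by (intro mult_mono) auto
      have BG: "\<bar>B m - gamma_quot ?h m\<bar> \<le> (KB + K3) * real m powr (-5/2)"
        unfolding distrib_right using B[OF km(2)] K3(2)[OF km(2)] by linarith
      have G: "\<bar>gamma_quot ?h m\<bar> \<le> (K3 + 1) * real m powr (-3/2)"
        unfolding distrib_right using K3(2)[OF km(2)] mult_left_mono[OF pw(4)[OF km(2)], of K3] K3(1) powr_ge_zero[of "real m" "-3/2"] by linarith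
      have XY: "\<bar>X - Y n k\<bar> \<le> (KA + K1 + KA + K2) * real k powr (-3/2) * real n powr g"
      proof -
        have "X - Y n k = ((A k - real k powr ?h) - (gamma_quot (1/2) k - real k powr ?h)) * real n powr g
           - ((A k - real k powr ?h) * real k powr g - (gamma_quot ?a k - real k powr (g - 1/2)))"
          using pw(2)[OF km(1)] by (simp add: X_def Y_def algebra_simps)
        also have "\<bar>\<dots>\<bar> \<le> (\<bar>A k - real k powr ?h\<bar> + \<bar>gamma_quot (1/2) k - real k powr ?h\<bar>) * real n powr g
           + (\<bar>A k - real k powr ?h\<bar> * real k powr g + \<bar>gamma_quot ?a k - real k powr (g - 1/2)\<bar>)"
          by (rule four_term_triangle) auto
        also have "\<dots> \<le> (KA * real k powr (-3/2) + K1 * real k powr (-3/2)) * real n powr g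
           + (KA * real k powr (-3/2) * real k powr g + K2 * real k powr (g - 3/2))"
          using A[OF km(1)] K1(2)[OF km(1)] K2(2)[OF km(1)] by (intro add_mono mult_right_mono) auto
        also have "\<dots> = (KA + K1) * real k powr (-3/2) * real n powr g + (KA + K2) * (real k powr (-3/2) * real k powr g)"
          using pw(1)[OF km(1)] by (simp add: algebra_simps)
        also have "\<dots> \<le> (KA + K1) * real k powr (-3/2) * real n powr g + (KA + K2) * (real k powr (-3/2) * real n powr g)"
          using km g KA K2(1) by (intro add_left_mono mult_left_mono powr_mono2) auto
        finally show ?thesis by (simp add: algebra_simps)
      qed
      have "A k * B m * (real n powr g - real k powr g) - Y n k * gamma_quot ?h m = X * (B m - gamma_quot ?h m) + (X - Y n k) * gamma_quot ?h m"
        by (simp add: X_def algebra_simps)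
      also have "\<bar>\<dots>\<bar> \<le> \<bar>X\<bar> * \<bar>B m - gamma_quot ?h m\<bar> + \<bar>X - Y n k\<bar> * \<bar>gamma_quot ?h m\<bar>"
        by (rule order.trans[OF abs_triangle_ineq]) (simp add: abs_mult)
      also have "\<dots> \<le> ((1 + KA) * real k powr (-1/2)) * (N * real n powr (g - 1) * real m) * ((KB + K3) * real m powr (-5/2))
          + (KA + K1 + KA + K2) * real k powr (-3/2) * real n powr g * ((K3 + 1) * real m powr (-3/2))"
        using X BG XY G KA KB K1(1) K2(1) by (intro add_mono mult_mono) (auto simp: N_def)
      also have "((1 + KA) * real k powr (-1/2)) * (N * real n powr (g - 1) * real m) * ((KB + K3) * real m powr (-5/2))
         = (1 + KA) * N * (KB + K3) * real n powr (g - 1) * (real k powr (-1/2) * (real m powr (-5/2) * real m))"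
        by (simp only: mult_ac)
      also have "real m powr (-5/2) * real m = real m powr (-3/2)" by (rule pw(3)[OF km(2)])
      finally show ?thesis unfolding m_def[symmetric] by (simp only: mult_ac)
    qed
    have "\<bar>?V n - ?W n\<bar>
        \<le> (\<Sum>k=1..<n. \<bar>A k * B (n - k) * (real n powr g - real k powr g) - Y n k * gamma_quot ?h (n - k)\<bar>)"
      unfolding sum_subtractf[symmetric] by (rule sum_abs)
    also have "\<dots> \<le> (\<Sum>k=1..<n. (1 + KA) * N * (KB + K3) * real n powr (g - 1) * (real k powr (-1/2) * real (n - k) powr (-3/2))
         + (KA + K1 + KA + K2) * (K3 + 1) * real n powr g * (real k powr (-3/2) * real (n - k) powr (-3/2)))"
      by (intro sum_mono term_bound)
    also have "\<dots> = (1 + KA) * N * (KB + K3) * real n powr (g - 1) * (\<Sum>k=1..<n. real k powr (-1/2) * real (n - k) powr (-3/2))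
         + (KA + K1 + KA + K2) * (K3 + 1) * real n powr g * (\<Sum>k=1..<n. real k powr (-3/2) * real (n - k) powr (-3/2))"
      by (simp only: sum.distrib sum_distrib_left)
    also have "\<dots> \<le> (1 + KA) * N * (KB + K3) * real n powr (g - 1) * (S1 * real n powr (-1/2))
         + (KA + K1 + KA + K2) * (K3 + 1) * real n powr g * (S2 * real n powr (-3/2))"
      using S1(2)[OF n] S2(2)[OF n] KA KB K1(1) K2(1) K3(1) by (intro add_mono mult_left_mono) (auto simp: N_def)
    also have "\<dots> = (1 + KA) * N * (KB + K3) * S1 * (real n powr (g - 1) * real n powr (-1/2))
         + (KA + K1 + KA + K2) * (K3 + 1) * S2 * (real n powr g * real n powr (-3/2))"
      by (simp only: mult_ac)
    also have "real n powr (g - 1) * real n powr (-1/2) = real n powr (g - 3/2)" by (simp add: powr_add[symmetric])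
    also have "real n powr g * real n powr (-3/2) = real n powr (g - 3/2)" by (simp add: powr_add[symmetric])
    finally show "\<bar>?V n - ?W n\<bar>
        \<le> L * real n powr (g - 3/2)"
      by (simp add: L_def algebra_simps)
  qed auto
  from sum_in_bigo(1)[OF this main] show ?thesis by (simp add: c_def)
qed

context linear_ratio_family
begin

section \<open>The size process and its defect operator\<close>

text \<open>The constant \<open>\<kappa>\<close> of the introduction in the form in which the convolution estimate produces it;
  \<open>loss_rate_eq\<close> expresses it by \<open>\<sigma>\<close>.\<close>
definition loss_rate :: "real \<Rightarrow> real" where
  "loss_rate g = a\<^sub>1 * weight_const * (2 * sqrt pi * Gamma (g + 1/2) / Gamma g)"

lemma loss_rate_eq: "loss_rate g = sqrt 2 / scaling_sigma \<Phi> * (Gamma (g + 1/2) / Gamma g)"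
proof -
  have a1: "a\<^sub>1 > 0" using a0_less by simp
  have "a\<^sub>1 * weight_const * (2 * sqrt pi) = sqrt (a\<^sub>1 ^ 2 * (\<alpha>\<^sub>0 / (2 * pi * a\<^sub>1 ^ 3)) * (4 * pi))"
    unfolding weight_const_def real_sqrt_mult using a1 by simp
  also have "a\<^sub>1 ^ 2 * (\<alpha>\<^sub>0 / (2 * pi * a\<^sub>1 ^ 3)) * (4 * pi) = 2 / (a\<^sub>1 / \<alpha>\<^sub>0)"
    using a1 alpha_pos by (simp add: divide_simps power2_eq_square power3_eq_cube)
  also have "sqrt \<dots> = sqrt 2 / scaling_sigma \<Phi>"
    unfolding scaling_sigma_eq real_sqrt_divide ..
  finally have *: "a\<^sub>1 * weight_const * (2 * sqrt pi) = sqrt 2 / scaling_sigma \<Phi>" .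
  have "loss_rate g = a\<^sub>1 * weight_const * (2 * sqrt pi) * (Gamma (g + 1/2) / Gamma g)"
    by (simp add: loss_rate_def mult.assoc)
  then show ?thesis unfolding * .
qed

lemma scaling_sigma_pos: "scaling_sigma \<Phi> > 0"
  using alpha_pos a0_less by (simp add: scaling_sigma_eq)

lemma loss_rate_pos: "g > 0 \<Longrightarrow> loss_rate g > 0"
  using scaling_sigma_pos by (simp add: loss_rate_eq)

text \<open>The toll sequence for which \<open>x\<close> is the expected total toll along the size process.\<close>
definition defect :: "(nat \<Rightarrow> real) \<Rightarrow> nat \<Rightarrow> real" where
  "defect x n = x n - (\<Sum>k=1..<n. split_prob n k * x k)"

lemma defect_1: "defect x 1 = x 1"
  by (simp add: defect_def)

lemma defect_eq:
  assumes "n \<ge> 2"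
  shows "defect x n = (\<Sum>k=1..<n. split_prob n k * (x n - x k))"
  using split_prob_sum[OF assms]
  by (simp add: defect_def right_diff_distrib sum_subtractf sum_distrib_right[symmetric])

lemma defect_diff: "defect (\<lambda>n. x n - c * y n) n = defect x n - c * defect y n"
  by (simp add: defect_def right_diff_distrib sum_subtractf sum_distrib_left mult_ac)

text \<open>The matrix of splitting probabilities is nonnegative and strictly lower triangular, so the defect
  operator has a nonnegative inverse.  Hence an unknown sequence is estimated by exhibiting one
  explicit sequence with a sufficiently large defect.\<close>
lemma defect_comparison:
  assumes "\<And>n. n \<ge> 1 \<Longrightarrow> \<bar>defect x n\<bar> \<le> K * defect y n" and "n \<ge> 1"
  shows "\<bar>x n\<bar> \<le> K * y n"
  using \<open>n \<ge> 1\<close>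
proof (induction n rule: less_induct)
  case (less n)
  have "\<bar>\<Sum>k=1..<n. split_prob n k * x k\<bar> \<le> (\<Sum>k=1..<n. \<bar>split_prob n k * x k\<bar>)" by (rule sum_abs)
  also have "\<dots> \<le> (\<Sum>k=1..<n. split_prob n k * (K * y k))"
    using less.IH by (intro sum_mono) (auto simp: abs_mult split_prob_nonneg intro!: mult_left_mono)
  also have "\<dots> = K * (\<Sum>k=1..<n. split_prob n k * y k)" by (simp add: sum_distrib_left mult_ac)
  finally have "\<bar>\<Sum>k=1..<n. split_prob n k * x k\<bar> \<le> K * (\<Sum>k=1..<n. split_prob n k * y k)" .
  moreover have "\<bar>defect x n\<bar> \<le> K * defect y n" using assms(1) less.prems by simp
  ultimately show ?case
    unfolding defect_def right_diff_distrib by linarith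
qed

lemma tilted_weight_bigo:
  "(\<lambda>n. tilted_weight n / weight_const - real n powr (-3/2)) \<in> O(\<lambda>n. real n powr (-5/2))"
proof -
  have "(\<lambda>n. (tilted_weight n * real n powr (3/2) / weight_const - 1) * real n powr (-3/2)) \<in> O(\<lambda>n. 1 / real n * real n powr (-3/2))"
    by (intro landau_o.big.mult tilted_weight_asymptotics) auto
  also have "(\<lambda>n. 1 / real n * real n powr (-3/2)) \<in> O(\<lambda>n. real n powr (-5/2))" by real_asymp
  finally have "(\<lambda>n. (tilted_weight n * real n powr (3/2) / weight_const - 1) * real n powr (-3/2)) \<in> O(\<lambda>n. real n powr (-5/2))" .
  moreover have "\<forall>\<^sub>F n in sequentially. (tilted_weight n * real n powr (3/2) / weight_const - 1) * real n powr (-3/2)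
      = tilted_weight n / weight_const - real n powr (-3/2)"
    using eventually_ge_at_top[of 1]
  proof eventually_elim
    case (elim n)
    have "real n powr (3/2) * real n powr (-3/2) = 1" using elim by (simp add: powr_add[symmetric])
    then show ?case by (simp add: left_diff_distrib)
  qed
  ultimately show ?thesis by (subst (asm) landau_o.big.in_cong)
qed

text \<open>Up to a constant, this is the factor of \<open>split_prob n k\<close> that depends on \<open>n\<close> alone.\<close>
lemma normaliser_bigo:
  "(\<lambda>n. weight_const / ((real n - 1) * tilted_weight n) - real n powr (1/2)) \<in> O(\<lambda>n. real n powr (-1/2))"
proof -
  let ?e = "\<lambda>n. weight_const / ((real n - 1) * tilted_weight n) - real n powr (1/2)"
  define u where "u n = tilted_weight n * real n powr (3/2) / weight_const" for n
  have u: "(\<lambda>n. u n - 1) \<in> O(\<lambda>n. 1 / real n)"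
    unfolding u_def by (rule tilted_weight_asymptotics)
  have "(\<lambda>n. 1 / real n) \<in> o(\<lambda>_. 1 :: real)" by real_asymp
  with u have "(\<lambda>n. u n - 1) \<in> o(\<lambda>_. 1)" by (rule landau_o.big_small_trans)
  then have "(\<lambda>n. u n - 1) \<longlonglongrightarrow> 0" by (drule_tac smalloD_tendsto) simp
  then have ev1: "\<forall>\<^sub>F n in sequentially. u n - 1 > -1/2"
    by (rule order_tendstoD) simp
  obtain K where K: "K > 0" and ev2: "\<forall>\<^sub>F n in sequentially. norm (u n - 1) \<le> K * norm (1 / real n)"
    using u by (rule landau_o.bigE)
  have "\<forall>\<^sub>F n in sequentially. norm (?e n)
      \<le> 4 * (1 + K) * norm (real n powr (-1/2))"
    using ev1 ev2 eventually_ge_at_top[of 2]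
  proof eventually_elim
    case (elim n)
    define v where "v = (real n - 1) * u n"
    have n: "real n \<ge> 2" using elim by simp
    have "(real n - 1) * (1/2) \<le> v"
      unfolding v_def using elim n by (intro mult_left_mono) auto
    then have v: "v \<ge> real n / 4" "v > 0" using n by auto
    have "weight_const / ((real n - 1) * tilted_weight n) = real n powr (3/2) / v"
      using weight_const_pos n by (simp add: v_def u_def)
    also have "\<dots> = real n powr (1/2) * (real n / v)"
    proof -
      have "real n powr (3/2) = real n powr (1/2 + 1)" by simp
      also have "\<dots> = real n powr (1/2) * real n" using n by (simp only: powr_add) simp
      finally show ?thesis by simp
    qed
    finally have "?e n = real n powr (1/2) * ((real n - v) / v)"
      using v by (simp add: right_diff_distrib diff_divide_distrib)
    moreover have "\<bar>real n - v\<bar> \<le> 1 + K"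
    proof -
      have "real n - v = 1 - (real n - 1) * (u n - 1)" by (simp add: v_def algebra_simps)
      also have "\<bar>\<dots>\<bar> \<le> 1 + (real n - 1) * \<bar>u n - 1\<bar>"
        using n by (intro order.trans[OF abs_triangle_ineq4]) (simp add: abs_mult)
      also have "(real n - 1) * \<bar>u n - 1\<bar> \<le> real n * (K * (1 / real n))"
        using elim n by (intro mult_mono) auto
      finally show ?thesis using n by simp
    qed
    then have "\<bar>(real n - v) / v\<bar> \<le> (1 + K) / (real n / 4)"
      unfolding abs_divide using v n K by (intro frac_le) auto
    ultimately have "\<bar>?e n\<bar> \<le> real n powr (1/2) * ((1 + K) / (real n / 4))"
      by (simp only: abs_mult) (intro mult_mono, auto)
    also have "\<dots> = 4 * (1 + K) * (real n powr (1/2) / real n)" using n by (simp add: field_simps)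
    also have "real n powr (1/2) / real n = real n powr (1/2 - 1)" using n by (simp only: powr_diff) simp
    also have "\<dots> = real n powr (-1/2)" by simp
    finally show ?case by simp
  qed
  then show ?thesis by (rule bigoI)
qed

text \<open>The splitting probabilities factor as \<open>E\<^sub>n A\<^sub>k B\<^sub>n\<^sub>-\<^sub>k\<close> up to a constant, where \<open>A\<^sub>k\<close>, \<open>B\<^sub>m\<close> and \<open>E\<^sub>n\<close> are
  \<open>k powr (-1/2)\<close>, \<open>m powr (-3/2)\<close> and \<open>n powr (1/2)\<close> with relative errors \<open>O(1/k)\<close>, \<open>O(1/m)\<close> and \<open>O(1/n)\<close>.
  As each row of probabilities sums to one, the defect is the convolution with \<open>n\<^sup>g - k\<^sup>g\<close> estimated
  above.\<close>
theorem defect_powr_asymptotics: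
  assumes g: "g > 0"
  shows "(\<lambda>n. defect (\<lambda>n. real n powr g) n - loss_rate g * real n powr (g - 1/2)) \<in> O(\<lambda>n. real n powr (g - 1))"
proof -
  define B where "B m = tilted_weight m / weight_const" for m
  define A where "A k = (real k + a\<^sub>0 / a\<^sub>1) * B k" for k
  define e where "e n = weight_const / ((real n - 1) * tilted_weight n) - real n powr (1/2)" for n
  define S where "S n = (\<Sum>k=1..<n. A k * B (n - k) * (real n powr g - real k powr g))" for n
  define c where "c = 2 * sqrt pi * Gamma (g + 1/2) / Gamma g"
  have a1: "a\<^sub>1 > 0" using a0_less by simp
  note wc = weight_const_pos
  have B: "(\<lambda>m. B m - real m powr (-3/2)) \<in> O(\<lambda>m. real m powr (-5/2))"
    unfolding B_def by (rule tilted_weight_bigo)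
  have "(\<lambda>m. real m * (B m - real m powr (-3/2)) + a\<^sub>0 / a\<^sub>1 * (B m - real m powr (-3/2)) + a\<^sub>0 / a\<^sub>1 * real m powr (-3/2)) \<in> O(\<lambda>m. real m powr (-3/2))"
  proof (intro sum_in_bigo)
    have "(\<lambda>m. real m * (B m - real m powr (-3/2))) \<in> O(\<lambda>m. real m * real m powr (-5/2))"
      by (intro landau_o.big.mult B) auto
    also have "(\<lambda>m. real m * real m powr (-5/2)) \<in> O(\<lambda>m. real m powr (-3/2))" by real_asymp
    finally show "(\<lambda>m. real m * (B m - real m powr (-3/2))) \<in> O(\<lambda>m. real m powr (-3/2))" .
    have "(\<lambda>m. real m powr (-5/2)) \<in> O(\<lambda>m. real m powr (-3/2))" by real_asymp
    with B have "(\<lambda>m. B m - real m powr (-3/2)) \<in> O(\<lambda>m. real m powr (-3/2))" by (rule landau_o.big_trans)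
    then show "(\<lambda>m. a\<^sub>0 / a\<^sub>1 * (B m - real m powr (-3/2))) \<in> O(\<lambda>m. real m powr (-3/2))"
      by (cases "a\<^sub>0 / a\<^sub>1 = 0") (simp_all only: landau_o.big.cmult_in_iff mult_zero_left, simp_all)
    show "(\<lambda>m. a\<^sub>0 / a\<^sub>1 * real m powr (-3/2)) \<in> O(\<lambda>m. real m powr (-3/2))"
      by (cases "a\<^sub>0 / a\<^sub>1 = 0") (simp_all only: landau_o.big.cmult_in_iff mult_zero_left, simp_all)
  qed
  moreover have "\<forall>\<^sub>F m in sequentially. real m * (B m - real m powr (-3/2)) + a\<^sub>0 / a\<^sub>1 * (B m - real m powr (-3/2)) + a\<^sub>0 / a\<^sub>1 * real m powr (-3/2)
      = A m - real m powr (-1/2)"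
    using eventually_ge_at_top[of 1]
  proof eventually_elim
    case (elim m)
    have "real m powr (-1/2) = real m powr (1 + -3/2)" by simp
    also have "\<dots> = real m * real m powr (-3/2)" using elim by (simp only: powr_add) simp
    finally show ?case by (simp add: A_def algebra_simps)
  qed
  ultimately have A: "(\<lambda>m. A m - real m powr (-1/2)) \<in> O(\<lambda>m. real m powr (-3/2))"
    by (subst (asm) landau_o.big.in_cong)
  obtain KA where KA: "\<And>k. k \<ge> 1 \<Longrightarrow> \<bar>A k - real k powr (-1/2)\<bar> \<le> KA * real k powr (-3/2)"
    using bigo_explicit_bound[OF A] by auto
  obtain KB where KB: "\<And>k. k \<ge> 1 \<Longrightarrow> \<bar>B k - real k powr (-3/2)\<bar> \<le> KB * real k powr (-5/2)"
    using bigo_explicit_bound[OF B] by auto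
  have S: "(\<lambda>n. S n - c * real n powr (g - 1)) \<in> O(\<lambda>n. real n powr (g - 3/2))"
    unfolding S_def c_def by (rule difference_convolution_asymptotics[OF KA KB g])
  have e: "e \<in> O(\<lambda>n. real n powr (-1/2))"
    unfolding e_def by (rule normaliser_bigo)
  have "(\<lambda>n. real n powr (g - 3/2)) \<in> O(\<lambda>n. real n powr (g - 1))" by real_asymp
  with S have "(\<lambda>n. S n - c * real n powr (g - 1)) \<in> O(\<lambda>n. real n powr (g - 1))" by (rule landau_o.big_trans)
  then have "(\<lambda>n. (S n - c * real n powr (g - 1)) + c * real n powr (g - 1)) \<in> O(\<lambda>n. real n powr (g - 1))"
    by (rule sum_in_bigo) (cases "c = 0", simp_all)
  then have S': "S \<in> O(\<lambda>n. real n powr (g - 1))" by simp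
  have "(\<lambda>n. real n powr (1/2) * (S n - c * real n powr (g - 1)) + e n * S n) \<in> O(\<lambda>n. real n powr (g - 1))"
  proof (intro sum_in_bigo)
    have "(\<lambda>n. real n powr (1/2) * (S n - c * real n powr (g - 1))) \<in> O(\<lambda>n. real n powr (1/2) * real n powr (g - 3/2))"
      by (intro landau_o.big.mult S) auto
    then show "(\<lambda>n. real n powr (1/2) * (S n - c * real n powr (g - 1))) \<in> O(\<lambda>n. real n powr (g - 1))"
      by (simp add: powr_add[symmetric])
    have "(\<lambda>n. e n * S n) \<in> O(\<lambda>n. real n powr (-1/2) * real n powr (g - 1))"
      by (intro landau_o.big.mult S' e)
    also have "(\<lambda>n. real n powr (-1/2) * real n powr (g - 1)) \<in> O(\<lambda>n. real n powr (g - 1))" by real_asymp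
    finally show "(\<lambda>n. e n * S n) \<in> O(\<lambda>n. real n powr (g - 1))" .
  qed
  then have "(\<lambda>n. (a\<^sub>1 * weight_const) * (real n powr (1/2) * (S n - c * real n powr (g - 1)) + e n * S n)) \<in> O(\<lambda>n. real n powr (g - 1))"
    using a1 wc by (subst landau_o.big.cmult_in_iff) auto
  moreover have "\<forall>\<^sub>F n in sequentially. (a\<^sub>1 * weight_const) * (real n powr (1/2) * (S n - c * real n powr (g - 1)) + e n * S n)
     = defect (\<lambda>n. real n powr g) n - loss_rate g * real n powr (g - 1/2)"
    using eventually_ge_at_top[of 2]
  proof eventually_elim
    case (elim n)
    have "defect (\<lambda>n. real n powr g) n = (\<Sum>k=1..<n. a\<^sub>1 * weight_const * (real n powr (1/2) + e n) * (A k * B (n - k) * (real n powr g - real k powr g)))"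
      unfolding defect_eq[OF elim]
    proof (intro sum.cong refl)
      fix k assume "k \<in> {1..<n}"
      then have k: "1 \<le> k" "k < n" by auto
      have "a\<^sub>1 * A k = (a\<^sub>1 * real k + a\<^sub>0) * B k"
      proof -
        have "a\<^sub>1 * (real k + a\<^sub>0 / a\<^sub>1) = a\<^sub>1 * real k + a\<^sub>0"
          unfolding distrib_left using a1 by simp
        then show ?thesis unfolding A_def mult.assoc[symmetric] by simp
      qed
      moreover have "a\<^sub>1 * weight_const * (real n powr (1/2) + e n) * (A k * B (n - k))
          = weight_const * (real n powr (1/2) + e n) * (a\<^sub>1 * A k) * B (n - k)"
        by (simp only: mult_ac)
      ultimately have "a\<^sub>1 * weight_const * (real n powr (1/2) + e n) * (A k * B (n - k))
          = weight_const * (real n powr (1/2) + e n) * ((a\<^sub>1 * real k + a\<^sub>0) * B k) * B (n - k)"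
        by (simp only:)
      also have "\<dots> = split_prob n k"
        unfolding split_prob_tilted[OF k] using wc by (simp add: e_def B_def)
      finally show "split_prob n k * (real n powr g - real k powr g) =
          a\<^sub>1 * weight_const * (real n powr (1/2) + e n) * (A k * B (n - k) * (real n powr g - real k powr g))"
        by (simp only: mult.assoc[symmetric])
    qed
    also have "\<dots> = a\<^sub>1 * weight_const * (real n powr (1/2) + e n) * S n"
      unfolding S_def by (simp only: sum_distrib_left)
    finally have d: "defect (\<lambda>n. real n powr g) n = a\<^sub>1 * weight_const * (real n powr (1/2) + e n) * S n" .
    have "real n powr (g - 1/2) = real n powr (1/2) * real n powr (g - 1)" by (simp add: powr_add[symmetric])
    then show ?case unfolding d loss_rate_def c_def[symmetric] by (simp add: algebra_simps)
  qed
  ultimately show ?thesis by (subst (asm) landau_o.big.in_cong)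
qed

lemma defect_powr_pos:
  assumes g: "g > 0" and n: "n \<ge> 1"
  shows "defect (\<lambda>n. real n powr g) n > 0"
proof (cases "n = 1")
  case True
  then show ?thesis by (simp add: defect_1[unfolded One_nat_def])
next
  case False
  with n have n2: "n \<ge> 2" by simp
  define d where "d = real n powr g - real (n - 1) powr g"
  have "d > 0" using g n2 by (simp add: d_def powr_less_mono2)
  moreover have "(\<Sum>k=1..<n. split_prob n k * d) \<le> (\<Sum>k=1..<n. split_prob n k * (real n powr g - real k powr g))"
  proof (intro sum_mono mult_left_mono)
    fix k assume k: "k \<in> {1..<n}"
    show "d \<le> real n powr g - real k powr g"
      unfolding d_def using k g by (intro diff_left_mono powr_mono2) auto
    show "split_prob n k \<ge> 0" using k by (intro split_prob_nonneg) auto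
  qed
  ultimately show ?thesis
    unfolding defect_eq[OF n2] sum_distrib_right[symmetric] split_prob_sum[OF n2] by simp
qed

lemma defect_powr_lower_bound:
  assumes g: "g > 0"
  obtains K where "K > 0" "\<And>n. n \<ge> 1 \<Longrightarrow> real n powr (g - 1/2) \<le> K * defect (\<lambda>n. real n powr g) n"
proof -
  have "(\<lambda>n. defect (\<lambda>n. real n powr g) n - loss_rate g * real n powr (g - 1/2)) \<in> o(\<lambda>n. real n powr (g - 1/2))"
    using defect_powr_asymptotics[OF g] by (rule landau_o.big_small_trans) real_asymp
  then have "\<forall>\<^sub>F n in sequentially. norm (defect (\<lambda>n. real n powr g) n - loss_rate g * real n powr (g - 1/2))
     \<le> (loss_rate g / 2) * norm (real n powr (g - 1/2))"
    by (rule landau_o.smallD) (use loss_rate_pos[OF g] in simp)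
  then have "\<forall>\<^sub>F n in sequentially. norm (real n powr (g - 1/2)) \<le> 2 / loss_rate g * norm (defect (\<lambda>n. real n powr g) n)"
  proof eventually_elim
    case (elim n)
    then have "\<bar>defect (\<lambda>n. real n powr g) n - loss_rate g * real n powr (g - 1/2)\<bar> \<le> (loss_rate g / 2) * real n powr (g - 1/2)"
      by simp
    then have "loss_rate g / 2 * real n powr (g - 1/2) \<le> \<bar>defect (\<lambda>n. real n powr g) n\<bar>"
      unfolding times_divide_eq_left by linarith
    then show ?case using loss_rate_pos[OF g] by (simp add: field_simps)
  qed
  then have "(\<lambda>n. real n powr (g - 1/2)) \<in> O(defect (\<lambda>n. real n powr g))" by (rule bigoI)
  then obtain K where "K > 0" "\<And>n. n \<ge> 1 \<Longrightarrow> \<bar>real n powr (g - 1/2)\<bar> \<le> K * defect (\<lambda>n. real n powr g) n"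
    by (rule bigo_explicit_bound) (use defect_powr_pos[OF g] in auto)
  then show ?thesis using that[of K] by simp
qed

text \<open>The case of a logarithmic \<open>L\<close> bounds errors that already carry a logarithm.\<close>
lemma defect_powr_mult_lower_bound:
  assumes g: "g > 0" and L: "\<And>k n. 1 \<le> k \<Longrightarrow> k \<le> n \<Longrightarrow> L k \<le> L n" "\<And>n. n \<ge> 1 \<Longrightarrow> L n \<ge> 0"
  obtains K where "K > 0" "\<And>n. n \<ge> 1 \<Longrightarrow> real n powr (g - 1/2) * L n \<le> K * defect (\<lambda>n. real n powr g * L n) n"
proof -
  obtain K where K: "K > 0" "\<And>n. n \<ge> 1 \<Longrightarrow> real n powr (g - 1/2) \<le> K * defect (\<lambda>n. real n powr g) n"
    using defect_powr_lower_bound[OF g] by blast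
  have "real n powr (g - 1/2) * L n \<le> K * defect (\<lambda>n. real n powr g * L n) n" if n: "n \<ge> 1" for n
  proof -
    have "real n powr (g - 1/2) * L n \<le> K * defect (\<lambda>n. real n powr g) n * L n"
      using K(2)[OF n] L(2)[OF n] by (rule mult_right_mono)
    also have "\<dots> = K * (defect (\<lambda>n. real n powr g) n * L n)" by simp
    also have "defect (\<lambda>n. real n powr g) n * L n \<le> defect (\<lambda>n. real n powr g * L n) n"
    proof -
      have "(\<Sum>k=1..<n. split_prob n k * (real k powr g * L k)) \<le> (\<Sum>k=1..<n. split_prob n k * (real k powr g * L n))"
        using L by (intro sum_mono mult_left_mono split_prob_nonneg) auto
      then show ?thesis
        by (simp add: defect_def left_diff_distrib sum_distrib_right mult.assoc)
    qed
    finally show ?thesis using K(1) by simp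
  qed
  with K(1) show ?thesis by (rule that)
qed

text \<open>This replaces the powers at exponent zero, where the loss rate vanishes.  Since
  \<open>ln (n / k) \<ge> (n - k) / n\<close>, the bound follows from the one for the first power.\<close>
lemma defect_ln_lower_bound:
  obtains K where "K > 0" "\<And>n. n \<ge> 1 \<Longrightarrow> real n powr (-1/2) \<le> K * defect (\<lambda>n. 1 + ln (real n)) n"
proof -
  obtain K where K: "K > 0" "\<And>n. n \<ge> 1 \<Longrightarrow> real n powr (1 - 1/2) \<le> K * defect (\<lambda>n. real n powr 1) n"
    using defect_powr_lower_bound[of 1] by auto
  have "real n powr (-1/2) \<le> K * defect (\<lambda>n. 1 + ln (real n)) n" if n: "n \<ge> 1" for n
  proof (cases "n = 1")
    case True
    then show ?thesis using K(2)[of 1] by (simp add: defect_1[unfolded One_nat_def])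
  next
    case False
    with n have n2: "n \<ge> 2" by simp
    have "real n powr (-1/2) = real n powr (1 - 1/2 - 1)" by simp
    also have "\<dots> = real n powr (1 - 1/2) / real n" using n by (simp only: powr_diff[of _ _ 1]) simp
    also have "\<dots> \<le> K * defect (\<lambda>n. real n powr 1) n / real n"
      using K(2)[OF n] by (rule divide_right_mono) simp
    also have "\<dots> = K * (defect (\<lambda>n. real n powr 1) n / real n)" by simp
    also have "defect (\<lambda>n. real n powr 1) n / real n \<le> defect (\<lambda>n. 1 + ln (real n)) n"
      unfolding defect_eq[OF n2] sum_divide_distrib
    proof (intro sum_mono)
      fix k assume k: "k \<in> {1..<n}"
      have "ln (real k / real n) \<le> real k / real n - 1"
        using k by (intro ln_le_minus_one) auto
      then have "(real n powr 1 - real k powr 1) / real n \<le> (1 + ln (real n)) - (1 + ln (real k))"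
        using k by (simp add: ln_div diff_divide_distrib)
      moreover have "split_prob n k \<ge> 0" using k by (intro split_prob_nonneg) auto
      ultimately show "split_prob n k * (real n powr 1 - real k powr 1) / real n
          \<le> split_prob n k * (1 + ln (real n) - (1 + ln (real k)))"
        by (simp only: times_divide_eq_right[symmetric]) (rule mult_left_mono)
    qed
    finally show ?thesis using K(1) by simp
  qed
  with K(1) show ?thesis by (rule that)
qed

end

section \<open>Moments of the destruction cost\<close>

definition moment_coeff :: "real \<Rightarrow> real \<Rightarrow> nat \<Rightarrow> real" where
  "moment_coeff \<sigma> b s = fact s * \<sigma> ^ s / 2 powr (real s / 2) *
     (\<Prod>j=1..s. Gamma (real j * b) / Gamma (real j * b + 1/2))"

definition log_factor :: "real \<Rightarrow> nat \<Rightarrow> real" where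
  "log_factor \<alpha> n = (if \<alpha> = 0 then 1 + ln (real n) else 1)"

lemma log_factor_ge_1: "n \<ge> 1 \<Longrightarrow> log_factor \<alpha> n \<ge> 1"
  by (simp add: log_factor_def)

lemma log_factor_mono: "1 \<le> k \<Longrightarrow> k \<le> n \<Longrightarrow> log_factor \<alpha> k \<le> log_factor \<alpha> n"
  by (simp add: log_factor_def)

lemma log_factor_le: "n \<ge> 1 \<Longrightarrow> log_factor \<alpha> n \<le> 2 * real n powr (1/2)"
proof -
  assume n: "n \<ge> 1"
  have "ln (sqrt (real n)) \<le> sqrt (real n) - 1" using n by (intro ln_le_minus_one) auto
  then have "1 + ln (real n) \<le> 2 * sqrt (real n)" using n by (simp add: ln_sqrt)
  moreover have "1 \<le> 2 * sqrt (real n)"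
    using n order.trans[of 1 "sqrt (real n)" "2 * sqrt (real n)"] by simp
  ultimately show ?thesis by (simp only: log_factor_def powr_half_sqrt of_nat_0_le_iff split: if_split) simp
qed

context linear_ratio_family
begin

lemma finite_total_cost:
  assumes "n \<ge> 1" shows "finite (set_pmf (total_cost \<Phi> t n))"
  unfolding total_cost_def set_bind_pmf
  using set_pmf_random_tree[OF assms] finite_subset[OF _ finite_trees[of n]]
  by (intro finite_UN_I finite_destruction_cost) auto

text \<open>Apply the first-step recursion to \<open>(y - t\<^sub>n)\<^sup>s\<close>: the shift by the toll cancels, and the binomial
  expansion on the left leaves moments of order below \<open>s\<close> at the same size \<open>n\<close>.  No convolution of
  lower moments occurs.\<close>
lemma defect_cost_moment:
  assumes n: "n \<ge> 1" and s: "s \<ge> 1"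
  shows "defect (cost_moment \<Phi> \<alpha> s) n =
    - (\<Sum>j<s. real (s choose j) * (- (real n powr \<alpha>)) ^ (s - j) * cost_moment \<Phi> \<alpha> j n)"
proof -
  define t where "t = real n powr \<alpha>"
  let ?E = "measure_pmf.expectation (power_cost \<Phi> \<alpha> n)"
  have fin: "finite (set_pmf (power_cost \<Phi> \<alpha> n))"
    unfolding power_cost_def by (rule finite_total_cost[OF n])
  have "?E (\<lambda>y. (y - t) ^ s) = ?E (\<lambda>y. \<Sum>j\<le>s. (real (s choose j) * (- t) ^ (s - j)) * y ^ j)"
    by (intro Bochner_Integration.integral_cong refl)
       (simp only: diff_conv_add_uminus binomial_ring mult_ac)
  also have "\<dots> = (\<Sum>j\<le>s. real (s choose j) * (- t) ^ (s - j) * cost_moment \<Phi> \<alpha> j n)"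
    unfolding cost_moment_def
    by (subst Bochner_Integration.integral_sum) (auto intro!: integrable_measure_pmf_finite fin)
  also have "\<dots> = cost_moment \<Phi> \<alpha> s n + (\<Sum>j<s. real (s choose j) * (- t) ^ (s - j) * cost_moment \<Phi> \<alpha> j n)"
    by (simp add: lessThan_Suc_atMost[symmetric])
  finally have 1: "?E (\<lambda>y. (y - t) ^ s) = cost_moment \<Phi> \<alpha> s n + (\<Sum>j<s. real (s choose j) * (- t) ^ (s - j) * cost_moment \<Phi> \<alpha> j n)" .
  have 2: "?E (\<lambda>y. (y - t) ^ s) = (\<Sum>k=1..<n. split_prob n k * cost_moment \<Phi> \<alpha> s k)"
  proof (cases "n = 1")
    case True
    then have "?E (\<lambda>y. (y - t) ^ s) = 0"
      unfolding power_cost_def True expectation_total_cost_1 t_def using s by simp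
    then show ?thesis using True by simp
  next
    case False
    with n have "n \<ge> 2" by simp
    then show ?thesis
      unfolding power_cost_def cost_moment_def by (subst expectation_total_cost_rec) (simp_all add: t_def)
  qed
  show ?thesis unfolding defect_def using 1 2 by (simp add: t_def)
qed

lemma moment_coeff_Suc:
  assumes "b > 0"
  shows "moment_coeff (scaling_sigma \<Phi>) b (Suc s) * loss_rate (real (Suc s) * b) = real (Suc s) * moment_coeff (scaling_sigma \<Phi>) b s"
proof -
  let ?g = "real (Suc s) * b"
  define P where "P = (\<Prod>j=1..s. Gamma (real j * b) / Gamma (real j * b + 1/2))"
  have g: "?g > 0" using assms by simp
  have pos: "Gamma ?g > 0" "Gamma (?g + 1/2) > 0" "scaling_sigma \<Phi> > 0" "sqrt 2 > (0::real)"
    using g scaling_sigma_pos by (auto intro!: Gamma_real_pos simp del: of_nat_Suc)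
  have "2 powr (real (Suc s) / 2) = 2 powr (1/2 + real s / 2)" by (simp add: add_divide_distrib)
  also have "\<dots> = sqrt 2 * 2 powr (real s / 2)" by (simp add: powr_add powr_half_sqrt)
  finally have p2: "2 powr (real (Suc s) / 2) = sqrt 2 * 2 powr (real s / 2)" .
  have prod: "(\<Prod>j=1..Suc s. Gamma (real j * b) / Gamma (real j * b + 1/2)) = P * (Gamma ?g / Gamma (?g + 1/2))"
    unfolding P_def by simp
  have "moment_coeff (scaling_sigma \<Phi>) b (Suc s) = (real (Suc s) * (fact s * scaling_sigma \<Phi> ^ s / 2 powr (real s / 2) * P))
       * (scaling_sigma \<Phi> / sqrt 2 * (Gamma ?g / Gamma (?g + 1/2)))"
    unfolding moment_coeff_def prod p2 by (simp add: mult_ac)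
  also have "fact s * scaling_sigma \<Phi> ^ s / 2 powr (real s / 2) * P = moment_coeff (scaling_sigma \<Phi>) b s"
    by (simp add: moment_coeff_def P_def)
  finally have *: "moment_coeff (scaling_sigma \<Phi>) b (Suc s) = (real (Suc s) * moment_coeff (scaling_sigma \<Phi>) b s)
       * (scaling_sigma \<Phi> / sqrt 2 * (Gamma ?g / Gamma (?g + 1/2)))" .
  have "(scaling_sigma \<Phi> / sqrt 2 * (Gamma ?g / Gamma (?g + 1/2))) * loss_rate ?g = 1"
    unfolding loss_rate_eq using pos by (simp del: of_nat_Suc)
  then show ?thesis
    unfolding * mult.assoc[of "real (Suc s) * moment_coeff (scaling_sigma \<Phi>) b s"] by (simp only: mult_1_right)
qed

lemma cost_moment_0: "cost_moment \<Phi> \<alpha> 0 n = 1"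
  by (simp add: cost_moment_def)

text \<open>Let \<open>b = \<alpha> + 1/2\<close> and \<open>\<gamma> = s b\<close>.  In the defect of the \<open>s\<close>-th moment the term of order \<open>s - 1\<close> is
  \<open>s n\<^sup>\<alpha> \<mu>\<^sub>s\<^sub>-\<^sub>1 \<approx> s M\<^sub>s\<^sub>-\<^sub>1 n powr (\<gamma> - 1/2)\<close>, and the lower ones are \<open>O(n powr (\<gamma> - 1))\<close>.  Subtracting \<open>M\<^sub>s n\<^sup>\<gamma>\<close>
  removes the leading term, as \<open>M\<^sub>s\<close> times the loss rate at \<open>\<gamma>\<close> equals \<open>s M\<^sub>s\<^sub>-\<^sub>1\<close>.  The difference has a defect
  \<open>O(n powr (\<gamma> - 1))\<close>, up to a logarithm, and comparison with \<open>n powr (\<gamma> - 1/2)\<close> gives the bound.  The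
  exponent \<open>\<gamma> - 1/2\<close> is zero only for \<open>\<alpha> = 0\<close> and \<open>s = 1\<close>; there \<open>1 + ln n\<close> takes the place of the power,
  and the logarithm enters the bounds for all higher moments.\<close>
theorem cost_moment_asymptotics:
  assumes \<alpha>: "\<alpha> \<ge> 0"
  shows "\<exists>K. \<forall>n\<ge>1. \<bar>cost_moment \<Phi> \<alpha> s n - moment_coeff (scaling_sigma \<Phi>) (\<alpha> + 1/2) s * real n powr (real s * (\<alpha> + 1/2))\<bar>
     \<le> K * (real n powr (real s * (\<alpha> + 1/2) - 1/2) * log_factor \<alpha> n)"
proof (induction s rule: less_induct)
  case (less s)
  define b where "b = \<alpha> + 1/2"
  define M where "M = moment_coeff (scaling_sigma \<Phi>) b"
  define \<mu> where "\<mu> = cost_moment \<Phi> \<alpha>"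
  define L where "L = log_factor \<alpha>"
  have b: "b > 0" "b \<ge> 1/2" using \<alpha> by (auto simp: b_def)
  have L: "n \<ge> 1 \<Longrightarrow> L n \<ge> 1" "1 \<le> k \<Longrightarrow> k \<le> n \<Longrightarrow> L k \<le> L n" "n \<ge> 1 \<Longrightarrow> L n \<le> 2 * real n powr (1/2)" for k n
    using log_factor_ge_1 log_factor_mono log_factor_le by (auto simp: L_def)
  have IH: "\<exists>K. \<forall>n\<ge>1. \<bar>\<mu> j n - M j * real n powr (real j * b)\<bar> \<le> K * (real n powr (real j * b - 1/2) * L n)" if "j < s" for j
    using less[OF that] by (simp add: \<mu>_def M_def b_def L_def)
  have crude: "\<exists>C. \<forall>n\<ge>1. \<bar>\<mu> j n\<bar> \<le> C * real n powr (real j * b)" if j: "j < s" for j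
  proof -
    obtain K where K: "\<And>n. n \<ge> 1 \<Longrightarrow> \<bar>\<mu> j n - M j * real n powr (real j * b)\<bar> \<le> K * (real n powr (real j * b - 1/2) * L n)"
      using IH[OF j] by blast
    have "\<bar>\<mu> j n\<bar> \<le> (\<bar>M j\<bar> + \<bar>K\<bar> * 2) * real n powr (real j * b)" if n: "n \<ge> 1" for n
    proof -
      have "K * (real n powr (real j * b - 1/2) * L n) \<le> \<bar>K\<bar> * (real n powr (real j * b - 1/2) * (2 * real n powr (1/2)))"
        using L(1)[OF n] L(3)[OF n] by (intro mult_mono) auto
      also have "real n powr (real j * b - 1/2) * (2 * real n powr (1/2)) = 2 * real n powr (real j * b)"
        by (simp add: powr_add[symmetric])
      finally have "K * (real n powr (real j * b - 1/2) * L n) \<le> \<bar>K\<bar> * 2 * real n powr (real j * b)" by simp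
      moreover have "\<bar>M j * real n powr (real j * b)\<bar> = \<bar>M j\<bar> * real n powr (real j * b)" by (simp add: abs_mult)
      ultimately show ?thesis using K[OF n] unfolding distrib_right by linarith
    qed
    then show ?thesis by blast
  qed
  show ?case
  proof (cases s)
    case 0
    then show ?thesis by (intro exI[of _ 0]) (simp add: cost_moment_0 moment_coeff_def)
  next
    case (Suc s')
    define \<gamma> where "\<gamma> = real s * b"
    define x where "x n = \<mu> s n - M s * real n powr \<gamma>" for n
    have \<gamma>: "\<gamma> > 0" "\<gamma> \<ge> 1/2" "real s' * b = \<gamma> - b"
    proof -
      have "1 * b \<le> real s * b" using b Suc by (intro mult_right_mono) auto
      then show "\<gamma> > 0" "\<gamma> \<ge> 1/2" using b unfolding \<gamma>_def by linarith+
      show "real s' * b = \<gamma> - b" by (simp add: \<gamma>_def Suc algebra_simps)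
    qed
    obtain C where C: "\<And>j n. j < s \<Longrightarrow> n \<ge> 1 \<Longrightarrow> \<bar>\<mu> j n\<bar> \<le> C j * real n powr (real j * b)"
      using crude by metis
    obtain K1 where K1: "K1 > 0" "\<And>n. n \<ge> 1 \<Longrightarrow> \<bar>defect (\<lambda>n. real n powr \<gamma>) n - loss_rate \<gamma> * real n powr (\<gamma> - 1/2)\<bar> \<le> K1 * real n powr (\<gamma> - 1)"
      by (rule bigo_explicit_bound[OF defect_powr_asymptotics[OF \<gamma>(1)]]) auto
    \<comment> \<open>The moment of order zero is exactly one.  Thus for \<open>s = 1\<close> no logarithm enters the defect, as required
      when the comparison sequence is \<open>1 + ln n\<close>.\<close>
    obtain K0 where K0: "K0 \<ge> 0" "s = 1 \<Longrightarrow> K0 = 0"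
      "\<And>n. n \<ge> 1 \<Longrightarrow> \<bar>\<mu> s' n - M s' * real n powr (real s' * b)\<bar> \<le> K0 * (real n powr (real s' * b - 1/2) * L n)"
    proof (cases "s = 1")
      case True
      then show ?thesis using that[of 0] Suc by (simp add: \<mu>_def cost_moment_0 M_def moment_coeff_def)
    next
      case False
      obtain K where K: "\<And>n. n \<ge> 1 \<Longrightarrow> \<bar>\<mu> s' n - M s' * real n powr (real s' * b)\<bar> \<le> K * (real n powr (real s' * b - 1/2) * L n)"
        using IH[of s'] Suc by auto
      have "\<bar>\<mu> s' n - M s' * real n powr (real s' * b)\<bar> \<le> \<bar>K\<bar> * (real n powr (real s' * b - 1/2) * L n)" if n: "n \<ge> 1" for n
        using K[OF n] L(1)[OF n] mult_right_mono[OF abs_ge_self[of K], of "real n powr (real s' * b - 1/2) * L n"] by auto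
      then show ?thesis using that[of "\<bar>K\<bar>"] False by simp
    qed
    define K2 where "K2 = (\<Sum>j<s'. real (s choose j) * C j)"
    define K where "K = K2 + \<bar>M s\<bar> * K1"
    \<comment> \<open>The terms of order \<open>n powr (\<gamma> - 1/2)\<close> cancel.  The remaining ones are the error of the moment of order \<open>s - 1\<close>,
      the error in the defect of \<open>n\<^sup>\<gamma>\<close>, and the moments of order at most \<open>s - 2\<close>.\<close>
    have x_defect: "\<bar>defect x n\<bar> \<le> real n powr (\<gamma> - 1) * (real s * K0 * L n + K)" if n: "n \<ge> 1" for n
    proof -
      define w where "w = real n powr \<alpha>"
      define D where "D = defect (\<lambda>n. real n powr \<gamma>) n"
      define R where "R = (\<Sum>j<s'. real (s choose j) * (- w) ^ (s - j) * \<mu> j n)"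
      have wpow: "w * real n powr (real s' * b) = real n powr (\<gamma> - 1/2)"
        "w * real n powr (real s' * b - 1/2) = real n powr (\<gamma> - 1)"
        unfolding w_def \<gamma>(3) powr_add[symmetric] by (simp_all add: b_def)
      have "defect (\<mu> s) n = real s * w * \<mu> s' n - R"
        unfolding \<mu>_def using defect_cost_moment[OF n, of s \<alpha>] Suc
        by (simp add: R_def w_def \<mu>_def)
      moreover have "defect x n = defect (\<mu> s) n - M s * D"
        unfolding x_def D_def by (rule defect_diff)
      moreover have "M s * loss_rate \<gamma> = real s * M s'"
        unfolding M_def \<gamma>_def Suc using moment_coeff_Suc[OF b(1)] by simp
      ultimately have "defect x n = real s * (w * (\<mu> s' n - M s' * real n powr (real s' * b)))
          - M s * (D - loss_rate \<gamma> * real n powr (\<gamma> - 1/2)) - R"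
        by (simp add: wpow(1) right_diff_distrib mult.assoc[symmetric])
      also have "\<bar>\<dots>\<bar> \<le> real s * (w * \<bar>\<mu> s' n - M s' * real n powr (real s' * b)\<bar>)
          + \<bar>M s\<bar> * \<bar>D - loss_rate \<gamma> * real n powr (\<gamma> - 1/2)\<bar> + \<bar>R\<bar>"
        by (intro order.trans[OF abs_triangle_ineq4] add_right_mono) (simp add: abs_mult w_def)
      also have "\<dots> \<le> real s * (w * (K0 * (real n powr (real s' * b - 1/2) * L n)))
          + \<bar>M s\<bar> * (K1 * real n powr (\<gamma> - 1)) + K2 * real n powr (\<gamma> - 1)"
      proof (intro add_mono mult_left_mono)
        show "\<bar>D - loss_rate \<gamma> * real n powr (\<gamma> - 1/2)\<bar> \<le> K1 * real n powr (\<gamma> - 1)"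
          unfolding D_def by (rule K1(2)[OF n])
        have "\<bar>R\<bar> \<le> (\<Sum>j<s'. \<bar>real (s choose j) * (- w) ^ (s - j) * \<mu> j n\<bar>)"
          unfolding R_def by (rule sum_abs)
        also have "\<dots> \<le> (\<Sum>j<s'. real (s choose j) * C j * real n powr (\<gamma> - 1))"
        proof (intro sum_mono)
          fix j assume j: "j \<in> {..<s'}"
          have C0: "C j \<ge> 0" using C[of j 1] j Suc by simp
          have "\<bar>(- w) ^ (s - j)\<bar> = real n powr (real (s - j) * \<alpha>)"
            using n by (simp add: w_def power_abs powr_realpow[symmetric] powr_powr mult.commute)
          then have "\<bar>real (s choose j) * (- w) ^ (s - j) * \<mu> j n\<bar> = real (s choose j) * (real n powr (real (s - j) * \<alpha>) * \<bar>\<mu> j n\<bar>)"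
            by (simp add: abs_mult)
          also have "\<dots> \<le> real (s choose j) * (real n powr (real (s - j) * \<alpha>) * (C j * real n powr (real j * b)))"
            using C[of j n] j n Suc by (intro mult_left_mono) auto
          also have "\<dots> = real (s choose j) * C j * (real n powr (real (s - j) * \<alpha>) * real n powr (real j * b))"
            by (simp only: mult_ac)
          also have "real n powr (real (s - j) * \<alpha>) * real n powr (real j * b) = real n powr (real (s - j) * \<alpha> + real j * b)"
            by (simp add: powr_add)
          also have "real (s - j) * \<alpha> + real j * b = \<gamma> - real (s - j) / 2"
            using j Suc by (simp add: \<gamma>_def b_def of_nat_diff algebra_simps add_divide_distrib diff_divide_distrib)
          also have "real (s choose j) * C j * real n powr (\<gamma> - real (s - j) / 2) \<le> real (s choose j) * C j * real n powr (\<gamma> - 1)"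
            using j Suc n C0 by (intro mult_left_mono powr_mono) auto
          finally show "\<bar>real (s choose j) * (- w) ^ (s - j) * \<mu> j n\<bar> \<le> real (s choose j) * C j * real n powr (\<gamma> - 1)" .
        qed
        finally show "\<bar>R\<bar> \<le> K2 * real n powr (\<gamma> - 1)" by (simp add: K2_def sum_distrib_right)
      qed (use K0(3)[OF n] in \<open>auto simp: w_def\<close>)
      also have "real s * (w * (K0 * (real n powr (real s' * b - 1/2) * L n))) = real s * K0 * L n * real n powr (\<gamma> - 1)"
        unfolding wpow(2)[symmetric] by (simp only: mult_ac)
      finally show ?thesis by (simp add: K_def algebra_simps)
    qed
    have "\<exists>K'. \<forall>n\<ge>1. \<bar>x n\<bar> \<le> K' * (real n powr (\<gamma> - 1/2) * L n)"
    proof (cases "\<gamma> - 1/2 > 0")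
      case True
      obtain Q where Q: "Q > 0" "\<And>n. n \<ge> 1 \<Longrightarrow> real n powr (\<gamma> - 1/2 - 1/2) * L n \<le> Q * defect (\<lambda>n. real n powr (\<gamma> - 1/2) * L n) n"
        by (rule defect_powr_mult_lower_bound[OF True, of L]) (use L in \<open>auto intro: order.trans[OF zero_le_one]\<close>)
      have "\<bar>defect x n\<bar> \<le> (real s * K0 + \<bar>K\<bar>) * Q * defect (\<lambda>n. real n powr (\<gamma> - 1/2) * L n) n" if n: "n \<ge> 1" for n
      proof -
        have "K \<le> \<bar>K\<bar> * L n" using L(1)[OF n] mult_left_mono[of 1 "L n" "\<bar>K\<bar>"] by simp
        then have "\<bar>defect x n\<bar> \<le> real n powr (\<gamma> - 1) * ((real s * K0 + \<bar>K\<bar>) * L n)"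
          by (intro order.trans[OF x_defect[OF n]] mult_left_mono) (auto simp: algebra_simps)
        also have "\<dots> = (real s * K0 + \<bar>K\<bar>) * (real n powr (\<gamma> - 1/2 - 1/2) * L n)" by simp
        also have "\<dots> \<le> (real s * K0 + \<bar>K\<bar>) * (Q * defect (\<lambda>n. real n powr (\<gamma> - 1/2) * L n) n)"
          using K0(1) by (intro mult_left_mono Q(2)[OF n]) auto
        finally show ?thesis by (simp only: mult.assoc)
      qed
      from defect_comparison[OF this] show ?thesis by blast
    next
      case False
      then have eq: "\<gamma> = 1/2" using \<gamma>(2) by simp
      have s1: "s = 1"
      proof (rule ccontr)
        assume "s \<noteq> 1"
        then have "2 * b \<le> real s * b" using b Suc by (intro mult_right_mono) auto
        then show False using eq b unfolding \<gamma>_def by linarith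
      qed
      then have "\<alpha> = 0" using eq by (simp add: \<gamma>_def b_def)
      then have L_eq: "L = (\<lambda>n. 1 + ln (real n))" by (auto simp: L_def log_factor_def)
      obtain Q where Q: "Q > 0" "\<And>n. n \<ge> 1 \<Longrightarrow> real n powr (-1/2) \<le> Q * defect L n"
        using defect_ln_lower_bound unfolding L_eq by blast
      have "\<bar>defect x n\<bar> \<le> \<bar>K\<bar> * Q * defect L n" if n: "n \<ge> 1" for n
      proof -
        have "\<bar>defect x n\<bar> \<le> real n powr (-1/2) * K" using x_defect[OF n] K0(2)[OF s1] by (simp add: eq)
        also have "\<dots> \<le> \<bar>K\<bar> * real n powr (-1/2)" by (simp add: mult.commute mult_right_mono)
        also have "\<dots> \<le> \<bar>K\<bar> * (Q * defect L n)" by (intro mult_left_mono Q(2)[OF n]) auto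
        finally show ?thesis by simp
      qed
      from defect_comparison[OF this] have "\<bar>x n\<bar> \<le> \<bar>K\<bar> * Q * (real n powr (\<gamma> - 1/2) * L n)" if "n \<ge> 1" for n
        using that by (simp add: eq)
      then show ?thesis by blast
    qed
    then show ?thesis
      by (simp add: x_def \<mu>_def M_def b_def L_def \<gamma>_def)
  qed
qed

end

section \<open>The method of moments\<close>

definition has_moments :: "(nat \<Rightarrow> real) \<Rightarrow> real measure \<Rightarrow> bool" where
  "has_moments m \<nu> \<longleftrightarrow> real_distribution \<nu> \<and> (\<forall>s. integrable \<nu> (\<lambda>y. y ^ s) \<and> (\<integral>y. y ^ s \<partial>\<nu>) = m s)"

text \<open>The even moments bound the error of the Taylor expansion of the characteristic function, so this
  condition makes the characteristic function an entire power series with coefficients determined by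
  the moments.\<close>
definition entire_moments :: "(nat \<Rightarrow> real) \<Rightarrow> bool" where
  "entire_moments m \<longleftrightarrow> (\<forall>t. (\<lambda>k. \<bar>t\<bar> ^ (2 * k) / fact (2 * k) * m (2 * k)) \<longlonglongrightarrow> 0)"

lemma char_eq_moment_series:
  assumes "has_moments m \<nu>" "entire_moments m"
  shows "(\<lambda>k. \<Sum>j\<le>2 * k. (\<i> * t) ^ j / fact j * m j) \<longlonglongrightarrow> char \<nu> t"
proof -
  interpret real_distribution \<nu> using assms(1) by (simp add: has_moments_def)
  have bound: "norm ((\<Sum>j\<le>2 * k. (\<i> * t) ^ j / fact j * m j) - char \<nu> t) \<le> 2 * (\<bar>t\<bar> ^ (2 * k) / fact (2 * k) * m (2 * k))" for k
  proof -
    have "(\<integral>x. \<bar>x\<bar> ^ (2 * k) \<partial>\<nu>) = m (2 * k)"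
      using assms(1) by (simp add: has_moments_def power_even_abs)
    then show ?thesis
      using char_approx1[of "2 * k" t] assms(1)
      by (simp add: has_moments_def norm_minus_commute)
  qed
  have "(\<lambda>k. 2 * (\<bar>t\<bar> ^ (2 * k) / fact (2 * k) * m (2 * k))) \<longlonglongrightarrow> 2 * 0"
    using assms(2) by (intro tendsto_intros) (simp add: entire_moments_def)
  then have "(\<lambda>k. 2 * (\<bar>t\<bar> ^ (2 * k) / fact (2 * k) * m (2 * k))) \<longlonglongrightarrow> 0" by simp
  then have "(\<lambda>k. (\<Sum>j\<le>2 * k. (\<i> * t) ^ j / fact j * m j) - char \<nu> t) \<longlonglongrightarrow> 0"
    by (rule Lim_null_comparison[rotated]) (use bound in auto)
  then show ?thesis by (rule LIM_zero_cancel)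
qed

theorem moments_determine_distribution:
  assumes "has_moments m \<nu>" "has_moments m \<nu>'" "entire_moments m"
  shows "\<nu>' = \<nu>"
proof (rule Levy_uniqueness)
  show "real_distribution \<nu>'" "real_distribution \<nu>" using assms by (auto simp: has_moments_def)
  show "char \<nu>' = char \<nu>"
    using LIMSEQ_unique[OF char_eq_moment_series[OF assms(2,3)] char_eq_moment_series[OF assms(1,3)]] by auto
qed

lemma integrable_power_of_even:
  assumes "real_distribution \<nu>" "integrable \<nu> (\<lambda>y. y ^ (2 * s))"
  shows "integrable \<nu> (\<lambda>y. y ^ s)"
proof -
  interpret real_distribution \<nu> by fact
  show ?thesis
  proof (rule Bochner_Integration.integrable_bound)
    show "integrable \<nu> (\<lambda>y. 1 + y ^ (2 * s))" using assms(2) by simp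
    have "\<bar>y ^ s\<bar> \<le> \<bar>1 + y ^ (2 * s)\<bar>" for y :: real
    proof -
      have "0 \<le> (\<bar>y ^ s\<bar> - 1) ^ 2" by simp
      then have "2 * \<bar>y ^ s\<bar> \<le> 1 + (y ^ s) ^ 2" by (simp add: power2_diff)
      then show ?thesis by (simp add: power_mult[symmetric] mult.commute)
    qed
    then show "AE y in \<nu>. norm (y ^ s) \<le> norm (1 + y ^ (2 * s))" by simp
  qed simp
qed

text \<open>Weak convergence controls integrals of bounded continuous functions only.  Clamping \<open>y\<^sup>s\<close> at height
  \<open>A\<close> changes its integral by at most the moment of order \<open>2 s\<close> divided by \<open>A\<close>, uniformly along the sequence.\<close>
definition clamp_power :: "real \<Rightarrow> nat \<Rightarrow> real \<Rightarrow> real" where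
  "clamp_power A s y = max (- A) (min A (y ^ s))"

lemma clamp_power_props:
  assumes "A > 0"
  shows "\<bar>clamp_power A s y\<bar> \<le> A" "isCont (clamp_power A s) y" "clamp_power A s \<in> borel_measurable borel"
    "\<bar>y ^ s - clamp_power A s y\<bar> \<le> y ^ (2 * s) / A"
proof -
  show "\<bar>clamp_power A s y\<bar> \<le> A" using assms by (auto simp: clamp_power_def)
  show "isCont (clamp_power A s) y" unfolding clamp_power_def by (intro continuous_intros)
  show "clamp_power A s \<in> borel_measurable borel" unfolding clamp_power_def by measurable
  have sq: "y ^ (2 * s) = \<bar>y ^ s\<bar> * \<bar>y ^ s\<bar>" by (simp add: power_mult power2_eq_square power_mult_distrib[symmetric] mult.commute)
  show "\<bar>y ^ s - clamp_power A s y\<bar> \<le> y ^ (2 * s) / A"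
  proof (cases "\<bar>y ^ s\<bar> \<le> A")
    case True
    then have "clamp_power A s y = y ^ s" by (auto simp: clamp_power_def)
    then show ?thesis using assms by (simp add: sq)
  next
    case False
    then have "\<bar>y ^ s - clamp_power A s y\<bar> \<le> \<bar>y ^ s\<bar>" using assms by (auto simp: clamp_power_def)
    also have "\<bar>y ^ s\<bar> * A \<le> \<bar>y ^ s\<bar> * \<bar>y ^ s\<bar>" using False by (intro mult_left_mono) auto
    then have "\<bar>y ^ s\<bar> \<le> y ^ (2 * s) / A" unfolding sq using assms by (simp add: field_simps)
    finally show ?thesis .
  qed
qed

lemma clamp_power_integral_close:
  assumes "real_distribution \<nu>" "integrable \<nu> (\<lambda>y. y ^ (2 * s))" "A > 0"
  shows "\<bar>(\<integral>y. y ^ s \<partial>\<nu>) - (\<integral>y. clamp_power A s y \<partial>\<nu>)\<bar> \<le> (\<integral>y. y ^ (2 * s) \<partial>\<nu>) / A"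
proof -
  interpret real_distribution \<nu> by fact
  note [measurable] = clamp_power_props(3)[OF assms(3)]
  have i1: "integrable \<nu> (\<lambda>y. y ^ s)" by (rule integrable_power_of_even[OF assms(1,2)])
  have i2: "integrable \<nu> (clamp_power A s)"
    by (rule integrable_const_bound[of _ A]) (use clamp_power_props(1)[OF assms(3)] in auto)
  have "\<bar>(\<integral>y. y ^ s \<partial>\<nu>) - (\<integral>y. clamp_power A s y \<partial>\<nu>)\<bar> = \<bar>\<integral>y. y ^ s - clamp_power A s y \<partial>\<nu>\<bar>"
    using i1 i2 by simp
  also have "\<dots> \<le> (\<integral>y. \<bar>y ^ s - clamp_power A s y\<bar> \<partial>\<nu>)"
    by (rule integral_abs_bound)
  also have "\<dots> \<le> (\<integral>y. y ^ (2 * s) / A \<partial>\<nu>)"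
    using i1 i2 assms(2) clamp_power_props(4)[OF assms(3)] by (intro integral_mono) auto
  finally show ?thesis by simp
qed

text \<open>Fatou's lemma, applied to clamped even powers, bounds the even moments of the limit.  Then all
  powers are integrable, and the clamping error tends to zero as \<open>A\<close> tends to infinity.\<close>
lemma moments_of_weak_limit:
  assumes M: "\<And>n. real_distribution (M n)" "\<And>n s. integrable (M n) (\<lambda>y. y ^ s)"
    and lim: "\<And>s. (\<lambda>n. \<integral>y. y ^ s \<partial>M n) \<longlonglongrightarrow> m s"
    and \<nu>: "real_distribution \<nu>" "weak_conv_m M \<nu>"
  shows "has_moments m \<nu>"
proof -
  interpret \<nu>: real_distribution \<nu> by fact
  have clamp_lim: "(\<lambda>n. \<integral>y. clamp_power A s y \<partial>M n) \<longlonglongrightarrow> (\<integral>y. clamp_power A s y \<partial>\<nu>)" if "A > 0" for A s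
    using clamp_power_props(1,2)[OF that] M(1) \<nu>
    by (intro weak_conv_imp_integral_bdd_continuous_conv[where B = A]) auto
  have even: "integrable \<nu> (\<lambda>y. y ^ (2 * s))" for s
  proof -
    let ?f = "\<lambda>N::nat. clamp_power (real N + 1) (2 * s)"
    have bound: "(\<integral>y. ?f N y \<partial>\<nu>) \<le> m (2 * s)" for N
    proof (rule LIMSEQ_le[OF clamp_lim lim])
      have "(\<integral>y. ?f N y \<partial>M n) \<le> (\<integral>y. y ^ (2 * s) \<partial>M n)" for n
      proof -
        interpret Mn: real_distribution "M n" by (rule M(1))
        have "?f N y \<le> y ^ (2 * s)" for y
        proof -
          have "y ^ (2 * s) \<ge> 0" by (simp add: power_mult)
          then show ?thesis by (auto simp: clamp_power_def intro: order.trans[of _ 0])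
        qed
        moreover have "integrable (M n) (?f N)"
          using clamp_power_props(1,3)[of "real N + 1" "2 * s"]
          by (intro Mn.integrable_const_bound[of _ "real N + 1"]) auto
        ultimately show ?thesis
          using M(2) by (intro integral_mono) auto
      qed
      then show "\<exists>N'. \<forall>n\<ge>N'. (\<integral>y. ?f N y \<partial>M n) \<le> (\<integral>y. y ^ (2 * s) \<partial>M n)" by blast
    qed simp
    have "(\<integral>\<^sup>+y. ennreal (y ^ (2 * s)) \<partial>\<nu>) = (\<integral>\<^sup>+y. liminf (\<lambda>N. ennreal (?f N y)) \<partial>\<nu>)"
    proof (intro nn_integral_cong)
      fix y :: real
      have nonneg: "y ^ (2 * s) \<ge> 0" by (simp add: power_mult)
      have "\<forall>\<^sub>F N in sequentially. ennreal (?f N y) = ennreal (y ^ (2 * s))"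
        using eventually_ge_at_top[of "nat \<lceil>y ^ (2 * s)\<rceil>"]
      proof eventually_elim
        case (elim N)
        then have "min (real N + 1) (y ^ (2 * s)) = y ^ (2 * s)" by linarith
        moreover have "max (- (real N + 1)) (y ^ (2 * s)) = y ^ (2 * s)" using nonneg by linarith
        ultimately show ?case by (simp only: clamp_power_def)
      qed
      then have "(\<lambda>N. ennreal (?f N y)) \<longlonglongrightarrow> ennreal (y ^ (2 * s))"
        by (rule tendsto_eventually)
      then show "ennreal (y ^ (2 * s)) = liminf (\<lambda>N. ennreal (?f N y))"
        by (simp add: lim_imp_Liminf)
    qed
    also have "\<dots> \<le> liminf (\<lambda>N. \<integral>\<^sup>+y. ennreal (?f N y) \<partial>\<nu>)"
      using clamp_power_props(3) by (intro nn_integral_liminf) auto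
    also have "\<dots> \<le> liminf (\<lambda>N::nat. ennreal (m (2 * s)))"
    proof (intro Liminf_mono always_eventually allI)
      fix N
      have nonneg: "?f N y \<ge> 0" for y
      proof -
        have "y ^ (2 * s) \<ge> 0" by (simp add: power_mult)
        then have "min (real N + 1) (y ^ (2 * s)) \<ge> 0" by simp
        then show ?thesis unfolding clamp_power_def by (rule max.coboundedI2)
      qed
      have "integrable \<nu> (?f N)"
        using clamp_power_props(1,3)[of "real N + 1" "2 * s"]
        by (intro \<nu>.integrable_const_bound[of _ "real N + 1"]) auto
      then show "(\<integral>\<^sup>+y. ennreal (?f N y) \<partial>\<nu>) \<le> ennreal (m (2 * s))"
        using bound[of N] nonneg by (simp add: nn_integral_eq_integral ennreal_leI)
    qed
    also have "\<dots> = ennreal (m (2 * s))" by (simp add: Liminf_const)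
    finally have "(\<integral>\<^sup>+y. ennreal (y ^ (2 * s)) \<partial>\<nu>) < \<infinity>" by (simp add: order_le_less_trans)
    then show ?thesis
      by (intro integrableI_nonneg) (auto simp: power_mult)
  qed
  have "(\<integral>y. y ^ s \<partial>\<nu>) = m s" for s
  proof -
    define Q where "Q = m (2 * s) + (\<integral>y. y ^ (2 * s) \<partial>\<nu>)"
    have close: "\<bar>m s - (\<integral>y. y ^ s \<partial>\<nu>)\<bar> \<le> Q / A" if A: "A > 0" for A
    proof -
      have "\<bar>m s - (\<integral>y. clamp_power A s y \<partial>\<nu>)\<bar> \<le> m (2 * s) / A"
      proof (rule LIMSEQ_le)
        show "(\<lambda>n. \<bar>(\<integral>y. y ^ s \<partial>M n) - (\<integral>y. clamp_power A s y \<partial>M n)\<bar>) \<longlonglongrightarrow> \<bar>m s - (\<integral>y. clamp_power A s y \<partial>\<nu>)\<bar>"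
          by (intro tendsto_intros lim clamp_lim A)
        show "(\<lambda>n. (\<integral>y. y ^ (2 * s) \<partial>M n) / A) \<longlonglongrightarrow> m (2 * s) / A"
          using A by (intro tendsto_intros lim) auto
        show "\<exists>N. \<forall>n\<ge>N. \<bar>(\<integral>y. y ^ s \<partial>M n) - (\<integral>y. clamp_power A s y \<partial>M n)\<bar> \<le> (\<integral>y. y ^ (2 * s) \<partial>M n) / A"
          using clamp_power_integral_close[OF M(1) M(2) A] by blast
      qed
      moreover have "\<bar>(\<integral>y. y ^ s \<partial>\<nu>) - (\<integral>y. clamp_power A s y \<partial>\<nu>)\<bar> \<le> (\<integral>y. y ^ (2 * s) \<partial>\<nu>) / A"
        by (rule clamp_power_integral_close[OF \<nu>(1) even A])
      ultimately show ?thesis unfolding Q_def add_divide_distrib by linarith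
    qed
    have "\<forall>\<^sub>F A in at_top. \<bar>m s - (\<integral>y. y ^ s \<partial>\<nu>)\<bar> \<le> Q / A"
      using eventually_gt_at_top[of 0] by eventually_elim (rule close)
    moreover have "((\<lambda>A. Q / A) \<longlongrightarrow> 0) at_top"
      by (intro tendsto_divide_0[OF tendsto_const] filterlim_at_top_imp_at_infinity filterlim_ident)
    ultimately have "\<bar>m s - (\<integral>y. y ^ s \<partial>\<nu>)\<bar> \<le> 0"
      by (intro tendsto_lowerbound[of "\<lambda>A. Q / A" 0 at_top]) auto
    then show ?thesis by simp
  qed
  with even integrable_power_of_even[OF \<nu>(1)] show ?thesis
    by (auto simp: has_moments_def \<nu>)
qed

lemma tight_of_bounded_second_moments:
  assumes M: "\<And>n. real_distribution (M n)" "\<And>n. integrable (M n) (\<lambda>y. y ^ 2)"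
    and B: "\<And>n. (\<integral>y. y ^ 2 \<partial>M n) \<le> B"
  shows "tight M"
  unfolding tight_def
proof (intro conjI allI impI M(1))
  fix \<epsilon> :: real assume \<epsilon>: "\<epsilon> > 0"
  \<comment> \<open>Chebyshev's inequality gives mass at most \<open>B / c\<^sup>2 < \<epsilon>\<close> outside; the summand 1 covers \<open>B = 0\<close>.\<close>
  define c where "c = sqrt ((\<bar>B\<bar> + 1) / \<epsilon>)"
  have c: "c > 0" using \<epsilon> by (auto simp: c_def)
  have "measure (M n) {- c<..c} > 1 - \<epsilon>" for n
  proof -
    interpret real_distribution "M n" by (rule M(1))
    have "prob {y \<in> space (M n). y ^ 2 \<ge> c ^ 2} \<le> (\<integral>y. y ^ 2 \<partial>M n) / c ^ 2"
      using c by (intro integral_Markov_inequality_measure[where A = "{}"] M(2)) auto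
    also have "\<dots> \<le> B / c ^ 2" using B[of n] c by (intro divide_right_mono) auto
    also have "\<dots> < \<epsilon>"
    proof -
      have "c ^ 2 = (\<bar>B\<bar> + 1) / \<epsilon>" using \<epsilon> by (simp add: c_def)
      then have "\<epsilon> * c ^ 2 = \<bar>B\<bar> + 1" using \<epsilon> by simp
      then show ?thesis using c by (simp add: field_simps)
    qed
    finally have small: "prob {y \<in> space (M n). y ^ 2 \<ge> c ^ 2} < \<epsilon>" .
    have "1 - prob {- c<..c} = prob (space (M n) - {- c<..c})" by (subst prob_compl) auto
    also have "\<dots> \<le> prob {y \<in> space (M n). y ^ 2 \<ge> c ^ 2}"
    proof (rule finite_measure_mono)
      show "space (M n) - {- c<..c} \<subseteq> {y \<in> space (M n). y ^ 2 \<ge> c ^ 2}"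
        using c by (auto simp: abs_le_square_iff[symmetric] not_less)
    qed simp
    finally show ?thesis using small by linarith
  qed
  then show "\<exists>a b. a < b \<and> (\<forall>n. measure (M n) {a<..b} > 1 - \<epsilon>)"
    using c by (intro exI[of _ "- c"] exI[of _ c]) auto
qed

text \<open>Bounded second moments make the sequence tight.  Every subsequential limit has the moments \<open>m\<close>, hence
  all of them coincide, and existence of one of them yields the limit law itself.\<close>
theorem method_of_moments:
  assumes M: "\<And>n. real_distribution (M n)" "\<And>n s. integrable (M n) (\<lambda>y. y ^ s)"
    and lim: "\<And>s. (\<lambda>n. \<integral>y. y ^ s \<partial>M n) \<longlonglongrightarrow> m s"
    and m: "entire_moments m"
  obtains \<nu> where "has_moments m \<nu>" "weak_conv_m M \<nu>"
proof -
  obtain B where B: "\<And>n. norm (\<integral>y. y ^ 2 \<partial>M n) \<le> B"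
    using convergent_imp_Bseq[OF convergentI[OF lim[of 2]]] by (auto simp: Bseq_def)
  have tight: "tight M"
    by (rule tight_of_bounded_second_moments[where B = B, OF M(1) M(2)]) (use B in \<open>auto simp: abs_le_iff\<close>)
  have sub: "has_moments m \<nu>" if "strict_mono r" "real_distribution \<nu>" "weak_conv_m (M \<circ> r) \<nu>" for r \<nu>
    using that M LIMSEQ_subseq_LIMSEQ[OF lim that(1)]
    by (intro moments_of_weak_limit[of "M \<circ> r"]) (auto simp: o_def)
  obtain r \<nu> where r: "strict_mono r" "real_distribution \<nu>" "weak_conv_m (M \<circ> id \<circ> r) \<nu>"
    using tight_imp_convergent_subsubsequence[OF tight strict_mono_id] by auto
  have \<nu>: "has_moments m \<nu>" using sub r by simp
  have "weak_conv_m M \<nu>"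
  proof (rule tight_subseq_weak_converge[OF M(1) r(2) tight])
    fix q \<nu>' assume q: "strict_mono q" "real_distribution \<nu>'" "weak_conv_m (M \<circ> q) \<nu>'"
    then have "\<nu>' = \<nu>" using moments_determine_distribution[OF \<nu> sub m] by simp
    then show "weak_conv_m (M \<circ> q) \<nu>" using q by simp
  qed
  with \<nu> show ?thesis by (rule that)
qed

section \<open>The limit moments and the Rayleigh distribution\<close>

lemma Gamma_half_shift_ratio_tendsto_0: "((\<lambda>x::real. Gamma x / Gamma (x + 1/2)) \<longlongrightarrow> 0) at_top"
proof -
  define R where "R x = stirling_remainder x - ln (2 * pi) / 2" for x
  have R: "R \<in> O(\<lambda>x. 1 / x)" unfolding R_def by (rule stirling_ln_Gamma)
  have "(\<lambda>x::real. 1 / x) \<in> o(\<lambda>_. 1 :: real)" by real_asymp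
  with R have "R \<in> o(\<lambda>_. 1)" by (rule landau_o.big_small_trans)
  then have R0: "(R \<longlongrightarrow> 0) at_top" by (drule_tac smalloD_tendsto) simp
  have "((\<lambda>x. R x - R (x + 1/2)) \<longlongrightarrow> 0 - 0) at_top"
    by (intro tendsto_intros R0 filterlim_compose[OF R0]) real_asymp
  then have "((\<lambda>x. exp (R x - R (x + 1/2))) \<longlongrightarrow> exp (0 - 0)) at_top" by (rule tendsto_exp)
  moreover have "((\<lambda>x::real. exp ((x - 1/2) * ln x - x * ln (x + 1/2) + 1/2)) \<longlongrightarrow> 0) at_top" by real_asymp
  ultimately have "((\<lambda>x. exp (R x - R (x + 1/2)) * exp ((x - 1/2) * ln x - x * ln (x + 1/2) + 1/2)) \<longlongrightarrow> exp (0 - 0) * 0) at_top"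
    by (rule tendsto_mult)
  then have "((\<lambda>x. exp (R x - R (x + 1/2)) * exp ((x - 1/2) * ln x - x * ln (x + 1/2) + 1/2)) \<longlongrightarrow> 0) at_top" by simp
  moreover have "\<forall>\<^sub>F x in at_top. exp (R x - R (x + 1/2)) * exp ((x - 1/2) * ln x - x * ln (x + 1/2) + 1/2) = Gamma x / Gamma (x + 1/2)"
    using eventually_gt_at_top[of 0]
  proof eventually_elim
    case (elim x)
    have "R x - R (x + 1/2) + ((x - 1/2) * ln x - x * ln (x + 1/2) + 1/2) = ln (Gamma x) - ln (Gamma (x + 1/2))"
      by (simp add: R_def stirling_remainder_def algebra_simps)
    moreover have "exp (ln (Gamma x) - ln (Gamma (x + 1/2))) = Gamma x / Gamma (x + 1/2)"
      using elim by (simp add: exp_diff)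
    ultimately show ?case by (simp only: exp_add[symmetric])
  qed
  ultimately show ?thesis by (rule Lim_transform_eventually)
qed

lemma limit_moment_0: "limit_moment \<alpha> 0 = 1"
  by (simp add: limit_moment_def)

text \<open>Consecutive values of \<open>m\<^sub>s / s!\<close> have the ratio \<open>\<Gamma>(s b) / (\<surd>2 \<Gamma>(s b + 1/2))\<close> with \<open>b = \<alpha> + 1/2\<close>, which tends
  to zero.\<close>
theorem entire_limit_moments:
  assumes "\<alpha> \<ge> 0"
  shows "entire_moments (limit_moment \<alpha>)"
  unfolding entire_moments_def
proof
  fix t :: real
  define b where "b = \<alpha> + 1/2"
  have b: "b > 0" using assms by (simp add: b_def)
  define f where "f s = (\<bar>t\<bar> / sqrt 2) ^ s * (\<Prod>j=1..s. Gamma (real j * b) / Gamma (real j * b + 1/2))" for s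
  have eq: "\<bar>t\<bar> ^ s / fact s * limit_moment \<alpha> s = f s" for s
  proof -
    have "2 powr (real s / 2) = sqrt 2 ^ s"
      by (simp add: powr_half_sqrt[symmetric] powr_powr powr_realpow[symmetric])
    then show ?thesis by (simp add: f_def limit_moment_def b_def power_divide)
  qed
  have "f \<longlonglongrightarrow> 0"
  proof -
    have "(\<lambda>j. \<bar>t\<bar> / sqrt 2 * (Gamma (real (Suc j) * b) / Gamma (real (Suc j) * b + 1/2))) \<longlonglongrightarrow> \<bar>t\<bar> / sqrt 2 * 0"
      by (intro tendsto_intros filterlim_compose[OF Gamma_half_shift_ratio_tendsto_0]) (use b in real_asymp)
    then have "\<forall>\<^sub>F j in sequentially. \<bar>t\<bar> / sqrt 2 * (Gamma (real (Suc j) * b) / Gamma (real (Suc j) * b + 1/2)) < 1/2"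
      by (intro order_tendstoD(2)) auto
    then obtain N where N: "\<And>j. j \<ge> N \<Longrightarrow> \<bar>t\<bar> / sqrt 2 * (Gamma (real (Suc j) * b) / Gamma (real (Suc j) * b + 1/2)) < 1/2"
      by (auto simp: eventually_at_top_linorder)
    have "summable f"
    proof (rule summable_ratio_test[where c = "1/2" and N = N])
      fix n assume n: "n \<ge> N"
      define q where "q = \<bar>t\<bar> / sqrt 2 * (Gamma (real (Suc n) * b) / Gamma (real (Suc n) * b + 1/2))"
      have "real (Suc n) * b > 0" using b by simp
      then have "Gamma (real (Suc n) * b) > 0" "Gamma (real (Suc n) * b + 1/2) > 0"
        by (auto intro!: Gamma_real_pos simp del: of_nat_Suc)
      then have q: "q \<ge> 0" unfolding q_def by (intro mult_nonneg_nonneg divide_nonneg_nonneg) auto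
      have "f (Suc n) = f n * q" unfolding f_def q_def by (simp add: mult_ac)
      then have "norm (f (Suc n)) = norm (f n) * q" using q by (simp add: abs_mult)
      also have "\<dots> \<le> norm (f n) * (1/2)" using N[OF n] unfolding q_def[symmetric] by (intro mult_left_mono) auto
      finally show "norm (f (Suc n)) \<le> 1/2 * norm (f n)" by simp
    qed simp
    then show ?thesis by (rule summable_LIMSEQ_zero)
  qed
  then have "(\<lambda>k. f (2 * k)) \<longlonglongrightarrow> 0"
    by (rule LIMSEQ_subseq_LIMSEQ[unfolded o_def, where f = "\<lambda>k. 2 * k"]) (simp add: strict_mono_def)
  then show "(\<lambda>k. \<bar>t\<bar> ^ (2 * k) / fact (2 * k) * limit_moment \<alpha> (2 * k)) \<longlonglongrightarrow> 0"
    by (simp only: eq)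
qed

lemma has_limit_moments_iff: "has_limit_moments \<alpha> \<nu> \<longleftrightarrow> has_moments (limit_moment \<alpha>) \<nu>"
proof
  assume *: "has_limit_moments \<alpha> \<nu>"
  then interpret real_distribution \<nu> by (simp add: has_limit_moments_def)
  have "integrable \<nu> (\<lambda>y. y ^ s) \<and> (\<integral>y. y ^ s \<partial>\<nu>) = limit_moment \<alpha> s" for s
    using * prob_space by (cases "s = 0") (auto simp: has_limit_moments_def limit_moment_0)
  then show "has_moments (limit_moment \<alpha>) \<nu>"
    using real_distribution_axioms by (simp add: has_moments_def)
qed (auto simp: has_limit_moments_def has_moments_def)

lemma half_line_gaussian_moment:
  "has_bochner_integral lborel (\<lambda>x::real. indicator {0..} x *\<^sub>R (exp (- x\<^sup>2) * x ^ n)) (Gamma ((real n + 1) / 2) / 2)"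
proof (cases "even n")
  case True
  then obtain k where n: "n = 2 * k" by (elim evenE)
  have x: "real k + 1/2 > 0" by simp
  have "Gamma (real k + 1/2) * fact k = exp (- (2 * real k) * ln 2) * sqrt pi * fact (2 * k)"
    using Gamma_legendre_duplication_real[OF x] Gamma_fact[of k, where 'a = real] Gamma_fact[of "2 * k", where 'a = real]
    by (simp add: algebra_simps)
  also have "exp (- (2 * real k) * ln 2) = 1 / 2 ^ (2 * k)"
    using exp_of_nat_mult[of "2 * k" "ln (2::real)"] by (simp add: exp_minus divide_inverse)
  finally have "Gamma (real k + 1/2) = sqrt pi * (fact (2 * k) / (2 ^ (2 * k) * fact k))"
    by (simp add: field_simps)
  moreover have "(real n + 1) / 2 = real k + 1/2" by (simp add: n add_divide_distrib)
  ultimately show ?thesis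
    using gaussian_moment_even_pos[of k] by (simp only: n) (simp add: mult_ac)
next
  case False
  then obtain k where n: "n = 2 * k + 1" by (elim oddE)
  have "(real n + 1) / 2 = 1 + real k" by (simp add: n add_divide_distrib)
  then show ?thesis
    using gaussian_moment_odd_pos[of k] Gamma_fact[of k, where 'a = real] by (simp only: n)
qed

text \<open>The substitution \<open>y = \<surd>2 x\<close> reduces the moments to Gaussian integrals over the half line.\<close>
lemma rayleigh_moment:
  "has_bochner_integral lborel (\<lambda>y::real. (if y \<ge> 0 then y * exp (- y\<^sup>2 / 2) else 0) * y ^ s) (2 powr (real s / 2) * Gamma (real s / 2 + 1))"
proof -
  let ?c = "1 / sqrt 2 :: real"
  have "has_bochner_integral lborel (\<lambda>x. indicator {0..} (0 + ?c * x) *\<^sub>R (exp (- (0 + ?c * x)\<^sup>2) * (0 + ?c * x) ^ (s + 1)))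
     ((Gamma ((real (s + 1) + 1) / 2) / 2) /\<^sub>R \<bar>?c\<bar>)"
    by (subst lborel_has_bochner_integral_real_affine_iff[symmetric]) (use half_line_gaussian_moment[of "s + 1"] in \<open>simp_all only: simp_thms, simp\<close>)
  from has_bochner_integral_mult_right[OF this, of "sqrt 2 ^ (s + 1)"]
  have "has_bochner_integral lborel (\<lambda>x. sqrt 2 ^ (s + 1) * (indicator {0..} (0 + ?c * x) *\<^sub>R (exp (- (0 + ?c * x)\<^sup>2) * (0 + ?c * x) ^ (s + 1))))
     (sqrt 2 ^ (s + 1) * ((Gamma ((real (s + 1) + 1) / 2) / 2) /\<^sub>R \<bar>?c\<bar>))" by simp
  also have "(\<lambda>x. sqrt 2 ^ (s + 1) * (indicator {0..} (0 + ?c * x) *\<^sub>R (exp (- (0 + ?c * x)\<^sup>2) * (0 + ?c * x) ^ (s + 1))))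
     = (\<lambda>y::real. (if y \<ge> 0 then y * exp (- y\<^sup>2 / 2) else 0) * y ^ s)"
  proof
    fix y :: real
    have ind: "indicator {0..} (0 + ?c * y) = (if y \<ge> 0 then 1 else 0 :: real)"
      by (simp add: indicator_def zero_le_divide_iff)
    have "sqrt 2 ^ (s + 1) * (exp (- (0 + ?c * y)\<^sup>2) * (0 + ?c * y) ^ (s + 1))
        = exp (- (?c * y)\<^sup>2) * (sqrt 2 ^ (s + 1) * (?c * y) ^ (s + 1))"
      by (simp only: add_0 mult_ac)
    also have "sqrt 2 ^ (s + 1) * (?c * y) ^ (s + 1) = y ^ (s + 1)"
      unfolding power_mult_distrib[symmetric] by simp
    also have "(?c * y)\<^sup>2 = y\<^sup>2 / 2" by (simp add: power_mult_distrib power_divide)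
    finally have "sqrt 2 ^ (s + 1) * (exp (- (0 + ?c * y)\<^sup>2) * (0 + ?c * y) ^ (s + 1)) = y * exp (- y\<^sup>2 / 2) * y ^ s"
      by simp
    then show "sqrt 2 ^ (s + 1) * (indicator {0..} (0 + ?c * y) *\<^sub>R (exp (- (0 + ?c * y)\<^sup>2) * (0 + ?c * y) ^ (s + 1)))
        = (if y \<ge> 0 then y * exp (- y\<^sup>2 / 2) else 0) * y ^ s"
      unfolding ind by (cases "y \<ge> 0") (simp_all only: if_True if_False scaleR_one scaleR_zero_left mult_zero_left mult_zero_right)
  qed
  also have "sqrt 2 ^ (s + 1) * ((Gamma ((real (s + 1) + 1) / 2) / 2) /\<^sub>R \<bar>?c\<bar>) = 2 powr (real s / 2) * Gamma (real s / 2 + 1)"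
  proof -
    have "sqrt 2 ^ s = 2 powr (real s / 2)"
      by (simp add: powr_half_sqrt[symmetric] powr_powr powr_realpow[symmetric])
    moreover have "(real (s + 1) + 1) / 2 = real s / 2 + 1" by (simp add: add_divide_distrib)
    moreover have "sqrt 2 ^ (s + 1) * ((g / 2) /\<^sub>R \<bar>?c\<bar>) = sqrt 2 ^ s * g" for g :: real
      using real_sqrt_mult_self[of 2] by (simp add: mult_ac)
    ultimately show ?thesis by (simp only:)
  qed
  finally show ?thesis .
qed

text \<open>For \<open>\<alpha> = 0\<close> the product telescopes.\<close>
lemma limit_moment_zero_closed_form:
  "(\<Prod>j=1..s. Gamma (real j * (1/2)) / Gamma (real j * (1/2) + 1/2)) = sqrt pi / Gamma ((real s + 1) / 2)"
proof (induction s)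
  case 0
  show ?case by (simp add: Gamma_one_half_real)
next
  case (Suc s)
  define G H where "G = Gamma ((real s + 1) / 2)" and "H = Gamma ((real (Suc s) + 1) / 2)"
  have "G > 0" by (simp add: G_def)
  have args: "real (Suc s) * (1/2) = (real s + 1) / 2" "(real s + 1) / 2 + 1/2 = (real (Suc s) + 1) / 2"
    by (simp_all add: add_divide_distrib)
  have "(\<Prod>j=1..Suc s. Gamma (real j * (1/2)) / Gamma (real j * (1/2) + 1/2)) =
      (\<Prod>j=1..s. Gamma (real j * (1/2)) / Gamma (real j * (1/2) + 1/2)) *
      (Gamma (real (Suc s) * (1/2)) / Gamma (real (Suc s) * (1/2) + 1/2))"
    by (rule prod.cl_ivl_Suc[THEN trans]) simp
  also have "\<dots> = sqrt pi / G * (G / H)"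
    unfolding Suc.IH args G_def[symmetric] H_def[symmetric] ..
  also have "\<dots> = sqrt pi / H" using \<open>G > 0\<close> by simp
  finally show ?case by (simp only: H_def)
qed

lemma limit_moment_zero: "limit_moment 0 s = 2 powr (real s / 2) * Gamma (real s / 2 + 1)"
proof -
  define x where "x = (real s + 1) / 2"
  have x: "x > 0" by (simp add: x_def)
  have "Gamma x * Gamma (x + 1/2) = exp ((1 - 2*x) * ln 2) * sqrt pi * Gamma (2 * x)"
    by (rule Gamma_legendre_duplication_real[OF x])
  also have "2 * x = 1 + real s" by (simp add: x_def)
  also have "Gamma (1 + real s) = fact s" by (rule Gamma_fact)
  also have "exp ((1 - (1 + real s)) * ln 2) = 2 powr (- real s)" by (simp add: powr_def)
  finally have *: "Gamma x * Gamma (x + 1/2) = 2 powr (- real s) * sqrt pi * fact s" .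
  have "fact s * sqrt pi / Gamma x = 2 powr real s * (2 powr (- real s) * sqrt pi * fact s) / Gamma x"
    by (simp add: powr_minus)
  also have "\<dots> = 2 powr real s * Gamma (x + 1/2)"
    unfolding *[symmetric] using Gamma_real_pos[OF x] by simp
  finally have "fact s * sqrt pi / Gamma x = 2 powr real s * Gamma (x + 1/2)" .
  moreover have "x + 1/2 = real s / 2 + 1" by (simp add: x_def field_simps)
  moreover have "2 powr real s = 2 powr (real s / 2) * (2::real) powr (real s / 2)" by (simp add: powr_add[symmetric])
  moreover have "limit_moment 0 s = fact s * sqrt pi / Gamma x / 2 powr (real s / 2)"
    using limit_moment_zero_closed_form[of s] by (simp add: limit_moment_def x_def)
  ultimately show ?thesis by simp
qed

theorem rayleigh_has_limit_moments: "has_limit_moments 0 rayleigh"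
proof -
  let ?f = "\<lambda>y::real. if y \<ge> 0 then y * exp (- y\<^sup>2 / 2) else 0"
  have [measurable]: "?f \<in> borel_measurable borel" by measurable
  have moments: "has_bochner_integral rayleigh (\<lambda>y. y ^ s) (limit_moment 0 s)" for s
    unfolding rayleigh_def limit_moment_zero
    using rayleigh_moment[of s] by (intro has_bochner_integral_density) auto
  have "prob_space rayleigh"
  proof (rule prob_spaceI)
    have "has_bochner_integral rayleigh (\<lambda>_. 1) (1::real)"
      using moments[of 0] by (simp add: limit_moment_0)
    then have "(\<integral>\<^sup>+y. ennreal 1 \<partial>rayleigh) = ennreal 1"
      by (subst nn_integral_eq_integral) (auto simp: has_bochner_integral_iff)
    then show "emeasure rayleigh (space rayleigh) = 1" by simp
  qed
  then have "real_distribution rayleigh"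
    by (intro real_distribution.intro real_distribution_axioms.intro) (simp_all add: rayleigh_def)
  then show ?thesis
    unfolding has_limit_moments_def using moments[unfolded has_bochner_integral_iff] by blast
qed

section \<open>Very simple families\<close>

lemma coeff_recurrence_of_ode:
  assumes "(1 + fps_const c * fps_X) * fps_deriv F = fps_const a * (F :: real fps)"
  shows "real (Suc k) * fps_nth F (Suc k) = (a - c * real k) * fps_nth F k"
proof -
  have "real (Suc k) * fps_nth F (Suc k) + c * real k * fps_nth F k = a * fps_nth F k"
    using arg_cong[OF assms, of "\<lambda>G. fps_nth G k"]
    by (cases k) (simp_all add: distrib_right mult.assoc)
  then show ?thesis by (simp add: algebra_simps)
qed

theorem very_simple_linear_ratio:
  assumes "very_simple \<Phi>"
  obtains \<alpha>\<^sub>0 a\<^sub>0 where "linear_ratio_family \<Phi> \<alpha>\<^sub>0 a\<^sub>0"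
proof -
  define \<alpha>\<^sub>0 where "\<alpha>\<^sub>0 = coeff_ratio \<Phi> 0"
  define c where "c = 2 * coeff_ratio \<Phi> 1 - \<alpha>\<^sub>0"
  have base: "fps_nth \<Phi> 0 = 1" "\<And>k. fps_nth \<Phi> k \<ge> 0" "\<alpha>\<^sub>0 > 0"
    using assms by (auto simp: very_simple_def simply_generated_def Let_def \<alpha>\<^sub>0_def)
  have "\<Phi> = fps_exp \<alpha>\<^sub>0 \<or> (\<exists>d\<ge>2. \<Phi> = (1 + fps_const (\<alpha>\<^sub>0 / of_nat d) * fps_X) ^ d) \<or>
      (c > 0 \<and> \<Phi> = fps_compose (fps_binomial (- \<alpha>\<^sub>0 / c)) (fps_const (- c) * fps_X))"
    using assms unfolding very_simple_def Let_def \<alpha>\<^sub>0_def[symmetric] c_def[symmetric] by blast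
  then consider (A) "\<Phi> = fps_exp \<alpha>\<^sub>0"
    | (B) d where "d \<ge> 2" "\<Phi> = (1 + fps_const (\<alpha>\<^sub>0 / of_nat d) * fps_X) ^ d"
    | (C) "c > 0" "\<Phi> = fps_compose (fps_binomial (- \<alpha>\<^sub>0 / c)) (fps_const (- c) * fps_X)"
    by blast
  then show ?thesis
  proof cases
    case A
    have "real (Suc k) * fps_nth \<Phi> (Suc k) = (\<alpha>\<^sub>0 - 0 * real k) * fps_nth \<Phi> k" for k
      by (rule coeff_recurrence_of_ode) (simp add: A)
    then have "linear_ratio_family \<Phi> \<alpha>\<^sub>0 0"
      using base by unfold_locales auto
    then show ?thesis by (rule that)
  next
    case B
    define b where "b = \<alpha>\<^sub>0 / real d"
    obtain k where k: "d = Suc k" using B(1) by (cases d) auto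
    have bd: "real d * b = \<alpha>\<^sub>0" using B(1) by (simp add: b_def)
    have phi: "\<Phi> = (1 + fps_const b * fps_X) ^ d" unfolding B(2) b_def ..
    have "(1 + fps_const b * fps_X) * fps_deriv \<Phi> = of_nat d * fps_const b * \<Phi>"
      unfolding phi k fps_deriv_power_Suc by (simp add: mult_ac)
    also have "of_nat d * fps_const b = fps_const \<alpha>\<^sub>0"
      unfolding bd[symmetric] by (simp add: fps_of_nat[symmetric])
    finally have "real (Suc k) * fps_nth \<Phi> (Suc k) = (\<alpha>\<^sub>0 - b * real k) * fps_nth \<Phi> k" for k
      by (rule coeff_recurrence_of_ode)
    moreover have "b < \<alpha>\<^sub>0" using B(1) base(3) by (simp add: b_def field_simps)
    ultimately have "linear_ratio_family \<Phi> \<alpha>\<^sub>0 b"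
      using base by unfold_locales auto
    then show ?thesis by (rule that)
  next
    case C
    define r where "r = - \<alpha>\<^sub>0 / c"
    have nth: "fps_nth \<Phi> k = (- c) ^ k * (r gchoose k)" for k
      unfolding C(2) r_def[symmetric] by (simp only: fps_compose_linear fps_nth_Abs_fps fps_binomial_nth)
    have "real (Suc k) * fps_nth \<Phi> (Suc k) = (\<alpha>\<^sub>0 - (- c) * real k) * fps_nth \<Phi> k" for k
    proof -
      have "real (Suc k) * (r gchoose Suc k) = (r - real k) * (r gchoose k)"
        using gbinomial_mult_1[of r k] by (simp add: algebra_simps)
      then have "real (Suc k) * fps_nth \<Phi> (Suc k) = (- c) * (r - real k) * fps_nth \<Phi> k"
        unfolding nth by (simp del: of_nat_Suc add: mult_ac)
      also have "(- c) * (r - real k) = \<alpha>\<^sub>0 - (- c) * real k"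
        using C(1) by (simp add: r_def algebra_simps)
      finally show ?thesis .
    qed
    then have "linear_ratio_family \<Phi> \<alpha>\<^sub>0 (- c)"
      using base C(1) by unfold_locales auto
    then show ?thesis by (rule that)
  qed
qed

lemma moment_coeff_eq_limit_moment:
  "moment_coeff \<sigma> (\<alpha> + 1/2) s = \<sigma> ^ s * limit_moment \<alpha> s"
  by (simp add: moment_coeff_def limit_moment_def)

lemma moment_coeff_half:
  "moment_coeff \<sigma> (1/2) s = fact s * \<sigma> ^ s * sqrt pi / (2 powr (real s / 2) * Gamma ((real s + 1) / 2))"
  unfolding moment_coeff_def limit_moment_zero_closed_form by simp

definition normalised_cost :: "real fps \<Rightarrow> real \<Rightarrow> nat \<Rightarrow> real measure" where
  "normalised_cost \<Phi> \<alpha> n = distr (measure_pmf (power_cost \<Phi> \<alpha> n)) borel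
     (\<lambda>y. inverse (scaling_sigma \<Phi>) * real n powr (- (\<alpha> + 1/2)) * y)"

context linear_ratio_family
begin

lemma cost_moment_bigo:
  assumes \<alpha>: "\<alpha> \<ge> 0" and q: "if \<alpha> \<in> {0, 1/2} then \<exists>\<epsilon>>0. q = 1/2 - \<epsilon> else q = min \<alpha> (1/2)"
  shows "(\<lambda>n. cost_moment \<Phi> \<alpha> s n - moment_coeff (scaling_sigma \<Phi>) (\<alpha> + 1/2) s * real n powr (real s * (\<alpha> + 1/2)))
     \<in> O(\<lambda>n. real n powr (real s * (\<alpha> + 1/2) - q))"
proof -
  let ?e = "real s * (\<alpha> + 1/2)"
  obtain K where "\<And>n. n \<ge> 1 \<Longrightarrow> \<bar>cost_moment \<Phi> \<alpha> s n - moment_coeff (scaling_sigma \<Phi>) (\<alpha> + 1/2) s * real n powr ?e\<bar>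
     \<le> K * (real n powr (?e - 1/2) * log_factor \<alpha> n)"
    using cost_moment_asymptotics[OF \<alpha>] by blast
  then have "(\<lambda>n. cost_moment \<Phi> \<alpha> s n - moment_coeff (scaling_sigma \<Phi>) (\<alpha> + 1/2) s * real n powr ?e)
     \<in> O(\<lambda>n. real n powr (?e - 1/2) * log_factor \<alpha> n)"
  proof (rule bigoI_nat)
    show "real n powr (?e - 1/2) * log_factor \<alpha> n \<ge> 0" if "n \<ge> 1" for n
      using log_factor_ge_1[OF that, of \<alpha>] by (intro mult_nonneg_nonneg) auto
  qed
  also have "(\<lambda>n. real n powr (?e - 1/2) * log_factor \<alpha> n) \<in> O(\<lambda>n. real n powr (?e - q))"
  proof (cases "\<alpha> = 0")
    case True
    with q obtain \<epsilon> where \<epsilon>: "\<epsilon> > 0" "q = 1/2 - \<epsilon>" by auto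
    have "(\<lambda>n. 1 + ln (real n)) \<in> O(\<lambda>n. real n powr \<epsilon>)" using \<epsilon>(1) by real_asymp
    then have "(\<lambda>n. real n powr (?e - 1/2) * (1 + ln (real n))) \<in> O(\<lambda>n. real n powr (?e - 1/2) * real n powr \<epsilon>)"
      by (intro landau_o.big.mult) auto
    moreover have "?e - 1/2 + \<epsilon> = ?e - q" by (simp add: \<epsilon>(2))
    then have "real n powr (?e - 1/2) * real n powr \<epsilon> = real n powr (?e - q)" for n
      by (simp only: powr_add[symmetric])
    ultimately show ?thesis using True by (simp only: log_factor_def simp_thms if_True)
  next
    case False
    have "q \<le> 1/2" using q by (auto split: if_splits)
    then show ?thesis
      using False by (intro bigoI_nat[of _ 1]) (auto simp: log_factor_def intro!: powr_mono)
  qed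
  finally show ?thesis .
qed

lemma normalised_cost_props:
  assumes \<alpha>: "\<alpha> \<ge> 0"
  shows "real_distribution (normalised_cost \<Phi> \<alpha> n)"
    and "integrable (normalised_cost \<Phi> \<alpha> n) (\<lambda>y. y ^ s)"
    and "(\<lambda>n. \<integral>y. y ^ s \<partial>normalised_cost \<Phi> \<alpha> n) \<longlonglongrightarrow> limit_moment \<alpha> s"
proof -
  define \<sigma> where "\<sigma> = scaling_sigma \<Phi>"
  let ?b = "\<alpha> + 1/2"
  have \<sigma>: "\<sigma> > 0" by (simp add: \<sigma>_def scaling_sigma_pos)
  show "real_distribution (normalised_cost \<Phi> \<alpha> n)"
    unfolding normalised_cost_def by (rule prob_space.real_distribution_distr[OF prob_space_measure_pmf]) simp
  have "integrable (power_cost \<Phi> \<alpha> n) (\<lambda>y. (inverse \<sigma> * real n powr (- ?b) * y) ^ s)"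
  proof (cases "n = 0")
    \<comment> \<open>There is no tree of size zero, so the law of the cost is unspecified there, but the scaling factor
      is then \<open>0 powr x = 0\<close>.\<close>
    case True
    then show ?thesis by simp
  next
    case False
    then have "finite (set_pmf (power_cost \<Phi> \<alpha> n))"
      unfolding power_cost_def by (intro finite_total_cost) auto
    then show ?thesis by (rule integrable_measure_pmf_finite)
  qed
  then show "integrable (normalised_cost \<Phi> \<alpha> n) (\<lambda>y. y ^ s)"
    unfolding normalised_cost_def \<sigma>_def by (subst integrable_distr_eq) simp_all
  obtain K where K: "\<And>n. n \<ge> 1 \<Longrightarrow> \<bar>cost_moment \<Phi> \<alpha> s n - moment_coeff \<sigma> ?b s * real n powr (real s * ?b)\<bar>
     \<le> K * (real n powr (real s * ?b - 1/2) * log_factor \<alpha> n)"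
    using cost_moment_asymptotics[OF \<alpha>] unfolding \<sigma>_def by blast
  have moment: "(\<integral>y. y ^ s \<partial>normalised_cost \<Phi> \<alpha> n) = inverse \<sigma> ^ s * real n powr (- (real s * ?b)) * cost_moment \<Phi> \<alpha> s n"
    if n: "n \<ge> 1" for n
  proof -
    have "(\<integral>y. y ^ s \<partial>normalised_cost \<Phi> \<alpha> n) = (\<integral>y. (inverse \<sigma> * real n powr (- ?b)) ^ s * y ^ s \<partial>power_cost \<Phi> \<alpha> n)"
      unfolding normalised_cost_def \<sigma>_def[symmetric] by (subst integral_distr) (simp_all add: power_mult_distrib)
    also have "\<dots> = (inverse \<sigma> * real n powr (- ?b)) ^ s * cost_moment \<Phi> \<alpha> s n"
      by (simp add: cost_moment_def)
    also have "(inverse \<sigma> * real n powr (- ?b)) ^ s = inverse \<sigma> ^ s * real n powr (- (real s * ?b))"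
      using n by (simp add: power_mult_distrib powr_realpow[symmetric] powr_powr algebra_simps)
    finally show ?thesis .
  qed
  have bound: "\<bar>(\<integral>y. y ^ s \<partial>normalised_cost \<Phi> \<alpha> n) - limit_moment \<alpha> s\<bar> \<le> inverse \<sigma> ^ s * \<bar>K\<bar> * (real n powr (-1/2) * (1 + ln (real n)))"
    if n: "n \<ge> 1" for n
  proof -
    define c where "c = inverse \<sigma> ^ s * real n powr (- (real s * ?b))"
    have c: "c \<ge> 0" using \<sigma> by (simp add: c_def)
    have p: "real n powr (- (real s * ?b)) * real n powr (real s * ?b) = 1"
      "real n powr (- (real s * ?b)) * real n powr (real s * ?b - 1/2) = real n powr (-1/2)"
      using n unfolding powr_add[symmetric] by simp_all
    have "c * (moment_coeff \<sigma> ?b s * real n powr (real s * ?b)) = (inverse \<sigma> ^ s * \<sigma> ^ s) * (real n powr (- (real s * ?b)) * real n powr (real s * ?b)) * limit_moment \<alpha> s"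
      by (simp only: c_def moment_coeff_eq_limit_moment mult_ac)
    also have "inverse \<sigma> ^ s * \<sigma> ^ s = 1" using \<sigma> by (simp add: power_mult_distrib[symmetric])
    finally have "limit_moment \<alpha> s = c * (moment_coeff \<sigma> ?b s * real n powr (real s * ?b))" by (simp only: p mult_1)
    then have "\<bar>(\<integral>y. y ^ s \<partial>normalised_cost \<Phi> \<alpha> n) - limit_moment \<alpha> s\<bar> = \<bar>c * (cost_moment \<Phi> \<alpha> s n - moment_coeff \<sigma> ?b s * real n powr (real s * ?b))\<bar>"
      unfolding moment[OF n] c_def[symmetric] by (simp only: right_diff_distrib)
    also have "\<dots> = c * \<bar>cost_moment \<Phi> \<alpha> s n - moment_coeff \<sigma> ?b s * real n powr (real s * ?b)\<bar>"
      using c by (simp add: abs_mult)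
    also have "\<dots> \<le> c * (\<bar>K\<bar> * (real n powr (real s * ?b - 1/2) * (1 + ln (real n))))"
    proof (rule mult_left_mono[OF order.trans[OF K[OF n]] c])
      have "log_factor \<alpha> n \<le> 1 + ln (real n)" "log_factor \<alpha> n \<ge> 0" using n by (auto simp: log_factor_def)
      then show "K * (real n powr (real s * ?b - 1/2) * log_factor \<alpha> n) \<le> \<bar>K\<bar> * (real n powr (real s * ?b - 1/2) * (1 + ln (real n)))"
        by (intro mult_mono) auto
    qed
    also have "\<dots> = inverse \<sigma> ^ s * \<bar>K\<bar> * ((real n powr (- (real s * ?b)) * real n powr (real s * ?b - 1/2)) * (1 + ln (real n)))"
      unfolding c_def by (simp only: mult_ac)
    finally show ?thesis unfolding p(2) .
  qed
  have "(\<lambda>n. real n powr (-1/2) * (1 + ln (real n))) \<longlonglongrightarrow> 0" by real_asymp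
  then have "(\<lambda>n. inverse \<sigma> ^ s * \<bar>K\<bar> * (real n powr (-1/2) * (1 + ln (real n)))) \<longlonglongrightarrow> 0"
    by (rule tendsto_mult_right_zero)
  then have "(\<lambda>n. (\<integral>y. y ^ s \<partial>normalised_cost \<Phi> \<alpha> n) - limit_moment \<alpha> s) \<longlonglongrightarrow> 0"
    by (rule Lim_null_comparison[rotated]) (use bound in \<open>auto simp: eventually_at_top_linorder intro!: exI[of _ 1]\<close>)
  then show "(\<lambda>n. \<integral>y. y ^ s \<partial>normalised_cost \<Phi> \<alpha> n) \<longlonglongrightarrow> limit_moment \<alpha> s"
    by (rule LIM_zero_cancel)
qed

lemma cost_limit_law:
  assumes \<alpha>: "\<alpha> \<ge> 0"
  shows "\<exists>\<nu>. has_limit_moments \<alpha> \<nu> \<and> (\<forall>\<nu>'. has_limit_moments \<alpha> \<nu>' \<longrightarrow> \<nu>' = \<nu>)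
    \<and> weak_conv_m (normalised_cost \<Phi> \<alpha>) \<nu> \<and> (\<alpha> = 0 \<longrightarrow> \<nu> = rayleigh)"
proof -
  obtain \<nu> where \<nu>: "has_moments (limit_moment \<alpha>) \<nu>" "weak_conv_m (normalised_cost \<Phi> \<alpha>) \<nu>"
    by (rule method_of_moments[OF normalised_cost_props[OF \<alpha>] entire_limit_moments[OF \<alpha>]])
  have unique: "\<nu>' = \<nu>" if "has_limit_moments \<alpha> \<nu>'" for \<nu>'
    using that moments_determine_distribution[OF \<nu>(1) _ entire_limit_moments[OF \<alpha>]]
    by (simp add: has_limit_moments_iff)
  moreover have "\<nu> = rayleigh" if "\<alpha> = 0"
    using unique[of rayleigh] rayleigh_has_limit_moments that by simp
  ultimately show ?thesis
    using \<nu> has_limit_moments_iff by blast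
qed

lemma cost_moment_relative_error:
  "\<exists>r. r \<in> O(\<lambda>n. ln (real n) / sqrt (real n)) \<and>
     (\<forall>\<^sub>F n in sequentially. cost_moment \<Phi> 0 s n = moment_coeff (scaling_sigma \<Phi>) (1/2) s * real n powr (real s / 2) * (1 + r n))"
proof -
  define c where "c = moment_coeff (scaling_sigma \<Phi>) (1/2) s"
  define r where "r n = (cost_moment \<Phi> 0 s n - c * real n powr (real s / 2)) / (c * real n powr (real s / 2))" for n
  have c: "c > 0"
  proof -
    have "Gamma ((real s + 1) / 2) > 0" by simp
    then show ?thesis unfolding c_def moment_coeff_half using scaling_sigma_pos by simp
  qed
  obtain K where K: "\<And>n. n \<ge> 1 \<Longrightarrow> \<bar>cost_moment \<Phi> 0 s n - c * real n powr (real s / 2)\<bar>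
     \<le> K * (real n powr (real s / 2 - 1/2) * (1 + ln (real n)))"
    using cost_moment_asymptotics[of 0 s] by (auto simp: c_def log_factor_def)
  have "r \<in> O(\<lambda>n. real n powr (-1/2) * (1 + ln (real n)))"
  proof (rule bigoI_nat)
    fix n :: nat assume n: "n \<ge> 1"
    have "\<bar>r n\<bar> = \<bar>cost_moment \<Phi> 0 s n - c * real n powr (real s / 2)\<bar> / (c * real n powr (real s / 2))"
      using c by (simp add: r_def abs_mult)
    also have "\<dots> \<le> K * (real n powr (real s / 2 - 1/2) * (1 + ln (real n))) / (c * real n powr (real s / 2))"
      using K[OF n] c by (intro divide_right_mono) auto
    also have "\<dots> = K / c * (real n powr (real s / 2 - 1/2) / real n powr (real s / 2) * (1 + ln (real n)))" by simp
    also have "real n powr (real s / 2 - 1/2) / real n powr (real s / 2) = real n powr (-1/2)"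
      by (simp add: powr_diff[symmetric])
    finally show "\<bar>r n\<bar> \<le> K / c * (real n powr (-1/2) * (1 + ln (real n)))" .
  qed auto
  also have "(\<lambda>n. real n powr (-1/2) * (1 + ln (real n))) \<in> O(\<lambda>n. ln (real n) / sqrt (real n))" by real_asymp
  finally have "r \<in> O(\<lambda>n. ln (real n) / sqrt (real n))" .
  moreover have "\<forall>\<^sub>F n in sequentially. cost_moment \<Phi> 0 s n = c * real n powr (real s / 2) * (1 + r n)"
    using eventually_ge_at_top[of 1]
  proof eventually_elim
    case (elim n)
    then show ?case using c by (simp add: r_def distrib_left)
  qed
  ultimately show ?thesis unfolding c_def by blast
qed

end

theorem theorem5p1:
  fixes \<Phi> :: "real fps" and \<alpha> \<alpha>' \<sigma> :: real
  assumes "very_simple \<Phi>" and "\<alpha> \<ge> 0"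
    and "\<sigma> = scaling_sigma \<Phi>" and "\<alpha>' = \<alpha> + 1/2"
  shows
    "(\<forall>s\<ge>1. \<forall>q.
        (if \<alpha> \<in> {0, 1/2} then \<exists>\<epsilon>>0. q = 1/2 - \<epsilon> else q = min \<alpha> (1/2)) \<longrightarrow>
        (\<lambda>n. cost_moment \<Phi> \<alpha> s n
             - fact s * \<sigma> ^ s / 2 powr (real s / 2)
               * (\<Prod>j=1..s. Gamma (real j * \<alpha>') / Gamma (real j * \<alpha>' + 1/2))
               * real n powr (real s * \<alpha>'))
          \<in> O(\<lambda>n. real n powr (real s * \<alpha>' - q)))
     \<and> (\<exists>\<nu>. has_limit_moments \<alpha> \<nu>
           \<and> (\<forall>\<nu>'. has_limit_moments \<alpha> \<nu>' \<longrightarrow> \<nu>' = \<nu>)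
           \<and> weak_conv_m
               (\<lambda>n. distr (measure_pmf (power_cost \<Phi> \<alpha> n)) borel
                      (\<lambda>y. inverse \<sigma> * real n powr (- \<alpha>') * y)) \<nu>
           \<and> (\<alpha> = 0 \<longrightarrow> \<nu> = rayleigh))
     \<and> (\<alpha> = 0 \<longrightarrow>
         (\<forall>s\<ge>1. \<exists>r. r \<in> O(\<lambda>n. ln (real n) / sqrt (real n)) \<and>
           (\<forall>\<^sub>F n in sequentially. cost_moment \<Phi> \<alpha> s n =
              fact s * \<sigma> ^ s * sqrt pi / (2 powr (real s / 2) * Gamma ((real s + 1) / 2))
              * real n powr (real s / 2) * (1 + r n))))"
proof -
  obtain \<alpha>\<^sub>0 a\<^sub>0 where "linear_ratio_family \<Phi> \<alpha>\<^sub>0 a\<^sub>0"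
    by (rule very_simple_linear_ratio[OF assms(1)])
  then interpret linear_ratio_family \<Phi> \<alpha>\<^sub>0 a\<^sub>0 .
  note \<sigma> = assms(3) and b = assms(4)
  show ?thesis
  proof (intro conjI allI impI)
    fix s :: nat and q
    assume "if \<alpha> \<in> {0, 1/2} then \<exists>\<epsilon>>0. q = 1/2 - \<epsilon> else q = min \<alpha> (1/2)"
    from cost_moment_bigo[OF assms(2) this, of s]
    show "(\<lambda>n. cost_moment \<Phi> \<alpha> s n
             - fact s * \<sigma> ^ s / 2 powr (real s / 2)
               * (\<Prod>j=1..s. Gamma (real j * \<alpha>') / Gamma (real j * \<alpha>' + 1/2))
               * real n powr (real s * \<alpha>'))
          \<in> O(\<lambda>n. real n powr (real s * \<alpha>' - q))"
      unfolding moment_coeff_def \<sigma> b .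
  next
    show "\<exists>\<nu>. has_limit_moments \<alpha> \<nu>
           \<and> (\<forall>\<nu>'. has_limit_moments \<alpha> \<nu>' \<longrightarrow> \<nu>' = \<nu>)
           \<and> weak_conv_m
               (\<lambda>n. distr (measure_pmf (power_cost \<Phi> \<alpha> n)) borel
                      (\<lambda>y. inverse \<sigma> * real n powr (- \<alpha>') * y)) \<nu>
           \<and> (\<alpha> = 0 \<longrightarrow> \<nu> = rayleigh)"
      unfolding \<sigma> b using cost_limit_law[OF assms(2)] unfolding normalised_cost_def[abs_def] .
  next
    fix s :: nat
    assume "\<alpha> = 0"
    then show "\<exists>r. r \<in> O(\<lambda>n. ln (real n) / sqrt (real n)) \<and>
           (\<forall>\<^sub>F n in sequentially. cost_moment \<Phi> \<alpha> s n =
              fact s * \<sigma> ^ s * sqrt pi / (2 powr (real s / 2) * Gamma ((real s + 1) / 2))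
              * real n powr (real s / 2) * (1 + r n))"
      using cost_moment_relative_error[of s] unfolding moment_coeff_half \<sigma> by simp
  qed
qed

end
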